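(* Let $\zeta\in NBV([0,1];\mathbb R^{n\times n})$, $Y=B([-1,0];\mathbb R^n)$ and $Y^\diamond=NBV([0,1];\mathbb R^n)$ with pairing $\langle y^\diamond,y\rangle=\int_{[0,1]}dy^\diamond(\sigma)\cdot y(-\sigma)$. For $\varphi\in Y$ let $x(\cdot;\varphi)$ be the solution of the retarded functional differential equation $$\dot x(t)=\int_{[0,1]}d\zeta(\sigma)\,x(t-\sigma)\quad(t\ge0),\qquad x(\theta)=\varphi(\theta)\quad(-1\le\theta\le0),$$ and define $S(t):Y\to Y$, $t\ge0$, by $(S(t)\varphi)(\theta)=x(t+\theta;\varphi)$, $-1\le\theta\le0$. Then $\{S(t)\}_{t\ge0}$ is a twin semigroup on the norming dual pair $(Y,Y^\diamond)$.
   Context: $B([-1,0];\mathbb R^n)$: bounded Borel functions with the supremum norm. $NBV([0,1])$: functions $f$ of bounded variation on $[0,1]$ with $f(0)=0$, right-continuous on $(0,1)$, with total variation norm; $df$ is the measure on $[0,1]$ with $df([0,t])=f(t)$ for $0<t\le1$. The solution $x(\cdot;\varphi)$ is the unique locally bounded Borel function on $[-1,\infty)$ with $x=\varphi$ on $[-1,0]$ and $x(t)=\varphi(0)+\int_0^t\int_{[0,1]}d\zeta(\sigma)x(s-\sigma)\,ds$ for $t\ge0$. Banach spaces $Y,Y^\diamond$ form a norming dual pair if there is a bilinear map $\langle\cdot,\cdot\rangle:Y^\diamond\times Y\to\mathbb R$ with $|\langle y^\diamond,y\rangle|\le M\|y^\diamond\|\|y\|$ for some $M\ge1$, $\|y\|=\sup\{|\langle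 y^\diamond,y\rangle|:\|y^\diamond\|\le1\}$ and $\|y^\diamond\|=\sup\{|\langle y^\diamond,y\rangle|:\|y\|\le1\}$. A twin operator $L$ is a bounded bilinear map $Y^\diamond\times Y\to\mathbb R$, $(y^\diamond,y)\mapsto y^\diamond Ly$, such that for each $y$ there is $Ly\in Y$ with $\langle y^\diamond,Ly\rangle=y^\diamond Ly$ for all $y^\diamond$, and for each $y^\diamond$ there is $y^\diamond L\in Y^\diamond$ with $\langle y^\diamond L,y\rangle=y^\diamond Ly$ for all $y$; a bounded linear $L:Y\to Y$ is identified with the bilinear map $\langle y^\diamond,Ly\rangle$. Composition: $y^\diamond L_1L_2y:=\langle y^\diamond L_1,L_2y\rangle$. A twin semigroup is a family $\{S(t)\}_{t\ge0}$ of twin operators with: (i) $S(0)=I$, $S(t+s)=S(t)S(s)$; (ii) $|y^\diamond S(t)y|\le Me^{\omega t}\|y\|\|y^\diamond\|$ for some $M\ge1,\omega\in\mathbb R$; (iii) $t\mapsto y^\diamond S(t)y$ is (Borel) measurable for all $y,y^\diamond$; (iv) for $\operatorname{Re}\lambda>\omega$ there is a twin operator $\overline S(\lambda)$ (on the complexification if $\lambda$ is non-real) with $y^\diamond\overline S(\lambda)y=\int_0^\infty e^{-\lambda t}y^\diamond S(t)y\,dt$. *)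

theory Defs
  imports "HOL-Analysis.Analysis"
begin

section \<open>Bounded Borel functions on $[-1,0]$\<close>

text \<open>
  A function on $[-1,0]$ is represented by its extension by zero to the real line.
\<close>

typedef (overloaded) ('a::euclidean_space) bounded_borel =
  "{f :: real \<Rightarrow> 'a. f \<in> borel_measurable borel \<and> bounded (f ` {-1..0}) \<and> (\<forall>x. x \<notin> {-1..0} \<longrightarrow> f x = 0)}"
  morphisms apply_bb Abs_bb
  by (intro exI[of _ "\<lambda>_. 0"]) (auto simp: image_constant_conv)

setup_lifting type_definition_bounded_borel

lemma apply_bb_measurable [measurable]: "apply_bb f \<in> borel_measurable borel"
  and bounded_apply_bb: "bounded (apply_bb f ` {-1..0})"
  and apply_bb_outside: "x \<notin> {-1..0} \<Longrightarrow> apply_bb f x = 0"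
  using apply_bb[of f] by auto

lemma bb_eqI: "(\<And>x. x \<in> {-1..0} \<Longrightarrow> apply_bb f x = apply_bb g x) \<Longrightarrow> f = g"
  by (metis apply_bb_inject apply_bb_outside ext)

instantiation bounded_borel :: (euclidean_space) real_vector
begin

lift_definition zero_bounded_borel :: "'a bounded_borel" is "\<lambda>_. 0"
  by (auto simp: image_constant_conv)
lift_definition plus_bounded_borel :: "'a bounded_borel \<Rightarrow> 'a bounded_borel \<Rightarrow> 'a bounded_borel"
  is "\<lambda>f g x. f x + g x" by (auto intro: bounded_plus_comp)
lift_definition minus_bounded_borel :: "'a bounded_borel \<Rightarrow> 'a bounded_borel \<Rightarrow> 'a bounded_borel"
  is "\<lambda>f g x. f x - g x" by (auto intro: bounded_minus_comp)
lift_definition uminus_bounded_borel :: "'a bounded_borel \<Rightarrow> 'a bounded_borel"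
  is "\<lambda>f x. - f x" by (auto simp: bounded_iff)
lift_definition scaleR_bounded_borel :: "real \<Rightarrow> 'a bounded_borel \<Rightarrow> 'a bounded_borel"
  is "\<lambda>r f x. r *\<^sub>R f x" by (auto intro: bounded_scaleR_comp)

lemmas bb_simps [simp] = zero_bounded_borel.rep_eq plus_bounded_borel.rep_eq
  minus_bounded_borel.rep_eq uminus_bounded_borel.rep_eq scaleR_bounded_borel.rep_eq

instance
  by standard (auto intro!: bb_eqI simp: algebra_simps)

end

instantiation bounded_borel :: (euclidean_space) real_normed_vector
begin

definition norm_bounded_borel :: "'a bounded_borel \<Rightarrow> real"
  where "norm_bounded_borel f = (SUP \<theta>\<in>{-1..0}. norm (apply_bb f \<theta>))"
definition sgn_bounded_borel :: "'a bounded_borel \<Rightarrow> 'a bounded_borel"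
  where "sgn_bounded_borel f = f /\<^sub>R norm f"
definition dist_bounded_borel :: "'a bounded_borel \<Rightarrow> 'a bounded_borel \<Rightarrow> real"
  where "dist_bounded_borel f g = norm (f - g)"
definition uniformity_bounded_borel :: "('a bounded_borel \<times> 'a bounded_borel) filter"
  where "uniformity_bounded_borel = (INF e\<in>{0 <..}. principal {(x, y). dist x y < e})"
definition open_bounded_borel :: "'a bounded_borel set \<Rightarrow> bool"
  where "open_bounded_borel S = (\<forall>x\<in>S. \<forall>\<^sub>F (x', y) in uniformity. x' = x \<longrightarrow> y \<in> S)"

lemma norm_bb_upper: "norm (apply_bb f x) \<le> norm f"
proof (cases "x \<in> {-1..0}")
  case True
  have "bdd_above ((\<lambda>x. norm (apply_bb f x)) ` {-1..0})"
    using bounded_apply_bb[of f] by (auto simp: bounded_iff bdd_above_def)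
  with True show ?thesis
    unfolding norm_bounded_borel_def by (intro cSUP_upper)
next
  case False
  have "bdd_above ((\<lambda>x. norm (apply_bb f x)) ` {-1..0})"
    using bounded_apply_bb[of f] by (auto simp: bounded_iff bdd_above_def)
  then have "norm (apply_bb f 0) \<le> norm f"
    unfolding norm_bounded_borel_def by (intro cSUP_upper) auto
  with False show ?thesis
    by (simp add: apply_bb_outside order_trans[OF norm_ge_zero])
qed

lemma norm_bb_least: "(\<And>x. x \<in> {-1..0} \<Longrightarrow> norm (apply_bb f x) \<le> b) \<Longrightarrow> norm f \<le> b"
  unfolding norm_bounded_borel_def by (rule cSUP_least) auto

lemma norm_bb_scaleR_le: "norm (a *\<^sub>R f) \<le> \<bar>a\<bar> * norm (f :: 'a bounded_borel)"
  by (intro norm_bb_least) (auto intro!: mult_left_mono norm_bb_upper)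

instance
proof
  fix a :: real and f g :: "'a bounded_borel"
  show "norm f = 0 \<longleftrightarrow> f = 0"
  proof
    assume "norm f = 0"
    then show "f = 0"
      using norm_bb_upper[of f] by (intro bb_eqI) auto
  next
    assume "f = 0"
    then have "norm f \<le> 0" by (intro norm_bb_least) auto
    moreover have "0 \<le> norm f"
      using norm_bb_upper[of f 0] by (rule order_trans[OF norm_ge_zero])
    ultimately show "norm f = 0" by simp
  qed
  show "norm (f + g) \<le> norm f + norm g"
    by (intro norm_bb_least) (auto intro!: norm_triangle_le add_mono norm_bb_upper)
  show "norm (a *\<^sub>R f) = \<bar>a\<bar> * norm f"
  proof (cases "a = 0")
    case True
    then have "norm (a *\<^sub>R f) \<le> 0" by (intro norm_bb_least) auto
    moreover have "0 \<le> norm (a *\<^sub>R f)"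
      using norm_bb_upper[of "a *\<^sub>R f" 0] by (rule order_trans[OF norm_ge_zero])
    ultimately show ?thesis using True by simp
  next
    case False
    have "norm f = norm (inverse a *\<^sub>R a *\<^sub>R f)" using False by simp
    also have "\<dots> \<le> \<bar>inverse a\<bar> * norm (a *\<^sub>R f)" by (rule norm_bb_scaleR_le)
    finally have "\<bar>a\<bar> * norm f \<le> norm (a *\<^sub>R f)"
      using False by (simp add: field_simps)
    with norm_bb_scaleR_le[of a f] show ?thesis by simp
  qed
qed (simp_all add: sgn_bounded_borel_def dist_bounded_borel_def
      uniformity_bounded_borel_def open_bounded_borel_def)

end

instance bounded_borel :: (euclidean_space) banach
proof
  fix X :: "nat \<Rightarrow> 'a bounded_borel"
  assume X: "Cauchy X"
  have le: "norm (apply_bb (X m) x - apply_bb (X n) x) \<le> norm (X m - X n)" for m n x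
    using norm_bb_upper[of "X m - X n" x] by simp
  have "Cauchy (\<lambda>n. apply_bb (X n) x)" for x
    using X unfolding Cauchy_def dist_norm by (meson le le_less_trans)
  then have "\<exists>g. \<forall>x. (\<lambda>n. apply_bb (X n) x) \<longlonglongrightarrow> g x"
    by (intro choice) (auto simp: Cauchy_convergent_iff convergent_def)
  then obtain g where g: "\<And>x. (\<lambda>n. apply_bb (X n) x) \<longlonglongrightarrow> g x" by auto
  obtain K where K: "\<And>n. norm (X n) \<le> K"
    using Cauchy_Bseq[OF X] by (auto simp: Bseq_def)
  have "norm (g x) \<le> K" for x
    by (rule tendsto_upperbound[OF tendsto_norm[OF g]])
       (auto intro!: always_eventually order_trans[OF norm_bb_upper K])
  moreover have "g x = 0" if "x \<notin> {-1..0}" for x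
    using g[of x] that by (simp add: apply_bb_outside LIMSEQ_const_iff)
  moreover have "g \<in> borel_measurable borel"
    by (rule borel_measurable_LIMSEQ_metric[of "\<lambda>n. apply_bb (X n)"]) (use g in auto)
  ultimately have g_in: "apply_bb (Abs_bb g) = g"
    by (intro Abs_bb_inverse) (auto simp: bounded_iff)
  have "X \<longlonglongrightarrow> Abs_bb g"
  proof (rule LIMSEQ_I)
    fix e :: real assume "e > 0"
    then obtain N where N: "\<And>m n. m \<ge> N \<Longrightarrow> n \<ge> N \<Longrightarrow> norm (X m - X n) < e / 2"
      using CauchyD[OF X, of "e / 2"] by auto
    have "norm (X n - Abs_bb g) < e" if n: "n \<ge> N" for n
    proof -
      have "norm (X n - Abs_bb g) \<le> e / 2"
      proof (rule norm_bb_least)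
        fix x
        have "(\<lambda>m. norm (apply_bb (X n) x - apply_bb (X m) x)) \<longlonglongrightarrow> norm (apply_bb (X n) x - g x)"
          by (intro tendsto_intros g)
        moreover have "\<forall>\<^sub>F m in sequentially. norm (apply_bb (X n) x - apply_bb (X m) x) \<le> e / 2"
          using eventually_ge_at_top[of N]
          by eventually_elim (use N[OF n] le in \<open>meson less_imp_le order_trans\<close>)
        ultimately show "norm (apply_bb (X n - Abs_bb g) x) \<le> e / 2"
          unfolding minus_bounded_borel.rep_eq g_in by (rule tendsto_upperbound) simp
      qed
      with \<open>e > 0\<close> show ?thesis by simp
    qed
    then show "\<exists>no. \<forall>n\<ge>no. norm (X n - Abs_bb g) < e" by blast
  qed
  then show "convergent X" by (rule convergentI)
qed

section \<open>Normalized functions of bounded variation on $[0,1]$\<close>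

definition variation_sums :: "(real \<Rightarrow> 'a::real_normed_vector) \<Rightarrow> real \<Rightarrow> real \<Rightarrow> real set"
  where "variation_sums f a b =
    {(\<Sum>i<k. norm (f (p (Suc i)) - f (p i))) | (k::nat) p. mono_on {..k} p \<and> p ` {..k} \<subseteq> {a..b}}"

definition bounded_variation_on :: "(real \<Rightarrow> 'a::real_normed_vector) \<Rightarrow> real \<Rightarrow> real \<Rightarrow> bool"
  where "bounded_variation_on f a b \<longleftrightarrow> bdd_above (variation_sums f a b)"

definition total_variation :: "(real \<Rightarrow> 'a::real_normed_vector) \<Rightarrow> real \<Rightarrow> real \<Rightarrow> real"
  where "total_variation f a b = Sup (variation_sums f a b)"

lemma variation_sums_nonempty: "a \<le> b \<Longrightarrow> variation_sums f a b \<noteq> {}"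
  unfolding variation_sums_def
  by (auto intro!: exI[of _ 0] exI[of _ "\<lambda>_. a"] simp: mono_on_def)

lemma total_variation_upper:
  "bounded_variation_on f a b \<Longrightarrow> s \<in> variation_sums f a b \<Longrightarrow> s \<le> total_variation f a b"
  unfolding bounded_variation_on_def total_variation_def by (rule cSup_upper)

lemma total_variation_least:
  "a \<le> b \<Longrightarrow> (\<And>s. s \<in> variation_sums f a b \<Longrightarrow> s \<le> c) \<Longrightarrow> total_variation f a b \<le> c"
  unfolding total_variation_def by (rule cSup_least[OF variation_sums_nonempty])

lemma bounded_variation_onI:
  "(\<And>s. s \<in> variation_sums f a b \<Longrightarrow> s \<le> c) \<Longrightarrow> bounded_variation_on f a b"
  unfolding bounded_variation_on_def by (rule bdd_aboveI)

lemma sum_in_variation_sums: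
  "mono_on {..k} p \<Longrightarrow> p ` {..k} \<subseteq> {a..b} \<Longrightarrow>
    (\<Sum>i<k. norm (f (p (Suc i)) - f (p i))) \<in> variation_sums f a b"
  unfolding variation_sums_def by blast

lemma norm_diff_in_variation_sums:
  assumes "a \<le> s" "s \<le> t" "t \<le> b"
  shows "norm (f t - f s) \<in> variation_sums f a b"
proof -
  have "(\<Sum>i<(1::nat). norm (f ((\<lambda>i. if i = 0 then s else t) (Suc i)) - f ((\<lambda>i. if i = 0 then s else t) i)))
      \<in> variation_sums f a b"
    by (rule sum_in_variation_sums) (use assms in \<open>auto simp: mono_on_def\<close>)
  then show ?thesis by simp
qed

lemma variation_sums_add_le:
  assumes "bounded_variation_on f a b" "bounded_variation_on g a b"
    and "s \<in> variation_sums (\<lambda>x. f x + g x) a b"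
  shows "s \<le> total_variation f a b + total_variation g a b"
proof -
  from assms(3) obtain k p where s: "s = (\<Sum>i<k. norm ((f (p (Suc i)) + g (p (Suc i))) - (f (p i) + g (p i))))"
    and p: "mono_on {..k} p" "p ` {..k} \<subseteq> {a..b}"
    unfolding variation_sums_def by blast
  have "s \<le> (\<Sum>i<k. norm (f (p (Suc i)) - f (p i)) + norm (g (p (Suc i)) - g (p i)))"
    unfolding s by (intro sum_mono) (metis add_diff_add norm_triangle_ineq)
  also have "\<dots> = (\<Sum>i<k. norm (f (p (Suc i)) - f (p i))) + (\<Sum>i<k. norm (g (p (Suc i)) - g (p i)))"
    by (rule sum.distrib)
  also have "\<dots> \<le> total_variation f a b + total_variation g a b"
    by (intro add_mono total_variation_upper assms sum_in_variation_sums p)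
  finally show ?thesis .
qed

lemma variation_sums_scaleR_le:
  assumes "bounded_variation_on f a b" and "s \<in> variation_sums (\<lambda>x. c *\<^sub>R f x) a b"
  shows "s \<le> \<bar>c\<bar> * total_variation f a b"
proof -
  from assms(2) obtain k p where s: "s = (\<Sum>i<k. norm (c *\<^sub>R f (p (Suc i)) - c *\<^sub>R f (p i)))"
    and p: "mono_on {..k} p" "p ` {..k} \<subseteq> {a..b}"
    unfolding variation_sums_def by blast
  have "s = \<bar>c\<bar> * (\<Sum>i<k. norm (f (p (Suc i)) - f (p i)))"
    unfolding s by (simp add: sum_distrib_left scaleR_diff_right[symmetric] del: scaleR_diff_right)
  also have "\<dots> \<le> \<bar>c\<bar> * total_variation f a b"
    by (intro mult_left_mono total_variation_upper assms sum_in_variation_sums p) auto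
  finally show ?thesis .
qed

text \<open>
  A function on $[0,1]$ is represented by its extension by zero to the real line.
  Being defined by right-continuity on the open interval $(0,1)$ only, an element may jump
  at \<open>0\<close>; then its measure has an atom there.
\<close>

typedef (overloaded) ('a::euclidean_space) nbv =
  "{f :: real \<Rightarrow> 'a. bounded_variation_on f 0 1 \<and> f 0 = 0 \<and>
     (\<forall>t\<in>{0<..<1}. continuous (at_right t) f) \<and> (\<forall>t. t \<notin> {0..1} \<longrightarrow> f t = 0)}"
  morphisms apply_nbv Abs_nbv
  by (intro exI[of _ "\<lambda>_. 0"]) (auto simp: variation_sums_def intro!: bounded_variation_onI[of _ _ _ 0])

setup_lifting type_definition_nbv

lemma nbv_bounded_variation: "bounded_variation_on (apply_nbv f) 0 1"
  and nbv_0 [simp]: "apply_nbv f 0 = 0"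
  and nbv_right_continuous: "t \<in> {0<..<1} \<Longrightarrow> continuous (at_right t) (apply_nbv f)"
  and nbv_outside: "t \<notin> {0..1} \<Longrightarrow> apply_nbv f t = 0"
  using apply_nbv[of f] by auto

lemma nbv_eqI: "(\<And>t. t \<in> {0..1} \<Longrightarrow> apply_nbv f t = apply_nbv g t) \<Longrightarrow> f = g"
  by (metis apply_nbv_inject nbv_outside ext)

lemma bounded_variation_add:
  "bounded_variation_on f a b \<Longrightarrow> bounded_variation_on g a b \<Longrightarrow>
    bounded_variation_on (\<lambda>x. f x + g x) a b"
  by (rule bounded_variation_onI, rule variation_sums_add_le)

lemma bounded_variation_scaleR:
  "bounded_variation_on f a b \<Longrightarrow> bounded_variation_on (\<lambda>x. c *\<^sub>R f x) a b"
  by (rule bounded_variation_onI, rule variation_sums_scaleR_le)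

instantiation nbv :: (euclidean_space) real_vector
begin

lift_definition zero_nbv :: "'a nbv" is "\<lambda>_. 0"
  by (auto simp: variation_sums_def intro!: bounded_variation_onI[of _ _ _ 0])
lift_definition plus_nbv :: "'a nbv \<Rightarrow> 'a nbv \<Rightarrow> 'a nbv"
  is "\<lambda>f g x. f x + g x" by (auto intro!: bounded_variation_add continuous_add)
lift_definition scaleR_nbv :: "real \<Rightarrow> 'a nbv \<Rightarrow> 'a nbv"
  is "\<lambda>r f x. r *\<^sub>R f x" by (auto intro!: bounded_variation_scaleR continuous_intros)
definition uminus_nbv :: "'a nbv \<Rightarrow> 'a nbv" where "uminus_nbv f = (-1) *\<^sub>R f"
definition minus_nbv :: "'a nbv \<Rightarrow> 'a nbv \<Rightarrow> 'a nbv" where "minus_nbv f g = f + - g"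

lemmas nbv_simps [simp] = zero_nbv.rep_eq plus_nbv.rep_eq scaleR_nbv.rep_eq

lemma uminus_nbv_rep_eq [simp]: "apply_nbv (- f) x = - apply_nbv f x"
  by (simp add: uminus_nbv_def)

lemma minus_nbv_rep_eq [simp]: "apply_nbv (f - g) x = apply_nbv f x - apply_nbv g x"
  by (simp add: minus_nbv_def)

instance
  by standard (auto intro!: nbv_eqI simp: algebra_simps)

end

instantiation nbv :: (euclidean_space) real_normed_vector
begin

definition norm_nbv :: "'a nbv \<Rightarrow> real"
  where "norm_nbv f = total_variation (apply_nbv f) 0 1"
definition sgn_nbv :: "'a nbv \<Rightarrow> 'a nbv"
  where "sgn_nbv f = f /\<^sub>R norm f"
definition dist_nbv :: "'a nbv \<Rightarrow> 'a nbv \<Rightarrow> real"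
  where "dist_nbv f g = norm (f - g)"
definition uniformity_nbv :: "('a nbv \<times> 'a nbv) filter"
  where "uniformity_nbv = (INF e\<in>{0 <..}. principal {(x, y). dist x y < e})"
definition open_nbv :: "'a nbv set \<Rightarrow> bool"
  where "open_nbv S = (\<forall>x\<in>S. \<forall>\<^sub>F (x', y) in uniformity. x' = x \<longrightarrow> y \<in> S)"

lemma norm_nbv_upper: "norm (apply_nbv f t) \<le> norm f"
proof (cases "t \<in> {0..1}")
  case True
  then have "norm (apply_nbv f t - apply_nbv f 0) \<le> norm f"
    unfolding norm_nbv_def
    by (intro total_variation_upper nbv_bounded_variation norm_diff_in_variation_sums) auto
  then show ?thesis by simp
next
  case False
  have "norm (apply_nbv f 0 - apply_nbv f 0) \<le> norm f"
    unfolding norm_nbv_def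
    by (intro total_variation_upper nbv_bounded_variation norm_diff_in_variation_sums) auto
  with False show ?thesis by (simp add: nbv_outside)
qed

lemma norm_nbv_scaleR_le: "norm (a *\<^sub>R f) \<le> \<bar>a\<bar> * norm (f :: 'a nbv)"
  unfolding norm_nbv_def
  by (rule total_variation_least)
     (auto intro!: variation_sums_scaleR_le nbv_bounded_variation)

instance
proof
  fix a :: real and f g :: "'a nbv"
  have nonneg: "0 \<le> norm h" for h :: "'a nbv"
    using norm_nbv_upper[of h 0] by simp
  show "norm f = 0 \<longleftrightarrow> f = 0"
  proof
    assume "norm f = 0"
    then show "f = 0"
      using norm_nbv_upper[of f] by (intro nbv_eqI) auto
  next
    assume "f = 0"
    then have "norm f \<le> 0"
      using norm_nbv_scaleR_le[of 0 f] by simp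
    with nonneg[of f] show "norm f = 0" by simp
  qed
  show "norm (f + g) \<le> norm f + norm g"
    unfolding norm_nbv_def
    by (rule total_variation_least)
       (auto intro!: variation_sums_add_le nbv_bounded_variation)
  show "norm (a *\<^sub>R f) = \<bar>a\<bar> * norm f"
  proof (cases "a = 0")
    case True
    then show ?thesis
      using norm_nbv_scaleR_le[of 0 f] nonneg[of "0 *\<^sub>R f"] by simp
  next
    case False
    have "norm f = norm (inverse a *\<^sub>R a *\<^sub>R f)" using False by simp
    also have "\<dots> \<le> \<bar>inverse a\<bar> * norm (a *\<^sub>R f)" by (rule norm_nbv_scaleR_le)
    finally have "\<bar>a\<bar> * norm f \<le> norm (a *\<^sub>R f)"
      using False by (simp add: field_simps)
    with norm_nbv_scaleR_le[of a f] show ?thesis by simp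
  qed
qed (simp_all add: sgn_nbv_def dist_nbv_def uniformity_nbv_def open_nbv_def)

end

instance nbv :: (euclidean_space) banach
proof
  fix X :: "nat \<Rightarrow> 'a nbv"
  assume X: "Cauchy X"
  have le: "norm (apply_nbv (X m) t - apply_nbv (X n) t) \<le> norm (X m - X n)" for m n t
    using norm_nbv_upper[of "X m - X n" t] by simp
  have "Cauchy (\<lambda>n. apply_nbv (X n) t)" for t
    using X unfolding Cauchy_def dist_norm by (meson le le_less_trans)
  then have "\<exists>g. \<forall>t. (\<lambda>n. apply_nbv (X n) t) \<longlonglongrightarrow> g t"
    by (intro choice) (auto simp: Cauchy_convergent_iff convergent_def)
  then obtain g where g: "\<And>t. (\<lambda>n. apply_nbv (X n) t) \<longlonglongrightarrow> g t" by auto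
  have uniform: "\<exists>N. \<forall>n\<ge>N. \<forall>s\<in>variation_sums (\<lambda>t. apply_nbv (X n) t - g t) 0 1. s \<le> e"
    if "e > 0" for e
  proof -
    obtain N where N: "\<And>m n. m \<ge> N \<Longrightarrow> n \<ge> N \<Longrightarrow> norm (X m - X n) < e"
      using CauchyD[OF X \<open>e > 0\<close>] by auto
    have "s \<le> e" if n: "n \<ge> N" and s: "s \<in> variation_sums (\<lambda>t. apply_nbv (X n) t - g t) 0 1" for n s
    proof -
      from s obtain k p where s: "s = (\<Sum>i<k. norm ((apply_nbv (X n) (p (Suc i)) - g (p (Suc i))) -
            (apply_nbv (X n) (p i) - g (p i))))"
        and p: "mono_on {..k} p" "p ` {..k} \<subseteq> {0..1}"
        unfolding variation_sums_def by blast
      define S where "S m = (\<Sum>i<k. norm (apply_nbv (X n - X m) (p (Suc i)) - apply_nbv (X n - X m) (p i)))" for m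
      have "S \<longlonglongrightarrow> s"
        unfolding S_def s minus_nbv_rep_eq by (intro tendsto_intros g)
      moreover have "S m \<le> norm (X n - X m)" for m
        unfolding S_def norm_nbv_def
        by (intro total_variation_upper nbv_bounded_variation sum_in_variation_sums p)
      then have "\<forall>\<^sub>F m in sequentially. S m \<le> e"
        using eventually_ge_at_top[of N]
        by (elim eventually_mono) (meson N n less_imp_le order_trans)
      ultimately show "s \<le> e"
        by (simp add: tendsto_upperbound)
    qed
    then show ?thesis by blast
  qed
  obtain n where n: "\<And>s. s \<in> variation_sums (\<lambda>t. apply_nbv (X n) t - g t) 0 1 \<Longrightarrow> s \<le> 1"
    using uniform[of 1] by auto
  have "bounded_variation_on (\<lambda>t. apply_nbv (X n) t + (-1) *\<^sub>R (apply_nbv (X n) t - g t)) 0 1"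
    by (intro bounded_variation_add bounded_variation_scaleR nbv_bounded_variation
        bounded_variation_onI[OF n])
  then have bv: "bounded_variation_on g 0 1" by simp
  have unif: "uniform_limit UNIV (\<lambda>n. apply_nbv (X n)) g sequentially"
  proof -
    have "uniformly_Cauchy_on UNIV (\<lambda>n. apply_nbv (X n))"
      using X unfolding uniformly_Cauchy_on_def Cauchy_def dist_norm by (meson le le_less_trans)
    then obtain l where l: "uniform_limit UNIV (\<lambda>n. apply_nbv (X n)) l sequentially"
      using Cauchy_uniformly_convergent uniformly_convergent_on_def by blast
    have "l = g"
      using tendsto_uniform_limitI[OF l] g LIMSEQ_unique by blast
    with l show ?thesis by simp
  qed
  have cont: "continuous (at_right t) g" if "t \<in> {0<..<1}" for t
  proof -
    have "(g \<longlongrightarrow> g t) (at_right t)"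
    proof (rule swap_uniform_limit[where f = "\<lambda>n. apply_nbv (X n)" and g = "\<lambda>n. apply_nbv (X n) t"])
      show "\<forall>\<^sub>F n in sequentially. (apply_nbv (X n) \<longlongrightarrow> apply_nbv (X n) t) (at_right t)"
        using nbv_right_continuous[OF that] unfolding continuous_within by (rule always_eventually[OF allI])
      show "uniform_limit {t<..} (\<lambda>n. apply_nbv (X n)) g sequentially"
        by (rule uniform_limit_on_subset[OF unif]) auto
    qed (use g in auto)
    then show ?thesis by (simp add: continuous_within)
  qed
  have "g 0 = 0" using g[of 0] by (simp add: LIMSEQ_const_iff)
  moreover have "g t = 0" if "t \<notin> {0..1}" for t
    using g[of t] that by (simp add: nbv_outside LIMSEQ_const_iff)
  ultimately have g_in: "apply_nbv (Abs_nbv g) = g"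
    using bv cont by (intro Abs_nbv_inverse) auto
  have "X \<longlonglongrightarrow> Abs_nbv g"
  proof (rule LIMSEQ_I)
    fix e :: real assume "e > 0"
    then obtain N where N: "\<And>n s. n \<ge> N \<Longrightarrow>
        s \<in> variation_sums (\<lambda>t. apply_nbv (X n) t - g t) 0 1 \<Longrightarrow> s \<le> e / 2"
      using uniform[of "e / 2"] by auto
    have "apply_nbv (X n - Abs_nbv g) = (\<lambda>t. apply_nbv (X n) t - g t)" for n
      by (auto simp: g_in)
    then have "norm (X n - Abs_nbv g) \<le> e / 2" if "n \<ge> N" for n
      unfolding norm_nbv_def using N[OF that] by (intro total_variation_least) auto
    with \<open>e > 0\<close> show "\<exists>no. \<forall>n\<ge>no. norm (X n - Abs_nbv g) < e"
      by (intro exI[of _ N]) (fastforce)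
  qed
  then show "convergent X" by (rule convergentI)
qed

section \<open>Integration against functions of bounded variation\<close>

text \<open>
  The signed measure \<open>df\<close> on $[0,1]$ with \<open>df [0,t] = f t\<close> for \<open>0 < t \<le> 1\<close> is represented
  by a pair of finite Borel measures with difference \<open>df\<close>. The integral does not depend on the
  choice of this pair (\<open>stieltjes_integral_eq\<close>), and such a pair exists
  (\<open>ex_represents_df\<close>).
\<close>

definition represents_df :: "(real \<Rightarrow> real) \<Rightarrow> real measure \<Rightarrow> real measure \<Rightarrow> bool"
  where "represents_df f \<mu> \<nu> \<longleftrightarrow>
    finite_measure \<mu> \<and> finite_measure \<nu> \<and>
    sets \<mu> = sets (restrict_space borel {0..1}) \<and> sets \<nu> = sets (restrict_space borel {0..1}) \<and>
    (\<forall>t\<in>{0<..1}. measure \<mu> {0..t} - measure \<nu> {0..t} = f t)"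

definition stieltjes_integral :: "(real \<Rightarrow> real) \<Rightarrow> (real \<Rightarrow> real) \<Rightarrow> real"
  where "stieltjes_integral f g =
    (THE I. \<exists>\<mu> \<nu>. represents_df f \<mu> \<nu> \<and> I = (\<integral>\<sigma>. g \<sigma> \<partial>\<mu>) - (\<integral>\<sigma>. g \<sigma> \<partial>\<nu>))"

lemma represents_df_measure_unique:
  assumes "represents_df f \<mu> \<nu>" "represents_df f \<mu>' \<nu>'" "A \<in> sets borel"
  shows "measure \<mu> (A \<inter> {0..1}) - measure \<nu> (A \<inter> {0..1}) =
    measure \<mu>' (A \<inter> {0..1}) - measure \<nu>' (A \<inter> {0..1})"
proof -
  interpret \<mu>: finite_measure \<mu> using assms by (simp add: represents_df_def)
  interpret \<nu>: finite_measure \<nu> using assms by (simp add: represents_df_def)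
  interpret \<mu>': finite_measure \<mu>' using assms by (simp add: represents_df_def)
  interpret \<nu>': finite_measure \<nu>' using assms by (simp add: represents_df_def)
  have sets: "sets \<mu> = sets (restrict_space borel {0..1})" "sets \<nu> = sets (restrict_space borel {0..1})"
    "sets \<mu>' = sets (restrict_space borel {0..1})" "sets \<nu>' = sets (restrict_space borel {0..1})"
    using assms by (auto simp: represents_df_def)
  have Int_sets: "A \<inter> {0..1} \<in> sets (restrict_space borel {0..1})" if "A \<in> sets borel" for A :: "real set"
    using that by (auto simp: sets_restrict_space)
  let ?D = "\<lambda>M N A. measure M (A \<inter> {0..1}) - measure N (A \<inter> {0..1})"
  have t_pos: "?D \<mu> \<nu> {..t} = ?D \<mu>' \<nu>' {..t}" if "t > 0" for t
  proof -
    have "{..t} \<inter> {0..1} = {0..min t 1}" by auto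
    then show ?thesis using assms that by (auto simp: represents_df_def)
  qed
  have t_zero: "?D \<mu> \<nu> {..0} = ?D \<mu>' \<nu>' {..0}"
  proof -
    define B :: "nat \<Rightarrow> real set" where "B n = {..1 / Suc n} \<inter> {0..1}" for n
    have B: "(\<Inter>n. B n) = {..0} \<inter> {0..1}"
    proof -
      have "x \<le> 0" if "\<And>n::nat. x \<le> 1 / Suc n" for x :: real
        using that by (meson nat_approx_posE not_le)
      then show ?thesis by (fastforce simp: B_def)
    qed
    have dec: "decseq B"
    proof (rule decseq_SucI)
      fix n
      have "1 / real (Suc (Suc n)) \<le> 1 / real (Suc n)" by (intro frac_le) auto
      then show "B (Suc n) \<subseteq> B n" unfolding B_def by force
    qed
    have ran: "range B \<subseteq> sets (restrict_space borel {0..1})"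
    proof -
      have "B n \<in> sets (restrict_space borel {0..1})" for n
        unfolding B_def by (rule Int_sets) auto
      then show ?thesis by blast
    qed
    have "(\<lambda>n. measure \<mu> (B n) - measure \<nu> (B n)) \<longlonglongrightarrow> measure \<mu> (\<Inter>n. B n) - measure \<nu> (\<Inter>n. B n)"
      using ran sets dec
      by (intro tendsto_diff \<mu>.finite_Lim_measure_decseq \<nu>.finite_Lim_measure_decseq) auto
    moreover have "(\<lambda>n. measure \<mu>' (B n) - measure \<nu>' (B n)) \<longlonglongrightarrow> measure \<mu>' (\<Inter>n. B n) - measure \<nu>' (\<Inter>n. B n)"
      using ran sets dec
      by (intro tendsto_diff \<mu>'.finite_Lim_measure_decseq \<nu>'.finite_Lim_measure_decseq) auto
    moreover have "measure \<mu> (B n) - measure \<nu> (B n) = measure \<mu>' (B n) - measure \<nu>' (B n)" for n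
      unfolding B_def by (rule t_pos) simp
    ultimately show ?thesis
      unfolding B using LIMSEQ_unique by auto
  qed
  have t_all: "?D \<mu> \<nu> {..t} = ?D \<mu>' \<nu>' {..t}" for t
  proof -
    consider "t < 0" | "t = 0" | "t > 0" by linarith
    then show ?thesis
    proof cases
      case 1
      then have "{..t} \<inter> {0..1} = {}" by auto
      then show ?thesis by simp
    next
      case 2
      then show ?thesis using t_zero by (simp only:)
    next
      case 3
      then show ?thesis by (rule t_pos)
    qed
  qed
  have total: "?D \<mu> \<nu> UNIV = ?D \<mu>' \<nu>' UNIV"
  proof -
    have "{..1} \<inter> {0..1::real} = UNIV \<inter> {0..1}" by auto
    then show ?thesis using t_pos[of 1] by simp
  qed
  have gen: "sets (borel :: real measure) = sigma_sets UNIV (range atMost)"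
    by (subst borel_eq_atMost) (rule sets_measure_of, simp)
  have stable: "Int_stable (range (atMost :: real \<Rightarrow> _))"
    by (auto simp: Int_stable_def)
  note stable
  moreover have "range atMost \<subseteq> Pow (UNIV :: real set)" by simp
  moreover have "A \<in> sigma_sets UNIV (range atMost)" using assms(3) gen by simp
  ultimately show ?thesis
  proof (induction rule: sigma_sets_induct_disjoint)
    case (basic A)
    then show ?case using t_all by auto
  next
    case empty
    show ?case by simp
  next
    case (compl A)
    have A: "A \<in> sets borel" using compl(1) gen by simp
    have *: "measure M ((UNIV - A) \<inter> {0..1}) = measure M (UNIV \<inter> {0..1}) - measure M (A \<inter> {0..1})"
      if "finite_measure M" "sets M = sets (restrict_space borel {0..1})" for M
    proof -
      have "(UNIV - A) \<inter> {0..1} = (UNIV \<inter> {0..1}) - (A \<inter> {0..1})" by auto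
      then show ?thesis
        using that Int_sets[OF A] Int_sets[of UNIV]
        by (simp add: finite_measure.finite_measure_Diff)
    qed
    show ?case
      using compl(2) total
      by (simp only: *[OF \<mu>.finite_measure_axioms sets(1)] *[OF \<nu>.finite_measure_axioms sets(2)]
          *[OF \<mu>'.finite_measure_axioms sets(3)] *[OF \<nu>'.finite_measure_axioms sets(4)])
  next
    case (union A)
    have A: "A n \<in> sets borel" for n using union(2) gen by auto
    have *: "(\<lambda>n. measure M (A n \<inter> {0..1})) sums measure M ((\<Union>n. A n) \<inter> {0..1})"
      if "finite_measure M" "sets M = sets (restrict_space borel {0..1})" for M
    proof -
      have "(\<lambda>n. measure M (A n \<inter> {0..1})) sums measure M (\<Union>n. A n \<inter> {0..1})"
        using that Int_sets[OF A] union(1)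
        by (intro finite_measure.finite_measure_UNION) (fastforce simp: disjoint_family_on_def)+
      then show ?thesis by simp
    qed
    have "(\<lambda>n. ?D \<mu> \<nu> (A n)) sums ?D \<mu> \<nu> (\<Union>n. A n)"
      by (intro sums_diff * \<mu>.finite_measure_axioms \<nu>.finite_measure_axioms sets)
    moreover have "(\<lambda>n. ?D \<mu>' \<nu>' (A n)) sums ?D \<mu>' \<nu>' (\<Union>n. A n)"
      by (intro sums_diff * \<mu>'.finite_measure_axioms \<nu>'.finite_measure_axioms sets)
    ultimately show ?case
      using union(3) sums_unique2 by simp
  qed
qed

lemma represents_df_integral_unique:
  fixes g :: "real \<Rightarrow> real"
  assumes f: "represents_df f \<mu> \<nu>" and f': "represents_df f \<mu>' \<nu>'"
    and g: "g \<in> borel_measurable (restrict_space borel {0..1})" "bounded (g ` {0..1})"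
  shows "(\<integral>\<sigma>. g \<sigma> \<partial>\<mu>) - (\<integral>\<sigma>. g \<sigma> \<partial>\<nu>) = (\<integral>\<sigma>. g \<sigma> \<partial>\<mu>') - (\<integral>\<sigma>. g \<sigma> \<partial>\<nu>')"
proof -
  let ?B = "restrict_space borel {0..1::real}"
  have fin: "finite_measure \<mu>" "finite_measure \<nu>" "finite_measure \<mu>'" "finite_measure \<nu>'"
    and sets: "sets \<mu> = sets ?B" "sets \<nu> = sets ?B" "sets \<mu>' = sets ?B" "sets \<nu>' = sets ?B"
    using f f' by (auto simp: represents_df_def)
  have space: "space M = {0..1}" if "sets M = sets ?B" for M
    using sets_eq_imp_space_eq[OF that] by (simp add: space_restrict_space)
  have emeasure_eq: "emeasure \<mu> A + emeasure \<nu>' A = emeasure \<mu>' A + emeasure \<nu> A"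
    if A: "A \<in> sets ?B" for A
  proof -
    obtain C where "C \<in> sets borel" "A = C \<inter> {0..1}"
      using A by (auto simp: sets_restrict_space)
    then have "measure \<mu> A + measure \<nu>' A = measure \<mu>' A + measure \<nu> A"
      using represents_df_measure_unique[OF f f', of C] by simp
    then show ?thesis
      using fin by (simp add: finite_measure.emeasure_eq_measure flip: ennreal_plus)
  qed
  have meas: "u \<in> borel_measurable M" if "u \<in> borel_measurable ?B" "sets M = sets ?B"
    for M and u :: "real \<Rightarrow> 'b::topological_space"
    using that measurable_cong_sets by blast
  have nn: "(\<integral>\<^sup>+x. u x \<partial>\<mu>) + (\<integral>\<^sup>+x. u x \<partial>\<nu>') = (\<integral>\<^sup>+x. u x \<partial>\<mu>') + (\<integral>\<^sup>+x. u x \<partial>\<nu>)"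
    if "u \<in> borel_measurable ?B" for u
    using that
  proof (induction rule: borel_measurable_induct)
    case (cong u v)
    have "(\<integral>\<^sup>+x. u x \<partial>M) = (\<integral>\<^sup>+x. v x \<partial>M)" if "sets M = sets ?B" for M
      using cong(3) space[OF that] by (intro nn_integral_cong) (auto simp: space_restrict_space)
    then show ?case using cong(4) sets by simp
  next
    case (set A)
    then show ?case using sets emeasure_eq by simp
  next
    case (mult u c)
    have *: "(\<integral>\<^sup>+x. c * u x \<partial>M) = c * (\<integral>\<^sup>+x. u x \<partial>M)" if "sets M = sets ?B" for M
      using meas[OF mult(2) that] by (rule nn_integral_cmult)
    then show ?case by (simp only: *[OF sets(1)] *[OF sets(4)] *[OF sets(3)] *[OF sets(2)] distrib_left[symmetric] mult.IH)
  next
    case (add u v)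
    have *: "(\<integral>\<^sup>+x. v x + u x \<partial>M) = (\<integral>\<^sup>+x. v x \<partial>M) + (\<integral>\<^sup>+x. u x \<partial>M)" if "sets M = sets ?B" for M
      by (rule nn_integral_add[OF meas[OF \<open>v \<in> borel_measurable ?B\<close> that]
            meas[OF \<open>u \<in> borel_measurable ?B\<close> that]])
    have "(\<integral>\<^sup>+x. v x + u x \<partial>\<mu>) + (\<integral>\<^sup>+x. v x + u x \<partial>\<nu>') =
        ((\<integral>\<^sup>+x. v x \<partial>\<mu>) + (\<integral>\<^sup>+x. v x \<partial>\<nu>')) + ((\<integral>\<^sup>+x. u x \<partial>\<mu>) + (\<integral>\<^sup>+x. u x \<partial>\<nu>'))"
      unfolding *[OF sets(1)] *[OF sets(4)] by (simp only: ac_simps)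
    also have "\<dots> = (\<integral>\<^sup>+x. v x + u x \<partial>\<mu>') + (\<integral>\<^sup>+x. v x + u x \<partial>\<nu>)"
      unfolding add.IH *[OF sets(2)] *[OF sets(3)] by (simp only: ac_simps)
    finally show ?case .
  next
    case (seq U)
    have inc: "incseq (\<lambda>i. \<integral>\<^sup>+x. U i x \<partial>M)" for M
      using \<open>incseq U\<close> by (auto simp: incseq_def le_fun_def intro!: nn_integral_mono)
    have lim: "(\<integral>\<^sup>+x. (SUP i. U i) x \<partial>M) = (SUP i. \<integral>\<^sup>+x. U i x \<partial>M)" if "sets M = sets ?B" for M
      unfolding SUP_apply
      by (rule nn_integral_monotone_convergence_SUP[OF \<open>incseq U\<close> meas[OF seq.hyps(1) that]])
    have "(\<integral>\<^sup>+x. (SUP i. U i) x \<partial>\<mu>) + (\<integral>\<^sup>+x. (SUP i. U i) x \<partial>\<nu>') =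
        (SUP i. (\<integral>\<^sup>+x. U i x \<partial>\<mu>) + (\<integral>\<^sup>+x. U i x \<partial>\<nu>'))"
      unfolding lim[OF sets(1)] lim[OF sets(4)] by (rule ennreal_SUP_add[OF inc inc, symmetric])
    also have "\<dots> = (\<integral>\<^sup>+x. (SUP i. U i) x \<partial>\<mu>') + (\<integral>\<^sup>+x. (SUP i. U i) x \<partial>\<nu>)"
      unfolding lim[OF sets(2)] lim[OF sets(3)] seq.IH by (rule ennreal_SUP_add[OF inc inc])
    finally show ?case .
  qed
  obtain K where K: "\<And>x. x \<in> {0..1} \<Longrightarrow> \<bar>g x\<bar> \<le> K"
    using g(2) unfolding bounded_iff by (metis imageI real_norm_def)
  have split: "ennreal ((\<integral>x. g x \<partial>M) + K * measure M {0..1}) = (\<integral>\<^sup>+x. ennreal (g x + K) \<partial>M)"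
    and nonneg: "0 \<le> (\<integral>x. g x \<partial>M) + K * measure M {0..1}"
    if M: "finite_measure M" "sets M = sets ?B" for M
  proof -
    interpret finite_measure M by fact
    have int: "integrable M g"
      using K space[OF M(2)] by (intro integrable_const_bound[of _ K] meas[OF g(1) M(2)] AE_I2) auto
    have K0: "0 \<le> g x + K" if "x \<in> space M" for x
      using K[of x] that space[OF M(2)] by auto
    have "(\<integral>x. g x + K \<partial>M) = (\<integral>x. g x \<partial>M) + K * measure M {0..1}"
      using int by (simp add: space[OF M(2)])
    moreover have "(\<integral>\<^sup>+x. ennreal (g x + K) \<partial>M) = ennreal (\<integral>x. g x + K \<partial>M)"
      using int K0 by (intro nn_integral_eq_integral AE_I2) auto
    moreover have "0 \<le> (\<integral>x. g x + K \<partial>M)"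
      using K0 by (intro integral_nonneg_AE AE_I2) auto
    ultimately show "ennreal ((\<integral>x. g x \<partial>M) + K * measure M {0..1}) = (\<integral>\<^sup>+x. ennreal (g x + K) \<partial>M)"
      and "0 \<le> (\<integral>x. g x \<partial>M) + K * measure M {0..1}" by simp_all
  qed
  have "(\<lambda>x. ennreal (g x + K)) \<in> borel_measurable ?B"
    using g(1) by measurable
  from nn[OF this]
  have "(\<integral>x. g x \<partial>\<mu>) + K * measure \<mu> {0..1} + ((\<integral>x. g x \<partial>\<nu>') + K * measure \<nu>' {0..1}) =
      (\<integral>x. g x \<partial>\<mu>') + K * measure \<mu>' {0..1} + ((\<integral>x. g x \<partial>\<nu>) + K * measure \<nu> {0..1})"
    using fin sets nonneg by (simp add: split[symmetric] flip: ennreal_plus)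
  moreover have "measure \<mu> {0..1} + measure \<nu>' {0..1} = measure \<mu>' {0..1} + measure \<nu> {0..1}"
    using represents_df_measure_unique[OF f f', of UNIV] by simp
  then have "K * measure \<mu> {0..1} + K * measure \<nu>' {0..1} = K * measure \<mu>' {0..1} + K * measure \<nu> {0..1}"
    by (simp flip: distrib_left)
  ultimately show ?thesis by linarith
qed

lemma stieltjes_integral_eq:
  assumes "represents_df f \<mu> \<nu>"
    and "g \<in> borel_measurable (restrict_space borel {0..1})" "bounded (g ` {0..1})"
  shows "stieltjes_integral f g = (\<integral>\<sigma>. g \<sigma> \<partial>\<mu>) - (\<integral>\<sigma>. g \<sigma> \<partial>\<nu>)"
  unfolding stieltjes_integral_def
proof (rule the_equality)
  fix I assume "\<exists>\<mu> \<nu>. represents_df f \<mu> \<nu> \<and> I = (\<integral>\<sigma>. g \<sigma> \<partial>\<mu>) - (\<integral>\<sigma>. g \<sigma> \<partial>\<nu>)"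
  then obtain \<mu>' \<nu>' where "represents_df f \<mu>' \<nu>'" "I = (\<integral>\<sigma>. g \<sigma> \<partial>\<mu>') - (\<integral>\<sigma>. g \<sigma> \<partial>\<nu>')"
    by blast
  then show "I = (\<integral>\<sigma>. g \<sigma> \<partial>\<mu>) - (\<integral>\<sigma>. g \<sigma> \<partial>\<nu>)"
    using represents_df_integral_unique[OF _ assms] by simp
qed (use assms in blast)

lemma ex_monotone_measure:
  fixes P :: "real \<Rightarrow> real"
  assumes P: "\<And>s t. 0 \<le> s \<Longrightarrow> s \<le> t \<Longrightarrow> t \<le> 1 \<Longrightarrow> P s \<le> P t"
  shows "\<exists>\<mu>. finite_measure \<mu> \<and> sets \<mu> = sets (restrict_space borel {0..1}) \<and>
    (\<forall>t\<in>{0<..<1}. (P \<longlongrightarrow> P 0 + measure \<mu> {0..t}) (at_right t)) \<and> P 1 = P 0 + measure \<mu> {0..1}"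
proof -
  define Q where "Q t = P (max 0 (min 1 t))" for t
  have Q: "mono Q" unfolding Q_def by (intro monoI P) auto
  define G where "G t = (INF s\<in>{t<..}. Q s)" for t
  have bdd: "bdd_below (Q ` {t<..})" for t
    using monoD[OF Q] by (auto intro!: bdd_belowI[of _ "Q t"])
  have lim: "(Q \<longlongrightarrow> G t) (at_right t)" for t
  proof (rule order_tendstoI)
    fix a assume "a < G t"
    moreover have "G t \<le> Q s" if "s > t" for s
      unfolding G_def using bdd that by (intro cINF_lower) auto
    ultimately show "\<forall>\<^sub>F s in at_right t. a < Q s"
      by (intro eventually_mono[OF eventually_at_right_less]) (rule less_le_trans)
  next
    fix a assume "G t < a"
    then obtain s where s: "s > t" "Q s < a"
      unfolding G_def using bdd by (subst (asm) cINF_less_iff) auto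
    have "\<forall>\<^sub>F r in at_right t. r \<in> {t<..<s}"
      using s by (intro eventually_at_right_real)
    then show "\<forall>\<^sub>F r in at_right t. Q r < a"
      by eventually_elim (use s monoD[OF Q] in \<open>auto intro: le_less_trans less_imp_le\<close>)
  qed
  have G_mono: "G s \<le> G t" if "s \<le> t" for s t
    unfolding G_def using that bdd by (intro cINF_superset_mono) auto
  have QG: "Q t \<le> G t" for t
    unfolding G_def using monoD[OF Q] by (intro cINF_greatest) auto
  have GQ: "G t \<le> Q s" if "t < s" for s t
    unfolding G_def using bdd that by (intro cINF_lower) auto
  have G_cont: "continuous (at_right t) G" for t
    unfolding continuous_within
  proof (rule tendsto_sandwich[OF _ _ tendsto_const])
    show "\<forall>\<^sub>F s in at_right t. G t \<le> G s"
      using eventually_at_right_less by eventually_elim (auto intro!: G_mono)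
    show "\<forall>\<^sub>F s in at_right t. G s \<le> Q (t + 2 * (s - t))"
      using eventually_at_right_less by eventually_elim (auto intro!: GQ)
    have "filterlim (\<lambda>s. t + 2 * (s - t)) (at_right t) (at_right t)"
      unfolding filterlim_at
    proof
      show "\<forall>\<^sub>F s in at_right t. t + 2 * (s - t) \<in> {t<..} \<and> t + 2 * (s - t) \<noteq> t"
        using eventually_at_right_less by eventually_elim auto
      show "((\<lambda>s. t + 2 * (s - t)) \<longlongrightarrow> t) (at_right t)"
        by (rule tendsto_eq_rhs, (rule tendsto_intros)+) simp
    qed
    from filterlim_compose[OF lim this] show "((\<lambda>s. Q (t + 2 * (s - t))) \<longlongrightarrow> G t) (at_right t)" .
  qed
  let ?I = "interval_measure G"
  let ?h = "\<lambda>x::real. min 1 (max 0 x)"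
  let ?B = "restrict_space borel {0..1::real}"
  let ?R = "restrict_space ?I {-1<..1}"
  define \<mu> where "\<mu> = distr ?R ?B ?h"
  have h: "?h \<in> measurable ?R ?B"
  proof (intro measurable_restrict_space1 measurable_restrict_space2)
    show "?h \<in> borel_measurable ?I" by measurable
  qed auto
  have meas: "measure \<mu> {0..t} = G t - G (-1)" if "0 \<le> t" "t \<le> 1" for t
  proof -
    have "measure \<mu> {0..t} = measure ?R (?h -` {0..t} \<inter> space ?R)"
      unfolding \<mu>_def
      using h that by (intro measure_distr) (auto simp: sets_restrict_space_iff)
    also have "?h -` {0..t} \<inter> space ?R = {-1<..t}"
      using that by (auto simp: space_restrict_space min_def max_def split: if_splits)
    also have "measure ?R {-1<..t} = measure ?I {-1<..t}"
      using that by (intro measure_restrict_space) auto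
    also have "\<dots> = G t - G (-1)"
      using that by (intro measure_interval_measure_Ioc G_mono G_cont) auto
    finally show ?thesis .
  qed
  have "finite_measure ?R"
    by (intro finite_measureI)
       (simp add: emeasure_restrict_space space_restrict_space emeasure_interval_measure_Ioc G_mono G_cont)
  then have "finite_measure \<mu>"
    unfolding \<mu>_def by (intro finite_measure.finite_measure_distr h)
  moreover have "sets \<mu> = sets ?B" by (simp add: \<mu>_def)
  moreover have G1: "G (-1) = P 0"
    using QG[of "-1"] GQ[of "-1" "-1/2"] by (simp add: Q_def)
  moreover have "G 1 = P 1"
    using QG[of 1] GQ[of 1 2] by (simp add: Q_def)
  moreover have "(P \<longlongrightarrow> G t) (at_right t)" if "t \<in> {0<..<1}" for t
  proof (rule Lim_transform_eventually[OF lim])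
    have "\<forall>\<^sub>F s in at_right t. s \<in> {t<..<1}"
      using that by (intro eventually_at_right_real) auto
    then show "\<forall>\<^sub>F s in at_right t. Q s = P s"
      by eventually_elim (use that in \<open>auto simp: Q_def\<close>)
  qed
  ultimately show ?thesis
    using meas by (intro exI[of _ \<mu>]) auto
qed

lemma total_variation_increment:
  assumes bv: "bounded_variation_on f a b" and "a \<le> s" "s \<le> t" "t \<le> b"
  shows "total_variation f a s + norm (f t - f s) \<le> total_variation f a t"
proof -
  have sub: "variation_sums f a t \<subseteq> variation_sums f a b"
    using assms unfolding variation_sums_def
    by (fastforce dest: subsetD)
  have bvt: "bounded_variation_on f a t"
    using bv bdd_above_mono[OF _ sub] by (simp add: bounded_variation_on_def)
  have "total_variation f a s \<le> total_variation f a t - norm (f t - f s)"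
  proof (rule total_variation_least)
    fix r assume "r \<in> variation_sums f a s"
    then obtain k p where r: "r = (\<Sum>i<k. norm (f (p (Suc i)) - f (p i)))"
      and p: "mono_on {..k} p" "p ` {..k} \<subseteq> {a..s}"
      unfolding variation_sums_def by blast
    define q where "q i = (if i \<le> k then p i else if i = Suc k then s else t)" for i
    have pq: "a \<le> p i \<and> p i \<le> s" if "i \<le> k" for i using p(2) that by auto
    have "mono_on {..Suc (Suc k)} q"
      unfolding mono_on_def q_def using p(1) pq assms
      by (auto simp: mono_on_def intro: order_trans)
    moreover have "q ` {..Suc (Suc k)} \<subseteq> {a..t}"
      unfolding q_def using pq assms by (auto split: if_splits) (meson order_trans)+
    ultimately have "(\<Sum>i<Suc (Suc k). norm (f (q (Suc i)) - f (q i))) \<le> total_variation f a t"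
      by (intro total_variation_upper[OF bvt] sum_in_variation_sums)
    moreover have "(\<Sum>i<k. norm (f (q (Suc i)) - f (q i))) = r"
      unfolding r by (intro sum.cong) (auto simp: q_def)
    moreover have "norm (f (q (Suc (Suc k))) - f (q (Suc k))) = norm (f t - f s)"
      by (simp add: q_def)
    ultimately have "r + norm (f (q (Suc k)) - f (q k)) + norm (f t - f s) \<le> total_variation f a t"
      by simp
    then show "r \<le> total_variation f a t - norm (f t - f s)"
      using norm_ge_zero[of "f (q (Suc k)) - f (q k)"] by linarith
  qed (use assms in auto)
  then show ?thesis by simp
qed

lemma ex_represents_df_real:
  fixes f :: "real \<Rightarrow> real"
  assumes bv: "bounded_variation_on f 0 1" and f0: "f 0 = 0"
    and cont: "\<And>t. t \<in> {0<..<1} \<Longrightarrow> continuous (at_right t) f"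
  shows "\<exists>\<mu> \<nu>. represents_df f \<mu> \<nu>"
proof -
  let ?V = "total_variation f 0"
  have inc: "?V s + \<bar>f t - f s\<bar> \<le> ?V t" if "0 \<le> s" "s \<le> t" "t \<le> 1" for s t
    using total_variation_increment[OF bv that] by simp
  have P: "?V s \<le> ?V t" and Q: "?V s - f s \<le> ?V t - f t" if "0 \<le> s" "s \<le> t" "t \<le> 1" for s t
    using inc[OF that] by linarith+
  obtain \<mu> where \<mu>: "finite_measure \<mu>" "sets \<mu> = sets (restrict_space borel {0..1})"
    "\<And>t. t \<in> {0<..<1} \<Longrightarrow> (?V \<longlongrightarrow> ?V 0 + measure \<mu> {0..t}) (at_right t)"
    "?V 1 = ?V 0 + measure \<mu> {0..1}"
    using ex_monotone_measure[of ?V, OF P] by auto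
  obtain \<nu> where \<nu>: "finite_measure \<nu>" "sets \<nu> = sets (restrict_space borel {0..1})"
    "\<And>t. t \<in> {0<..<1} \<Longrightarrow> ((\<lambda>t. ?V t - f t) \<longlongrightarrow> ?V 0 + measure \<nu> {0..t}) (at_right t)"
    "?V 1 - f 1 = ?V 0 + measure \<nu> {0..1}"
    using ex_monotone_measure[of "\<lambda>t. ?V t - f t", OF Q] f0 by auto
  have "measure \<mu> {0..t} - measure \<nu> {0..t} = f t" if "t \<in> {0<..1}" for t
  proof (cases "t = 1")
    case True
    then show ?thesis using \<mu>(4) \<nu>(4) by simp
  next
    case False
    then have t: "t \<in> {0<..<1}" using that by auto
    have "((\<lambda>s. ?V s - (?V s - f s)) \<longlongrightarrow>
        (?V 0 + measure \<mu> {0..t}) - (?V 0 + measure \<nu> {0..t})) (at_right t)"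
      by (intro tendsto_diff[OF \<mu>(3)[OF t] \<nu>(3)[OF t]])
    then have "(f \<longlongrightarrow> measure \<mu> {0..t} - measure \<nu> {0..t}) (at_right t)" by simp
    moreover have "(f \<longlongrightarrow> f t) (at_right t)"
      using cont[OF t] by (simp add: continuous_within)
    ultimately show ?thesis by (intro tendsto_unique[of "at_right t"]) auto
  qed
  then have "represents_df f \<mu> \<nu>"
    using \<mu>(1,2) \<nu>(1,2) by (simp add: represents_df_def)
  then show ?thesis by blast
qed

lemma ex_represents_df:
  assumes h: "bounded_linear h"
  shows "\<exists>\<mu> \<nu>. represents_df (\<lambda>t. h (apply_nbv f t)) \<mu> \<nu>"
proof (rule ex_represents_df_real)
  interpret bounded_linear h by fact
  obtain K where K: "\<And>x. norm (h x) \<le> norm x * K" "K \<ge> 0"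
    using nonneg_bounded by auto
  show "bounded_variation_on (\<lambda>t. h (apply_nbv f t)) 0 1"
  proof (rule bounded_variation_onI)
    fix s assume "s \<in> variation_sums (\<lambda>t. h (apply_nbv f t)) 0 1"
    then obtain k p where s: "s = (\<Sum>i<k. norm (h (apply_nbv f (p (Suc i))) - h (apply_nbv f (p i))))"
      and p: "mono_on {..k} p" "p ` {..k} \<subseteq> {0..1}"
      unfolding variation_sums_def by blast
    have "s \<le> (\<Sum>i<k. norm (apply_nbv f (p (Suc i)) - apply_nbv f (p i)) * K)"
      unfolding s diff[symmetric] by (intro sum_mono K)
    also have "\<dots> \<le> norm f * K"
      unfolding sum_distrib_right[symmetric] norm_nbv_def
      by (intro mult_right_mono K total_variation_upper nbv_bounded_variation sum_in_variation_sums p)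
    finally show "s \<le> norm f * K" .
  qed
  show "continuous (at_right t) (\<lambda>t. h (apply_nbv f t))" if "t \<in> {0<..<1}" for t
    using nbv_right_continuous[OF that] by (rule continuous)
qed (simp add: linear_0 bounded_linear.linear h)

text \<open>
  For \<open>f\<close> of bounded variation with values in $\mathbb{R}^n$ or $\mathbb{R}^{n\times n}$,
  $\int_{[0,1]} df(\sigma)\cdot g(\sigma)$ and $\int_{[0,1]} d\zeta(\sigma)\, g(\sigma)$,
  componentwise.
\<close>

definition integral_dot :: "(real ^ 'n) nbv \<Rightarrow> (real \<Rightarrow> real ^ 'n) \<Rightarrow> real"
  where "integral_dot f g =
    (\<Sum>i\<in>UNIV. stieltjes_integral (\<lambda>\<sigma>. apply_nbv f \<sigma> $ i) (\<lambda>\<sigma>. g \<sigma> $ i))"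

definition integral_mat :: "(real ^ 'n ^ 'n) nbv \<Rightarrow> (real \<Rightarrow> real ^ 'n) \<Rightarrow> real ^ 'n"
  where "integral_mat \<zeta> g =
    (\<chi> i. \<Sum>j\<in>UNIV. stieltjes_integral (\<lambda>\<sigma>. apply_nbv \<zeta> \<sigma> $ i $ j) (\<lambda>\<sigma>. g \<sigma> $ j))"

section \<open>Norming dual pairs, twin operators, twin semigroups\<close>

definition norming_dual_pair :: "('d::banach \<Rightarrow> 'y::banach \<Rightarrow> real) \<Rightarrow> bool"
  where "norming_dual_pair p \<longleftrightarrow>
    (\<forall>d. linear (\<lambda>y. p d y)) \<and> (\<forall>y. linear (\<lambda>d. p d y)) \<and>
    (\<exists>M\<ge>1. \<forall>d y. \<bar>p d y\<bar> \<le> M * norm d * norm y) \<and>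
    (\<forall>y. norm y = (SUP d\<in>{d. norm d \<le> 1}. \<bar>p d y\<bar>)) \<and>
    (\<forall>d. norm d = (SUP y\<in>{y. norm y \<le> 1}. \<bar>p d y\<bar>))"

definition twin_operator ::
    "('d::banach \<Rightarrow> 'y::banach \<Rightarrow> real) \<Rightarrow> ('d \<Rightarrow> 'y \<Rightarrow> real) \<Rightarrow> bool"
  where "twin_operator p L \<longleftrightarrow>
    bounded_bilinear L \<and>
    (\<forall>y. \<exists>z. \<forall>d. p d z = L d y) \<and>
    (\<forall>d. \<exists>e. \<forall>y. p e y = L d y)"

text \<open>The elements \<open>L y\<close> of \<open>Y\<close> and \<open>d L\<close> of \<open>Y\<^sup>\<diamond>\<close> associated with a twin operator.\<close>

definition right_action :: "('d \<Rightarrow> 'y \<Rightarrow> real) \<Rightarrow> ('d \<Rightarrow> 'y \<Rightarrow> real) \<Rightarrow> 'y \<Rightarrow> 'y"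
  where "right_action p L y = (THE z. \<forall>d. p d z = L d y)"

definition left_action :: "('d \<Rightarrow> 'y \<Rightarrow> real) \<Rightarrow> 'd \<Rightarrow> ('d \<Rightarrow> 'y \<Rightarrow> real) \<Rightarrow> 'd"
  where "left_action p d L = (THE e. \<forall>y. p e y = L d y)"

definition twin_comp ::
    "('d \<Rightarrow> 'y \<Rightarrow> real) \<Rightarrow> ('d \<Rightarrow> 'y \<Rightarrow> real) \<Rightarrow> ('d \<Rightarrow> 'y \<Rightarrow> real) \<Rightarrow> 'd \<Rightarrow> 'y \<Rightarrow> real"
  where "twin_comp p L1 L2 d y = p (left_action p d L1) (right_action p L2 y)"

definition operator_form :: "('d \<Rightarrow> 'y \<Rightarrow> real) \<Rightarrow> ('y \<Rightarrow> 'y) \<Rightarrow> 'd \<Rightarrow> 'y \<Rightarrow> real"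
  where "operator_form p T d y = p d (T y)"

text \<open>
  Complexification: the pair \<open>(u, v)\<close> stands for \<open>u + i v\<close>, with the Taylor norm
  (used only for boundedness, which is the same for every equivalent norm).
  Real bilinear forms extend to complex bilinear ones.
\<close>

definition cplx_scale :: "complex \<Rightarrow> 'a::real_vector \<times> 'a \<Rightarrow> 'a \<times> 'a"
  where "cplx_scale c w =
    (Re c *\<^sub>R fst w - Im c *\<^sub>R snd w, Re c *\<^sub>R snd w + Im c *\<^sub>R fst w)"

definition cplx_norm :: "'a::real_normed_vector \<times> 'a \<Rightarrow> real"
  where "cplx_norm w = (SUP \<alpha>. norm (cos \<alpha> *\<^sub>R fst w + sin \<alpha> *\<^sub>R snd w))"

definition cplx_form :: "('d \<Rightarrow> 'y \<Rightarrow> real) \<Rightarrow> 'd \<times> 'd \<Rightarrow> 'y \<times> 'y \<Rightarrow> complex"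
  where "cplx_form L d y =
    Complex (L (fst d) (fst y) - L (snd d) (snd y)) (L (fst d) (snd y) + L (snd d) (fst y))"

definition cplx_bounded_bilinear ::
    "('d::real_normed_vector \<times> 'd \<Rightarrow> 'y::real_normed_vector \<times> 'y \<Rightarrow> complex) \<Rightarrow> bool"
  where "cplx_bounded_bilinear L \<longleftrightarrow>
    (\<forall>d d' y. L (d + d') y = L d y + L d' y) \<and> (\<forall>d y y'. L d (y + y') = L d y + L d y') \<and>
    (\<forall>c d y. L (cplx_scale c d) y = c * L d y) \<and> (\<forall>c d y. L d (cplx_scale c y) = c * L d y) \<and>
    (\<exists>K. \<forall>d y. norm (L d y) \<le> K * cplx_norm d * cplx_norm y)"

definition cplx_twin_operator ::
    "('d::banach \<Rightarrow> 'y::banach \<Rightarrow> real) \<Rightarrow> ('d \<times> 'd \<Rightarrow> 'y \<times> 'y \<Rightarrow> complex) \<Rightarrow> bool"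
  where "cplx_twin_operator p L \<longleftrightarrow>
    cplx_bounded_bilinear L \<and>
    (\<forall>y. \<exists>z. \<forall>d. cplx_form p d z = L d y) \<and>
    (\<forall>d. \<exists>e. \<forall>y. cplx_form p e y = L d y)"

definition has_laplace_twin_operator ::
    "('d::banach \<Rightarrow> 'y::banach \<Rightarrow> real) \<Rightarrow> (real \<Rightarrow> 'd \<Rightarrow> 'y \<Rightarrow> real) \<Rightarrow> complex \<Rightarrow> bool"
  where "has_laplace_twin_operator p S z \<longleftrightarrow>
    (if Im z = 0 then
       (\<exists>L. twin_operator p L \<and>
         (\<forall>d y. set_integrable lborel {0..} (\<lambda>t. exp (- Re z * t) * S t d y) \<and>
           L d y = (LBINT t:{0..}. exp (- Re z * t) * S t d y)))
     else
       (\<exists>L. cplx_twin_operator p L \<and>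
         (\<forall>d y. set_integrable lborel {0..} (\<lambda>t. exp (- z * of_real t) * cplx_form (S t) d y) \<and>
           L d y = (LBINT t:{0..}. exp (- z * of_real t) * cplx_form (S t) d y))))"

definition twin_semigroup ::
    "('d::banach \<Rightarrow> 'y::banach \<Rightarrow> real) \<Rightarrow> (real \<Rightarrow> 'd \<Rightarrow> 'y \<Rightarrow> real) \<Rightarrow> bool"
  where "twin_semigroup p S \<longleftrightarrow>
    (\<forall>t\<ge>0. twin_operator p (S t)) \<and>
    S 0 = p \<and> (\<forall>t\<ge>0. \<forall>s\<ge>0. S (t + s) = twin_comp p (S t) (S s)) \<and>
    (\<forall>d y. (\<lambda>t. S t d y) \<in> borel_measurable (restrict_space borel {0..})) \<and>
    (\<exists>M \<omega>. M \<ge> 1 \<and>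
      (\<forall>t\<ge>0. \<forall>d y. \<bar>S t d y\<bar> \<le> M * exp (\<omega> * t) * norm y * norm d) \<and>
      (\<forall>z. Re z > \<omega> \<longrightarrow> has_laplace_twin_operator p S z))"

section \<open>The retarded functional differential equation\<close>

definition nbv_pairing :: "(real ^ 'n) nbv \<Rightarrow> (real ^ 'n) bounded_borel \<Rightarrow> real"
  where "nbv_pairing f \<phi> = integral_dot f (\<lambda>\<sigma>. apply_bb \<phi> (- \<sigma>))"

definition is_rfde_solution ::
    "(real ^ 'n ^ 'n) nbv \<Rightarrow> (real ^ 'n) bounded_borel \<Rightarrow> (real \<Rightarrow> real ^ 'n) \<Rightarrow> bool"
  where "is_rfde_solution \<zeta> \<phi> x \<longleftrightarrow>
    x \<in> borel_measurable (restrict_space borel {-1..}) \<and>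
    (\<forall>T. bounded (x ` {-1..T})) \<and>
    (\<forall>\<theta>\<in>{-1..0}. x \<theta> = apply_bb \<phi> \<theta>) \<and>
    (\<forall>t\<ge>0. x t = apply_bb \<phi> 0 + (LBINT s:{0..t}. integral_mat \<zeta> (\<lambda>\<sigma>. x (s - \<sigma>))))"

text \<open>Values to the left of \<open>-1\<close> are set to zero to make the solution unique as a total function.\<close>

definition rfde_solution ::
    "(real ^ 'n ^ 'n) nbv \<Rightarrow> (real ^ 'n) bounded_borel \<Rightarrow> real \<Rightarrow> real ^ 'n"
  where "rfde_solution \<zeta> \<phi> = (THE x. is_rfde_solution \<zeta> \<phi> x \<and> (\<forall>t < -1. x t = 0))"

definition rfde_semigroup ::
    "(real ^ 'n ^ 'n) nbv \<Rightarrow> real \<Rightarrow> (real ^ 'n) bounded_borel \<Rightarrow> (real ^ 'n) bounded_borel"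
  where "rfde_semigroup \<zeta> t \<phi> =
    Abs_bb (\<lambda>\<theta>. if \<theta> \<in> {-1..0} then rfde_solution \<zeta> \<phi> (t + \<theta>) else 0)"

end

theory Submission
  imports Defs
begin

text \<open>
  The proof rests on one representation theorem, \<open>Riesz_representation\<close>: a linear functional on
  the bounded Borel functions is the pairing with an element of \<open>NBV\<close> as soon as it is bounded
  and continuous under bounded pointwise convergence. For such a functional \<open>l\<close> the
  candidate is \<open>f t \<bullet> u = l\<close> of the indicator of $[-t,0]$ times \<open>u\<close>. Testing \<open>l\<close> with the step function
  that takes, between consecutive partition points, the direction of the increment of \<open>f\<close> as its
  value bounds the variation of \<open>f\<close> by the norm of \<open>l\<close>; continuity of \<open>l\<close> gives right-continuity
  of \<open>f\<close>; and a monotone class argument extends the identity from indicators of intervals to all bounded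
  Borel functions (\<open>sigma_functional_eq_0\<close>).

  Every element of \<open>NBV\<close> that the theorem asks for is obtained in this way. Applied to
  evaluation at a point in a given direction, the representation theorem shows that the supremum norm is
  recovered from the pairing; applied to the pairing itself, with the dual norm as the bound, it shows the
  same for the total variation. The estimate $|\langle f,\varphi\rangle|\le\|f\|\,\|\varphi\|$ with
  constant 1 for the Euclidean norm is the only other ingredient of the norming property
  (\<open>integral_dot_bound\<close>): the scalar measures \<open>d(f \<bullet> u)\<close> for all unit vectors \<open>u\<close> are
  dominated by one measure whose mass is the total variation of \<open>f\<close>.

  For the delay equation, let \<open>V\<close> be the Volterra operator
  $(Vw)(t)=\int_0^t\int_{[0,1]}d\zeta(\sigma)\,w(s-\sigma)\,ds$, so that a solution is a fixed point of
  $x\mapsto\bar\varphi+Vx$, where $\bar\varphi$ extends $\varphi$ by the constant $\varphi(0)$. If \<open>C\<close>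
  bounds the inner integral and $\omega=2C$, then \<open>V\<close> halves the constant \<open>K\<close> in an estimate
  $|w(t)|\le Ke^{\omega t}$. Hence the series $x=\sum_k V^k\bar\varphi$
  converges geometrically, the solution is unique and it grows at most like $e^{\omega t}$. Each term depends on
  $\varphi$ continuously under bounded pointwise convergence, by dominated convergence, and so does
  the sum, by Tannery's theorem (\<open>rfde_solution_lim\<close>). This is what makes
  $\varphi\mapsto\langle d,S(t)\varphi\rangle$ and its Laplace transform accessible to the
  representation theorem, and hence gives their adjoint actions on \<open>NBV\<close>. The semigroup property is
  uniqueness of solutions for the shifted equation.

  The Laplace transform at $z$ acts on the bounded Borel functions by
  $\theta\mapsto\int_0^\infty e^{-zt}x(t+\theta)\,dt$, by Fubini's theorem. For non-real \<open>z\<close>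
  everything is done for the two real weights $\mathrm{Re}\,e^{-zt}$ and $\mathrm{Im}\,e^{-zt}$, and
  the two real twin operators are combined on the complexification.
\<close>

section \<open>Integration against functions of bounded variation\<close>

definition bounded_borel_on_unit :: "(real \<Rightarrow> real) \<Rightarrow> bool"
  where "bounded_borel_on_unit g \<longleftrightarrow> g \<in> borel_measurable borel \<and> bounded (g ` {0..1})"

lemma bounded_borel_on_unitI:
  "g \<in> borel_measurable borel \<Longrightarrow> (\<And>\<sigma>. \<sigma> \<in> {0..1} \<Longrightarrow> \<bar>g \<sigma>\<bar> \<le> B) \<Longrightarrow> bounded_borel_on_unit g"
  unfolding bounded_borel_on_unit_def by (auto intro!: boundedI[of _ B])

lemma bounded_borel_on_unitE:
  assumes "bounded_borel_on_unit g"
  obtains B where "0 \<le> B" "\<And>\<sigma>. \<sigma> \<in> {0..1} \<Longrightarrow> \<bar>g \<sigma>\<bar> \<le> B"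
  using assms unfolding bounded_borel_on_unit_def bounded_pos
  by (metis imageI less_imp_le real_norm_def)

lemma bounded_borel_on_unit_measurable [measurable_dest]:
  "bounded_borel_on_unit g \<Longrightarrow> g \<in> borel_measurable borel"
  by (simp add: bounded_borel_on_unit_def)

lemma bounded_borel_on_unit_add:
  "bounded_borel_on_unit g \<Longrightarrow> bounded_borel_on_unit h \<Longrightarrow> bounded_borel_on_unit (\<lambda>\<sigma>. g \<sigma> + h \<sigma>)"
  unfolding bounded_borel_on_unit_def by (auto intro: bounded_plus_comp)

lemma bounded_borel_on_unit_cmult:
  "bounded_borel_on_unit g \<Longrightarrow> bounded_borel_on_unit (\<lambda>\<sigma>. c * g \<sigma>)"
  unfolding bounded_borel_on_unit_def
  using bounded_scaleR_comp[of g "{0..1}" c] by auto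

lemma bounded_borel_on_unit_indicator:
  "A \<in> sets borel \<Longrightarrow> bounded_borel_on_unit (indicator A)"
  by (rule bounded_borel_on_unitI[of _ 1]) (auto simp: indicator_def)

text \<open>
  Both measures in a pair that represents \<open>df\<close> are of this kind.
\<close>
definition unit_measure :: "real measure \<Rightarrow> bool"
  where "unit_measure M \<longleftrightarrow> finite_measure M \<and> sets M = sets (restrict_space borel {0..1})"

lemma unit_measure_finite: "unit_measure M \<Longrightarrow> finite_measure M"
  by (simp add: unit_measure_def)

lemma unit_measure_space: "unit_measure M \<Longrightarrow> space M = {0..1}"
  using sets_eq_imp_space_eq[of M "restrict_space borel {0..1}"]
  by (simp add: unit_measure_def space_restrict_space)

text \<open>
  The inclusion of $[0,1]$ into the line transfers measurability of functions on the line to these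
  measures, whose sigma algebra lives on $[0,1]$ only.
\<close>
lemma unit_measure_ident:
  assumes "unit_measure M" shows "(\<lambda>\<sigma>. \<sigma>) \<in> measurable M borel"
proof -
  have "(\<lambda>\<sigma>. \<sigma>) \<in> measurable (restrict_space borel {0..1::real}) borel"
    by (intro measurable_restrict_space1) simp
  then show ?thesis
    using assms measurable_cong_sets[of M "restrict_space borel {0..1}" borel borel]
    unfolding unit_measure_def by blast
qed

lemma unit_measure_measurable:
  "unit_measure M \<Longrightarrow> g \<in> borel_measurable borel \<Longrightarrow> g \<in> borel_measurable M"
  by (rule measurable_compose[OF unit_measure_ident])

lemma unit_measure_integrable:
  assumes M: "unit_measure M" and g: "bounded_borel_on_unit g"
  shows "integrable M g"
proof -
  obtain B where B: "\<And>\<sigma>. \<sigma> \<in> {0..1} \<Longrightarrow> \<bar>g \<sigma>\<bar> \<le> B"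
    using bounded_borel_on_unitE[OF g] by blast
  show ?thesis
    using B by (intro finite_measure.integrable_const_bound[where B=B] unit_measure_finite[OF M]
      unit_measure_measurable[OF M] AE_I2 bounded_borel_on_unit_measurable[OF g])
      (auto simp: unit_measure_space[OF M])
qed

lemma unit_measure_integral_bound:
  assumes M: "unit_measure M" and g: "g \<in> borel_measurable borel" "\<And>\<sigma>. \<sigma> \<in> {0..1} \<Longrightarrow> \<bar>g \<sigma>\<bar> \<le> B"
  shows "\<bar>\<integral>\<sigma>. g \<sigma> \<partial>M\<bar> \<le> measure M {0..1} * B"
proof -
  interpret finite_measure M using M by (rule unit_measure_finite)
  have "norm (\<integral>\<sigma>. g \<sigma> \<partial>M) \<le> (\<integral>\<sigma>. B \<partial>M)"
  proof (rule Bochner_Integration.integral_norm_bound_integral)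
    show "integrable M g"
      by (intro unit_measure_integrable[OF M] bounded_borel_on_unitI[OF g])
    show "norm (g x) \<le> B" if "x \<in> space M" for x
      using g(2)[of x] that unit_measure_space[OF M] by simp
  qed simp
  then show ?thesis by (simp add: unit_measure_space[OF M])
qed

lemma unit_measure_integral_lim:
  fixes g :: "nat \<Rightarrow> real \<Rightarrow> real"
  assumes M: "unit_measure M" and g: "\<And>k. g k \<in> borel_measurable borel"
    "\<And>k \<sigma>. \<sigma> \<in> {0..1} \<Longrightarrow> \<bar>g k \<sigma>\<bar> \<le> B"
    and h: "h \<in> borel_measurable borel" "\<And>\<sigma>. \<sigma> \<in> {0..1} \<Longrightarrow> (\<lambda>k. g k \<sigma>) \<longlonglongrightarrow> h \<sigma>"
  shows "(\<lambda>k. \<integral>\<sigma>. g k \<sigma> \<partial>M) \<longlonglongrightarrow> (\<integral>\<sigma>. h \<sigma> \<partial>M)"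
proof (rule integral_dominated_convergence)
  interpret finite_measure M using M by (rule unit_measure_finite)
  show "integrable M (\<lambda>_. B)" by simp
  show "g k \<in> borel_measurable M" "h \<in> borel_measurable M" for k
    by (intro unit_measure_measurable[OF M] g h)+
  show "AE \<sigma> in M. (\<lambda>k. g k \<sigma>) \<longlonglongrightarrow> h \<sigma>" "AE \<sigma> in M. norm (g k \<sigma>) \<le> B" for k
    using h(2) g(2) by (auto intro!: AE_I2 simp: unit_measure_space[OF M])
qed

lemma unit_measure_pair_measurable:
  fixes G :: "real \<Rightarrow> real \<Rightarrow> real"
  assumes M: "unit_measure M" and G: "case_prod G \<in> borel_measurable (borel \<Otimes>\<^sub>M borel)"
  shows "(\<lambda>(t, \<sigma>). G t \<sigma>) \<in> borel_measurable (borel \<Otimes>\<^sub>M M)"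
    "(\<lambda>(t, \<sigma>). G t \<sigma>) \<in> borel_measurable (lborel \<Otimes>\<^sub>M M)"
proof -
  note [measurable] = unit_measure_ident[OF M]
  have "(\<lambda>p. (fst p, snd p)) \<in> measurable (borel \<Otimes>\<^sub>M M) (borel \<Otimes>\<^sub>M borel)"
    "(\<lambda>p. (fst p, snd p)) \<in> measurable (lborel \<Otimes>\<^sub>M M) (borel \<Otimes>\<^sub>M borel)"
    by (auto intro!: measurable_Pair measurable_compose[OF measurable_snd unit_measure_ident[OF M]]
        simp del: prod.collapse)
  from this[THEN measurable_compose, OF G]
  show "(\<lambda>(t, \<sigma>). G t \<sigma>) \<in> borel_measurable (borel \<Otimes>\<^sub>M M)"
    "(\<lambda>(t, \<sigma>). G t \<sigma>) \<in> borel_measurable (lborel \<Otimes>\<^sub>M M)"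
    by (simp_all add: case_prod_beta')
qed

lemma unit_measure_integral_measurable:
  fixes G :: "real \<Rightarrow> real \<Rightarrow> real"
  assumes M: "unit_measure M" and G: "case_prod G \<in> borel_measurable (borel \<Otimes>\<^sub>M borel)"
  shows "(\<lambda>t. \<integral>\<sigma>. G t \<sigma> \<partial>M) \<in> borel_measurable borel"
proof -
  interpret finite_measure M using M by (rule unit_measure_finite)
  show ?thesis
    by (rule borel_measurable_lebesgue_integral) (rule unit_measure_pair_measurable[OF M G])
qed

lemma unit_measure_Fubini:
  fixes G :: "real \<Rightarrow> real \<Rightarrow> real"
  assumes M: "unit_measure M" and G: "case_prod G \<in> borel_measurable (borel \<Otimes>\<^sub>M borel)"
    and k: "integrable lborel k" "\<And>t \<sigma>. \<sigma> \<in> {0..1} \<Longrightarrow> \<bar>G t \<sigma>\<bar> \<le> k t"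
  shows "integrable lborel (\<lambda>t. \<integral>\<sigma>. G t \<sigma> \<partial>M)"
    "(\<integral>t. (\<integral>\<sigma>. G t \<sigma> \<partial>M) \<partial>lborel) = (\<integral>\<sigma>. (\<integral>t. G t \<sigma> \<partial>lborel) \<partial>M)"
proof -
  interpret finite_measure M using M by (rule unit_measure_finite)
  interpret P: pair_sigma_finite lborel M ..
  have Gm: "(\<lambda>(t, \<sigma>). G t \<sigma>) \<in> borel_measurable (lborel \<Otimes>\<^sub>M M)"
    by (rule unit_measure_pair_measurable[OF M G])
  have k0: "0 \<le> k t" for t using k(2)[of 0 t] by simp
  have int: "integrable (lborel \<Otimes>\<^sub>M M) (\<lambda>(t, \<sigma>). G t \<sigma>)"
  proof (rule Bochner_Integration.integrable_bound[OF _ Gm])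
    have km: "k \<in> borel_measurable lborel" using k(1) by simp
    have "integrable (lborel \<Otimes>\<^sub>M M) (\<lambda>(t, \<sigma>). k t)"
    proof (rule P.Fubini_integrable)
      show "(\<lambda>(t, \<sigma>). k t) \<in> borel_measurable (lborel \<Otimes>\<^sub>M M)"
        using km by measurable
      show "integrable lborel (\<lambda>t. \<integral>\<sigma>. norm (case (t, \<sigma>) of (t, \<sigma>) \<Rightarrow> k t) \<partial>M)"
        using k(1) by (auto intro!: integrable_norm)
      show "AE t in lborel. integrable M (\<lambda>\<sigma>. case (t, \<sigma>) of (t, \<sigma>) \<Rightarrow> k t)"
        by simp
    qed
    then show "integrable (lborel \<Otimes>\<^sub>M M) (\<lambda>(t, \<sigma>). k t)" .
    show "AE p in lborel \<Otimes>\<^sub>M M. norm (case p of (t, \<sigma>) \<Rightarrow> G t \<sigma>) \<le> norm (case p of (t, \<sigma>) \<Rightarrow> k t)"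
      using k(2) k0 by (intro AE_I2) (auto simp: space_pair_measure unit_measure_space[OF M])
  qed
  show "integrable lborel (\<lambda>t. \<integral>\<sigma>. G t \<sigma> \<partial>M)"
    using P.integrable_fst'[OF int] by simp
  show "(\<integral>t. (\<integral>\<sigma>. G t \<sigma> \<partial>M) \<partial>lborel) = (\<integral>\<sigma>. (\<integral>t. G t \<sigma> \<partial>lborel) \<partial>M)"
    using P.Fubini_integral[OF int] by simp
qed

definition representable :: "(real \<Rightarrow> real) \<Rightarrow> bool"
  where "representable f \<longleftrightarrow> (\<exists>\<mu> \<nu>. represents_df f \<mu> \<nu>)"

lemma represents_df_unit_measures:
  "represents_df f \<mu> \<nu> \<Longrightarrow> unit_measure \<mu> \<and> unit_measure \<nu>"
  by (simp add: represents_df_def unit_measure_def)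

lemma stieltjes_eq:
  assumes "represents_df f \<mu> \<nu>" "bounded_borel_on_unit g"
  shows "stieltjes_integral f g = (\<integral>\<sigma>. g \<sigma> \<partial>\<mu>) - (\<integral>\<sigma>. g \<sigma> \<partial>\<nu>)"
  using assms unfolding bounded_borel_on_unit_def
  by (intro stieltjes_integral_eq) (auto intro: measurable_restrict_space1)

lemma representableE:
  assumes "representable f"
  obtains \<mu> \<nu> where "unit_measure \<mu>" "unit_measure \<nu>" "represents_df f \<mu> \<nu>"
    "\<And>g. bounded_borel_on_unit g \<Longrightarrow> stieltjes_integral f g = (\<integral>\<sigma>. g \<sigma> \<partial>\<mu>) - (\<integral>\<sigma>. g \<sigma> \<partial>\<nu>)"
  using assms unfolding representable_def
  by (metis represents_df_unit_measures stieltjes_eq)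

text \<open>
  Scalar functions obtained linearly from an element of \<open>NBV\<close> inherit its bounded variation and
  one-sided continuity.
\<close>
lemma representable_nbv_inner: "representable (\<lambda>t. apply_nbv f t \<bullet> u)"
  unfolding representable_def by (rule ex_represents_df) (rule bounded_linear_inner_left)

lemma representable_nbv_component: "representable (\<lambda>t. apply_nbv f t $ i)"
  unfolding representable_def by (rule ex_represents_df) (rule bounded_linear_vec_nth)

lemma representable_nbv_entry: "representable (\<lambda>t. apply_nbv f t $ i $ j)"
  unfolding representable_def
  by (rule ex_represents_df) (intro bounded_linear_compose[OF bounded_linear_vec_nth bounded_linear_vec_nth])

lemma stieltjes_cong:
  assumes "\<And>\<sigma>. \<sigma> \<in> {0..1} \<Longrightarrow> g \<sigma> = h \<sigma>"
  shows "stieltjes_integral f g = stieltjes_integral f h"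
proof -
  have "(\<integral>\<sigma>. g \<sigma> \<partial>M) = (\<integral>\<sigma>. h \<sigma> \<partial>M)" if "unit_measure M" for M
    using assms by (intro Bochner_Integration.integral_cong) (auto simp: unit_measure_space[OF that])
  then have "(\<exists>\<mu> \<nu>. represents_df f \<mu> \<nu> \<and> I = (\<integral>\<sigma>. g \<sigma> \<partial>\<mu>) - (\<integral>\<sigma>. g \<sigma> \<partial>\<nu>)) \<longleftrightarrow>
      (\<exists>\<mu> \<nu>. represents_df f \<mu> \<nu> \<and> I = (\<integral>\<sigma>. h \<sigma> \<partial>\<mu>) - (\<integral>\<sigma>. h \<sigma> \<partial>\<nu>))" for I
    by (metis represents_df_unit_measures)
  then show ?thesis unfolding stieltjes_integral_def by simp
qed

lemma stieltjes_add:
  assumes "representable f" "bounded_borel_on_unit g" "bounded_borel_on_unit h"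
  shows "stieltjes_integral f (\<lambda>\<sigma>. g \<sigma> + h \<sigma>) = stieltjes_integral f g + stieltjes_integral f h"
  by (rule representableE[OF assms(1)])
     (simp add: assms bounded_borel_on_unit_add unit_measure_integrable)

lemma stieltjes_cmult:
  assumes "representable f" "bounded_borel_on_unit g"
  shows "stieltjes_integral f (\<lambda>\<sigma>. c * g \<sigma>) = c * stieltjes_integral f g"
  by (rule representableE[OF assms(1)])
     (simp add: assms bounded_borel_on_unit_cmult unit_measure_integrable right_diff_distrib)

lemma stieltjes_bound:
  assumes "representable f"
  obtains C where "0 \<le> C" "\<And>g B. g \<in> borel_measurable borel \<Longrightarrow> (\<And>\<sigma>. \<sigma> \<in> {0..1} \<Longrightarrow> \<bar>g \<sigma>\<bar> \<le> B) \<Longrightarrow>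
    \<bar>stieltjes_integral f g\<bar> \<le> C * B"
proof -
  obtain \<mu> \<nu> where \<mu>: "unit_measure \<mu>" and \<nu>: "unit_measure \<nu>"
    and eq: "\<And>g. bounded_borel_on_unit g \<Longrightarrow> stieltjes_integral f g = (\<integral>\<sigma>. g \<sigma> \<partial>\<mu>) - (\<integral>\<sigma>. g \<sigma> \<partial>\<nu>)"
    using representableE[OF assms] by metis
  show thesis
  proof (rule that)
    show "0 \<le> measure \<mu> {0..1} + measure \<nu> {0..1}" by simp
    show "\<bar>stieltjes_integral f g\<bar> \<le> (measure \<mu> {0..1} + measure \<nu> {0..1}) * B"
      if g: "g \<in> borel_measurable borel" "\<And>\<sigma>. \<sigma> \<in> {0..1} \<Longrightarrow> \<bar>g \<sigma>\<bar> \<le> B" for g B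
      using unit_measure_integral_bound[OF \<mu> g] unit_measure_integral_bound[OF \<nu> g]
        eq[OF bounded_borel_on_unitI[OF g]]
      by (simp add: distrib_right abs_le_iff)
  qed
qed

lemma stieltjes_lim:
  fixes g :: "nat \<Rightarrow> real \<Rightarrow> real"
  assumes f: "representable f" and g: "\<And>k. g k \<in> borel_measurable borel"
    "\<And>k \<sigma>. \<sigma> \<in> {0..1} \<Longrightarrow> \<bar>g k \<sigma>\<bar> \<le> B"
    and h: "h \<in> borel_measurable borel" "\<And>\<sigma>. \<sigma> \<in> {0..1} \<Longrightarrow> (\<lambda>k. g k \<sigma>) \<longlonglongrightarrow> h \<sigma>"
  shows "(\<lambda>k. stieltjes_integral f (g k)) \<longlonglongrightarrow> stieltjes_integral f h"
proof -
  have "\<bar>h \<sigma>\<bar> \<le> B" if "\<sigma> \<in> {0..1}" for \<sigma>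
    using tendsto_upperbound[OF tendsto_rabs[OF h(2)[OF that]], of B] g(2)[OF that] by simp
  then have "bounded_borel_on_unit h" "bounded_borel_on_unit (g k)" for k
    using g h(1) by (blast intro: bounded_borel_on_unitI)+
  note bdd = this
  obtain \<mu> \<nu> where \<mu>: "unit_measure \<mu>" and \<nu>: "unit_measure \<nu>"
    and eq: "\<And>g. bounded_borel_on_unit g \<Longrightarrow> stieltjes_integral f g = (\<integral>\<sigma>. g \<sigma> \<partial>\<mu>) - (\<integral>\<sigma>. g \<sigma> \<partial>\<nu>)"
    using representableE[OF f] by metis
  show ?thesis
    unfolding eq[OF bdd(1)] eq[OF bdd(2)]
    by (intro tendsto_diff unit_measure_integral_lim[OF \<mu> g h] unit_measure_integral_lim[OF \<nu> g h])
qed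

lemma stieltjes_measurable:
  fixes G :: "real \<Rightarrow> real \<Rightarrow> real"
  assumes f: "representable f" and G: "case_prod G \<in> borel_measurable (borel \<Otimes>\<^sub>M borel)"
    and bdd: "\<And>t. bounded (G t ` {0..1})"
  shows "(\<lambda>t. stieltjes_integral f (G t)) \<in> borel_measurable borel"
proof -
  have G1: "bounded_borel_on_unit (G t)" for t
    unfolding bounded_borel_on_unit_def using bdd measurable_Pair2[OF G, of t] by simp
  obtain \<mu> \<nu> where \<mu>: "unit_measure \<mu>" and \<nu>: "unit_measure \<nu>"
    and eq: "\<And>g. bounded_borel_on_unit g \<Longrightarrow> stieltjes_integral f g = (\<integral>\<sigma>. g \<sigma> \<partial>\<mu>) - (\<integral>\<sigma>. g \<sigma> \<partial>\<nu>)"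
    using representableE[OF f] by metis
  show ?thesis
    unfolding eq[OF G1]
    by (intro borel_measurable_diff unit_measure_integral_measurable[OF _ G] \<mu> \<nu>)
qed

text \<open>
  The result of integrating out the first variable is again an admissible integrand, as
  the exchange of integrals below requires.
\<close>
lemma integral_bounded_borel_on_unit:
  fixes G :: "real \<Rightarrow> real \<Rightarrow> real"
  assumes G: "case_prod G \<in> borel_measurable (borel \<Otimes>\<^sub>M borel)"
    and k: "integrable lborel k" "\<And>t \<sigma>. \<sigma> \<in> {0..1} \<Longrightarrow> \<bar>G t \<sigma>\<bar> \<le> k t"
  shows "bounded_borel_on_unit (\<lambda>\<sigma>. \<integral>t. G t \<sigma> \<partial>lborel)"
proof (rule bounded_borel_on_unitI)
  have "(\<lambda>(\<sigma>, t). G t \<sigma>) \<in> borel_measurable (borel \<Otimes>\<^sub>M lborel)"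
    using measurable_pair_swap[OF G]
      measurable_cong_sets[OF sets_pair_measure_cong[OF refl sets_lborel] refl, of borel borel]
    by (simp add: case_prod_beta')
  then show "(\<lambda>\<sigma>. \<integral>t. G t \<sigma> \<partial>lborel) \<in> borel_measurable borel"
    by (rule lborel.borel_measurable_lebesgue_integral)
  show "\<bar>\<integral>t. G t \<sigma> \<partial>lborel\<bar> \<le> (\<integral>t. k t \<partial>lborel)" if "\<sigma> \<in> {0..1}" for \<sigma>
  proof -
    have Gm: "(\<lambda>t. G t \<sigma>) \<in> borel_measurable lborel"
      using measurable_Pair1[OF G, of \<sigma>] by simp
    have "integrable lborel (\<lambda>t. G t \<sigma>)"
      using k(2)[OF that] by (intro Bochner_Integration.integrable_bound[OF k(1) Gm] AE_I2) (auto intro: order_trans[OF _ abs_ge_self])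
    then have "norm (\<integral>t. G t \<sigma> \<partial>lborel) \<le> (\<integral>t. k t \<partial>lborel)"
      using k(1) k(2)[OF that] by (intro Bochner_Integration.integral_norm_bound_integral) auto
    then show ?thesis by simp
  qed
qed

lemma stieltjes_Fubini:
  fixes G :: "real \<Rightarrow> real \<Rightarrow> real"
  assumes f: "representable f" and G: "case_prod G \<in> borel_measurable (borel \<Otimes>\<^sub>M borel)"
    and k: "integrable lborel k" "\<And>t \<sigma>. \<sigma> \<in> {0..1} \<Longrightarrow> \<bar>G t \<sigma>\<bar> \<le> k t"
  shows "integrable lborel (\<lambda>t. stieltjes_integral f (G t))"
    "(\<integral>t. stieltjes_integral f (G t) \<partial>lborel) = stieltjes_integral f (\<lambda>\<sigma>. \<integral>t. G t \<sigma> \<partial>lborel)"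
proof -
  have G1: "bounded_borel_on_unit (G t)" for t
    using k(2) measurable_Pair2[OF G, of t] by (intro bounded_borel_on_unitI[of _ "k t"]) auto
  have G2: "bounded_borel_on_unit (\<lambda>\<sigma>. \<integral>t. G t \<sigma> \<partial>lborel)"
    by (rule integral_bounded_borel_on_unit[OF G k])
  obtain \<mu> \<nu> where \<mu>: "unit_measure \<mu>" and \<nu>: "unit_measure \<nu>"
    and eq: "\<And>g. bounded_borel_on_unit g \<Longrightarrow> stieltjes_integral f g = (\<integral>\<sigma>. g \<sigma> \<partial>\<mu>) - (\<integral>\<sigma>. g \<sigma> \<partial>\<nu>)"
    using representableE[OF f] by metis
  show "integrable lborel (\<lambda>t. stieltjes_integral f (G t))"
    unfolding eq[OF G1]
    by (intro Bochner_Integration.integrable_diff unit_measure_Fubini(1)[OF _ G k] \<mu> \<nu>)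
  show "(\<integral>t. stieltjes_integral f (G t) \<partial>lborel) = stieltjes_integral f (\<lambda>\<sigma>. \<integral>t. G t \<sigma> \<partial>lborel)"
    unfolding eq[OF G1] eq[OF G2]
    by (subst Bochner_Integration.integral_diff)
       (simp_all only: unit_measure_Fubini[OF \<mu> G k] unit_measure_Fubini[OF \<nu> G k])
qed

section \<open>Functionals determined by intervals\<close>

text \<open>
  These are the signed measures on $[0,1]$, regarded as functionals. Sums and differences of
  signed measures then need no construction, and identities between them can be proved by the
  monotone class argument below. The value depends on the restriction to $[0,1]$ only.
\<close>
definition sigma_functional :: "((real \<Rightarrow> real) \<Rightarrow> real) \<Rightarrow> bool"
  where "sigma_functional D \<longleftrightarrow>
    (\<forall>g h. bounded_borel_on_unit g \<longrightarrow> bounded_borel_on_unit h \<longrightarrow>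
      (\<forall>\<sigma>\<in>{0..1}. g \<sigma> = h \<sigma>) \<longrightarrow> D g = D h) \<and>
    (\<forall>g h. bounded_borel_on_unit g \<longrightarrow> bounded_borel_on_unit h \<longrightarrow>
      D (\<lambda>\<sigma>. g \<sigma> + h \<sigma>) = D g + D h) \<and>
    (\<forall>c g. bounded_borel_on_unit g \<longrightarrow> D (\<lambda>\<sigma>. c * g \<sigma>) = c * D g) \<and>
    (\<forall>g h B. (\<forall>k::nat. g k \<in> borel_measurable borel) \<longrightarrow> (\<forall>k. \<forall>\<sigma>\<in>{0..1}. \<bar>g k \<sigma>\<bar> \<le> B) \<longrightarrow>
      h \<in> borel_measurable borel \<longrightarrow> (\<forall>\<sigma>\<in>{0..1}. (\<lambda>k. g k \<sigma>) \<longlonglongrightarrow> h \<sigma>) \<longrightarrow>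
      (\<lambda>k. D (g k)) \<longlonglongrightarrow> D h)"

lemma sigma_functionalD:
  assumes "sigma_functional D"
  shows "bounded_borel_on_unit g \<Longrightarrow> bounded_borel_on_unit h \<Longrightarrow>
      (\<And>\<sigma>. \<sigma> \<in> {0..1} \<Longrightarrow> g \<sigma> = h \<sigma>) \<Longrightarrow> D g = D h"
    and "bounded_borel_on_unit g \<Longrightarrow> bounded_borel_on_unit h \<Longrightarrow> D (\<lambda>\<sigma>. g \<sigma> + h \<sigma>) = D g + D h"
    and "bounded_borel_on_unit g \<Longrightarrow> D (\<lambda>\<sigma>. c * g \<sigma>) = c * D g"
    and "(\<And>k::nat. G k \<in> borel_measurable borel) \<Longrightarrow> (\<And>k \<sigma>. \<sigma> \<in> {0..1} \<Longrightarrow> \<bar>G k \<sigma>\<bar> \<le> B) \<Longrightarrow>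
      h \<in> borel_measurable borel \<Longrightarrow> (\<And>\<sigma>. \<sigma> \<in> {0..1} \<Longrightarrow> (\<lambda>k. G k \<sigma>) \<longlonglongrightarrow> h \<sigma>) \<Longrightarrow>
      (\<lambda>k. D (G k)) \<longlonglongrightarrow> D h"
  using assms unfolding sigma_functional_def by blast+

lemma sigma_functionalI:
  assumes "\<And>g h. bounded_borel_on_unit g \<Longrightarrow> bounded_borel_on_unit h \<Longrightarrow>
      (\<And>\<sigma>. \<sigma> \<in> {0..1} \<Longrightarrow> g \<sigma> = h \<sigma>) \<Longrightarrow> D g = D h"
    and "\<And>g h. bounded_borel_on_unit g \<Longrightarrow> bounded_borel_on_unit h \<Longrightarrow> D (\<lambda>\<sigma>. g \<sigma> + h \<sigma>) = D g + D h"
    and "\<And>c g. bounded_borel_on_unit g \<Longrightarrow> D (\<lambda>\<sigma>. c * g \<sigma>) = c * D g"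
    and "\<And>g h B. (\<And>k::nat. g k \<in> borel_measurable borel) \<Longrightarrow> (\<And>k \<sigma>. \<sigma> \<in> {0..1} \<Longrightarrow> \<bar>g k \<sigma>\<bar> \<le> B) \<Longrightarrow>
      h \<in> borel_measurable borel \<Longrightarrow> (\<And>\<sigma>. \<sigma> \<in> {0..1} \<Longrightarrow> (\<lambda>k. g k \<sigma>) \<longlonglongrightarrow> h \<sigma>) \<Longrightarrow>
      (\<lambda>k. D (g k)) \<longlonglongrightarrow> D h"
  shows "sigma_functional D"
  unfolding sigma_functional_def using assms by (intro conjI allI impI) blast+

lemma sigma_functional_add:
  assumes "sigma_functional D" "sigma_functional E"
  shows "sigma_functional (\<lambda>g. D g + E g)"
proof (rule sigma_functionalI)
  fix G :: "nat \<Rightarrow> real \<Rightarrow> real" and h B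
  assume "\<And>k. G k \<in> borel_measurable borel" "\<And>k \<sigma>. \<sigma> \<in> {0..1} \<Longrightarrow> \<bar>G k \<sigma>\<bar> \<le> B"
    "h \<in> borel_measurable borel" "\<And>\<sigma>. \<sigma> \<in> {0..1} \<Longrightarrow> (\<lambda>k. G k \<sigma>) \<longlonglongrightarrow> h \<sigma>"
  note lim = this
  show "(\<lambda>k. D (G k) + E (G k)) \<longlonglongrightarrow> D h + E h"
    using tendsto_add[OF sigma_functionalD(4)[OF assms(1) lim] sigma_functionalD(4)[OF assms(2) lim]] by blast
next
  fix g h assume "bounded_borel_on_unit g" "bounded_borel_on_unit h" "\<And>\<sigma>. \<sigma> \<in> {0..1} \<Longrightarrow> g \<sigma> = h \<sigma>"
  note gh = this
  show "D g + E g = D h + E h"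
    using sigma_functionalD(1)[OF assms(1) gh] sigma_functionalD(1)[OF assms(2) gh] by simp
qed (simp_all add: sigma_functionalD(2,3)[OF assms(1)] sigma_functionalD(2,3)[OF assms(2)] distrib_left)

lemma sigma_functional_cmult:
  assumes "sigma_functional D"
  shows "sigma_functional (\<lambda>g. c * D g)"
proof (rule sigma_functionalI)
  fix G :: "nat \<Rightarrow> real \<Rightarrow> real" and h B
  assume "\<And>k. G k \<in> borel_measurable borel" "\<And>k \<sigma>. \<sigma> \<in> {0..1} \<Longrightarrow> \<bar>G k \<sigma>\<bar> \<le> B"
    "h \<in> borel_measurable borel" "\<And>\<sigma>. \<sigma> \<in> {0..1} \<Longrightarrow> (\<lambda>k. G k \<sigma>) \<longlonglongrightarrow> h \<sigma>"
  note lim = this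
  show "(\<lambda>k. c * D (G k)) \<longlonglongrightarrow> c * D h"
    by (rule tendsto_mult_left) (rule sigma_functionalD(4)[OF assms(1) lim])
next
  fix g h assume "bounded_borel_on_unit g" "bounded_borel_on_unit h" "\<And>\<sigma>. \<sigma> \<in> {0..1} \<Longrightarrow> g \<sigma> = h \<sigma>"
  note gh = this
  show "c * D g = c * D h"
    using sigma_functionalD(1)[OF assms(1) gh] by simp
qed (simp_all add: sigma_functionalD(2,3)[OF assms(1)] distrib_left)

lemma sigma_functional_sum:
  assumes "finite I" "\<And>i. i \<in> I \<Longrightarrow> sigma_functional (D i)"
  shows "sigma_functional (\<lambda>g. \<Sum>i\<in>I. D i g)"
  using assms
proof (induction I rule: finite_induct)
  case empty
  show ?case by (rule sigma_functionalI) auto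
qed (simp add: sigma_functional_add)

lemma sigma_functional_stieltjes:
  assumes "representable f"
  shows "sigma_functional (stieltjes_integral f)"
  by (rule sigma_functionalI)
     (rule stieltjes_cong stieltjes_add[OF assms] stieltjes_cmult[OF assms] stieltjes_lim[OF assms]; assumption)+

text \<open>
  The Borel sets on whose indicators \<open>D\<close> vanishes form a Dynkin system, by additivity and continuity, so
  the intervals, which are stable under intersection and generate the Borel sets, suffice;
  the class of functions that \<open>D\<close> annihilates is closed under monotone limits. Only \<open>t > 0\<close> has to be
  tested, because continuity yields the interval that ends at 0: this matches the normalization
  by which \<open>f 0 = 0\<close> even if \<open>df\<close> has an atom at 0.
\<close>
lemma sigma_functional_eq_0:
  assumes D: "sigma_functional D" and g: "bounded_borel_on_unit g"
    and gen: "\<And>t. t \<in> {0<..1} \<Longrightarrow> D (indicator {..t}) = 0"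
  shows "D g = 0"
proof -
  note cong = sigma_functionalD(1)[OF D] and additive = sigma_functionalD(2)[OF D]
    and cmult = sigma_functionalD(3)[OF D] and lim = sigma_functionalD(4)[OF D]
  note ind = bounded_borel_on_unit_indicator
  have zero: "D (\<lambda>_. 0) = 0"
    using cmult[of "\<lambda>_. 0" 0] by (simp add: bounded_borel_on_unitI[of _ 0])
  have "indicat_real {} = (\<lambda>_ :: real. 0)" by auto
  then have emp: "D (indicator {}) = 0" using zero by metis
  have set: "D (indicator A) = 0" if "A \<in> sets borel" for A
  proof -
    have borel: "sets (borel :: real measure) = sigma_sets UNIV (range atMost)"
      by (subst borel_eq_atMost) (rule sets_measure_of, simp)
    have "Int_stable (range (atMost :: real \<Rightarrow> _))"
      by (auto simp: Int_stable_def)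
    moreover have "range atMost \<subseteq> Pow (UNIV :: real set)" by simp
    moreover have "A \<in> sigma_sets UNIV (range atMost)" using that borel by simp
    ultimately show ?thesis
    proof (induction rule: sigma_sets_induct_disjoint)
      case (basic A)
      then obtain t where A: "A = {..t}" by auto
      consider "t < 0" | "t = 0" | "t \<in> {0<..1}" | "1 < t" by fastforce
      then show ?case
      proof cases
        case 1
        have "D (indicator A) = D (\<lambda>_. 0)"
          using 1 unfolding A by (intro cong ind bounded_borel_on_unitI[of _ 0]) auto
        then show ?thesis using zero by simp
      next
        case 2
        (* On [0,1] the indicators of [0, 1/(k+1)] decrease to that of {0}. *)
        have "(\<lambda>k. D (indicator {..1 / Suc k})) \<longlonglongrightarrow> D (indicator A)"
        proof (rule lim[of _ 1])
          fix \<sigma> :: real assume "\<sigma> \<in> {0..1}"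
          show "(\<lambda>k. indicat_real {..1 / Suc k} \<sigma>) \<longlonglongrightarrow> indicator A \<sigma>"
          proof (cases "\<sigma> = 0")
            case False
            then have "\<sigma> > 0" using \<open>\<sigma> \<in> {0..1}\<close> by simp
            then have "\<forall>\<^sub>F k in sequentially. 1 / real (Suc k) < \<sigma>"
              using order_tendstoD(2)[OF LIMSEQ_inverse_real_of_nat] by (simp add: inverse_eq_divide)
            then show ?thesis
              using \<open>\<sigma> > 0\<close> unfolding A 2
              by (intro tendsto_eventually) (auto elim!: eventually_mono)
          qed (simp add: A 2)
        qed (auto simp: A indicator_def)
        moreover have "D (indicator {..1 / Suc k}) = 0" for k
          by (intro gen) auto
        ultimately show ?thesis by (simp add: LIMSEQ_const_iff)
      next
        case 3
        then show ?thesis using gen A by simp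
      next
        case 4
        have "D (indicator A) = D (indicator {..1})"
          using 4 unfolding A by (intro cong ind) (auto simp: indicator_def)
        then show ?thesis using gen by simp
      qed
    next
      case empty
      show ?case by (rule emp)
    next
      case (compl A)
      then have A: "A \<in> sets borel" using borel by simp
      (* On [0,1] the constant 1 agrees with the indicator of an interval in the generator. *)
      have "D (\<lambda>\<sigma>. indicator (UNIV - A) \<sigma> + indicator A \<sigma>) = D (indicator {..1})"
        using A by (intro cong ind bounded_borel_on_unit_add) (auto simp: indicator_def)
      then show ?case
        using A compl gen[of 1] additive[OF ind ind, of "UNIV - A" A] by simp
    next
      case (union A)
      have A: "A n \<in> sets borel" for n using union(2) borel by auto
      define U where "U k = (\<Union>n<k. A n)" for k
      have U: "U k \<in> sets borel" for k using A unfolding U_def by auto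
      have U0: "D (indicator (U k)) = 0" for k
      proof (induction k)
        case 0
        show ?case using zero by (simp add: U_def)
      next
        case (Suc k)
        have "indicat_real (U (Suc k)) \<sigma> = indicator (U k) \<sigma> + indicator (A k) \<sigma>" for \<sigma>
        proof -
          have "U k \<inter> A k = {}"
            unfolding U_def using union(1)
            by (auto simp: disjoint_family_on_def) (metis IntI empty_iff less_irrefl)
          moreover have "U (Suc k) = U k \<union> A k"
            unfolding U_def by (auto simp: less_Suc_eq)
          ultimately show ?thesis
            by (auto simp: indicator_def)
        qed
        then have "D (indicator (U (Suc k))) = D (\<lambda>\<sigma>. indicator (U k) \<sigma> + indicator (A k) \<sigma>)"
          by presburger
        also have "\<dots> = D (indicator (U k)) + D (indicator (A k))"
          by (rule additive[OF ind[OF U] ind[OF A]])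
        also have "\<dots> = 0"
          unfolding Suc union(3) by simp
        finally show ?case .
      qed
      have "(\<lambda>k. D (indicator (U k))) \<longlonglongrightarrow> D (indicator (\<Union>n. A n))"
      proof (rule lim[of _ 1])
        fix \<sigma> :: real
        have "(\<lambda>k. indicat_real (\<Union>n<k. A n) \<sigma>) \<longlonglongrightarrow> indicator (\<Union>n. A n) \<sigma>"
          by (rule LIMSEQ_indicator_UN)
        then show "(\<lambda>k. indicat_real (U k) \<sigma>) \<longlonglongrightarrow> indicator (\<Union>n. A n) \<sigma>"
          unfolding U_def .
      qed (use U A in \<open>auto simp: indicator_def\<close>)
      then show ?case by (simp add: U0 LIMSEQ_const_iff)
    qed
  qed
  have nonneg: "D u = 0" if "u \<in> borel_measurable borel" "\<And>\<sigma>. 0 \<le> u \<sigma>" "bounded_borel_on_unit u" for u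
    using that
  proof (induction u rule: borel_measurable_induct_real)
    case (set A)
    then show ?case using assms by (simp add: \<open>\<And>A. A \<in> sets borel \<Longrightarrow> D (indicator A) = 0\<close>)
  next
    case (mult u c)
    show ?case
    proof (cases "c = 0")
      case False
      have "bounded_borel_on_unit (\<lambda>\<sigma>. (1 / c) * (c * u \<sigma>))"
        by (intro bounded_borel_on_unit_cmult mult)
      then have "bounded_borel_on_unit u" using False by simp
      then show ?thesis using mult cmult by simp
    qed (simp add: zero)
  next
    case (add u v)
    obtain B where B: "\<And>\<sigma>. \<sigma> \<in> {0..1} \<Longrightarrow> \<bar>v \<sigma> + u \<sigma>\<bar> \<le> B"
      using bounded_borel_on_unitE[OF add.prems] by metis
    have uv: "bounded_borel_on_unit u" "bounded_borel_on_unit v"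
    proof -
      have "\<bar>u \<sigma>\<bar> \<le> B" "\<bar>v \<sigma>\<bar> \<le> B" if "\<sigma> \<in> {0..1}" for \<sigma>
        using B[OF that] add.hyps(2)[of \<sigma>] add.hyps(4)[of \<sigma>] by linarith+
      then show "bounded_borel_on_unit u" "bounded_borel_on_unit v"
        using add.hyps(1,3) by (blast intro: bounded_borel_on_unitI)+
    qed
    then show ?case using add.IH additive[OF uv(2,1)] by simp
  next
    case (seq U)
    obtain B where B: "\<And>\<sigma>. \<sigma> \<in> {0..1} \<Longrightarrow> \<bar>u \<sigma>\<bar> \<le> B"
      using bounded_borel_on_unitE[OF seq.prems] by metis
    have le: "U k \<sigma> \<le> u \<sigma>" for k \<sigma>
      using incseq_le[of "\<lambda>k. U k \<sigma>" "u \<sigma>" k] seq.hyps by (auto simp: incseq_def le_fun_def)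
    have UB: "\<bar>U k \<sigma>\<bar> \<le> B" if "\<sigma> \<in> {0..1}" for k \<sigma>
      using B[OF that] le[of k \<sigma>] seq.hyps(2)[of k \<sigma>] by linarith
    have "(\<lambda>k. D (U k)) \<longlonglongrightarrow> D u"
      using seq.hyps seq.prems by (intro lim[of U B] UB) auto
    moreover have "D (U k) = 0" for k
      using UB seq.hyps by (intro seq.IH bounded_borel_on_unitI[of _ B]) auto
    ultimately show ?case by (simp add: LIMSEQ_const_iff)
  qed
  obtain B where B: "\<And>\<sigma>. \<sigma> \<in> {0..1} \<Longrightarrow> \<bar>g \<sigma>\<bar> \<le> B"
    using bounded_borel_on_unitE[OF g] by metis
  have gm [measurable]: "g \<in> borel_measurable borel" using g by (simp add: bounded_borel_on_unit_def)
  have pn: "bounded_borel_on_unit (\<lambda>\<sigma>. max 0 (g \<sigma>))" "bounded_borel_on_unit (\<lambda>\<sigma>. max 0 (- g \<sigma>))"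
  proof -
    have "\<bar>max 0 (g \<sigma>)\<bar> \<le> B" "\<bar>max 0 (- g \<sigma>)\<bar> \<le> B" if "\<sigma> \<in> {0..1}" for \<sigma>
      using B[OF that] by auto
    moreover have "(\<lambda>\<sigma>. max 0 (g \<sigma>)) \<in> borel_measurable borel" "(\<lambda>\<sigma>. max 0 (- g \<sigma>)) \<in> borel_measurable borel"
      by measurable
    ultimately show "bounded_borel_on_unit (\<lambda>\<sigma>. max 0 (g \<sigma>))" "bounded_borel_on_unit (\<lambda>\<sigma>. max 0 (- g \<sigma>))"
      by (blast intro: bounded_borel_on_unitI)+
  qed
  have "D g = D (\<lambda>\<sigma>. max 0 (g \<sigma>) + (-1) * max 0 (- g \<sigma>))"
    by (intro arg_cong[of _ _ D]) (auto simp: max_def)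
  also have "\<dots> = D (\<lambda>\<sigma>. max 0 (g \<sigma>)) + (-1) * D (\<lambda>\<sigma>. max 0 (- g \<sigma>))"
    using pn by (simp only: additive cmult bounded_borel_on_unit_cmult)
  also have "\<dots> = 0"
    using pn by (simp add: nonneg)
  finally show ?thesis .
qed

lemma sigma_functional_eqI:
  assumes "sigma_functional D" "sigma_functional E" "bounded_borel_on_unit g"
    and "\<And>t. t \<in> {0<..1} \<Longrightarrow> D (indicator {..t}) = E (indicator {..t})"
  shows "D g = E g"
  using sigma_functional_eq_0[OF sigma_functional_add[OF assms(1) sigma_functional_cmult[OF assms(2)]] assms(3), of "-1"]
    assms(4) by simp

lemma stieltjes_indicator:
  assumes "representable f" "t \<in> {0<..1}"
  shows "stieltjes_integral f (indicator {..t}) = f t"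
proof -
  obtain \<mu> \<nu> where \<mu>: "unit_measure \<mu>" and \<nu>: "unit_measure \<nu>" and df: "represents_df f \<mu> \<nu>"
    and eq: "\<And>g. bounded_borel_on_unit g \<Longrightarrow> stieltjes_integral f g = (\<integral>\<sigma>. g \<sigma> \<partial>\<mu>) - (\<integral>\<sigma>. g \<sigma> \<partial>\<nu>)"
    using representableE[OF assms(1)] by metis
  have *: "(\<integral>\<sigma>. indicator {..t} \<sigma> \<partial>M) = measure M {0..t}" if M: "unit_measure M" for M
  proof -
    have "{..t} \<inter> space M = {0..t}" using assms(2) by (auto simp: unit_measure_space[OF M])
    then show ?thesis by simp
  qed
  show ?thesis
    using df assms(2) unfolding eq[OF bounded_borel_on_unit_indicator[OF atMost_borel]] *[OF \<mu>] *[OF \<nu>]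
    by (simp add: represents_df_def)
qed

text \<open>
  Linearity in the integrator follows from uniqueness: both sides are sigma functionals with
  the same distribution function.
\<close>
lemma stieltjes_add_integrator:
  assumes f: "representable f1" "representable f2" "representable (\<lambda>t. f1 t + f2 t)"
    and g: "bounded_borel_on_unit g"
  shows "stieltjes_integral (\<lambda>t. f1 t + f2 t) g = stieltjes_integral f1 g + stieltjes_integral f2 g"
  by (rule sigma_functional_eqI[where D = "stieltjes_integral (\<lambda>t. f1 t + f2 t)"
        and E = "\<lambda>g. stieltjes_integral f1 g + stieltjes_integral f2 g", OF _ _ g])
     (simp_all add: stieltjes_indicator f sigma_functional_add sigma_functional_stieltjes)

lemma stieltjes_cmult_integrator:
  assumes f: "representable f" "representable (\<lambda>t. c * f t)" and g: "bounded_borel_on_unit g"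
  shows "stieltjes_integral (\<lambda>t. c * f t) g = c * stieltjes_integral f g"
  by (rule sigma_functional_eqI[where D = "stieltjes_integral (\<lambda>t. c * f t)"
        and E = "\<lambda>g. c * stieltjes_integral f g", OF _ _ g])
     (simp_all add: stieltjes_indicator f sigma_functional_cmult sigma_functional_stieltjes)

section \<open>The pairing of vector functions and the total variation\<close>

lemma borel_measurable_vec_nth:
  fixes g :: "'a \<Rightarrow> real ^ 'n"
  assumes "g \<in> borel_measurable M"
  shows "(\<lambda>x. g x $ i) \<in> borel_measurable M"
proof -
  have "(\<lambda>v :: real ^ 'n. v $ i) \<in> borel_measurable borel"
    by (intro borel_measurable_continuous_onI continuous_intros)
  from measurable_compose[OF assms this] show ?thesis .
qed

lemma bounded_borel_on_unit_vec_nth: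
  fixes g :: "real \<Rightarrow> real ^ 'n"
  assumes "g \<in> borel_measurable borel" "\<And>\<sigma>. \<sigma> \<in> {0..1} \<Longrightarrow> norm (g \<sigma>) \<le> B"
  shows "bounded_borel_on_unit (\<lambda>\<sigma>. g \<sigma> $ i)"
  using assms by (intro bounded_borel_on_unitI[of _ B] borel_measurable_vec_nth)
    (auto intro: order_trans[OF component_le_norm_cart])

lemma integral_dot_cong:
  assumes "\<And>\<sigma>. \<sigma> \<in> {0..1} \<Longrightarrow> g \<sigma> = h \<sigma>"
  shows "integral_dot f g = integral_dot f h"
  unfolding integral_dot_def using assms by (intro sum.cong stieltjes_cong refl) simp

lemma integral_dot_lim:
  fixes g :: "nat \<Rightarrow> real \<Rightarrow> real ^ 'n"
  assumes g: "\<And>k. g k \<in> borel_measurable borel" "\<And>k \<sigma>. \<sigma> \<in> {0..1} \<Longrightarrow> norm (g k \<sigma>) \<le> B"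
    and h: "h \<in> borel_measurable borel" "\<And>\<sigma>. \<sigma> \<in> {0..1} \<Longrightarrow> (\<lambda>k. g k \<sigma>) \<longlonglongrightarrow> h \<sigma>"
  shows "(\<lambda>k. integral_dot f (g k)) \<longlonglongrightarrow> integral_dot f h"
  unfolding integral_dot_def
  by (intro tendsto_sum stieltjes_lim[where B = B] representable_nbv_component borel_measurable_vec_nth
      g h tendsto_vec_nth order_trans[OF component_le_norm_cart])

lemma integral_dot_linear:
  fixes g h :: "real \<Rightarrow> real ^ 'n"
  assumes g: "g \<in> borel_measurable borel" "\<And>\<sigma>. \<sigma> \<in> {0..1} \<Longrightarrow> norm (g \<sigma>) \<le> B"
    and h: "h \<in> borel_measurable borel" "\<And>\<sigma>. \<sigma> \<in> {0..1} \<Longrightarrow> norm (h \<sigma>) \<le> B'"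
  shows "integral_dot f (\<lambda>\<sigma>. g \<sigma> + h \<sigma>) = integral_dot f g + integral_dot f h"
    "integral_dot f (\<lambda>\<sigma>. c *\<^sub>R g \<sigma>) = c * integral_dot f g"
  using bounded_borel_on_unit_vec_nth[OF g] bounded_borel_on_unit_vec_nth[OF h]
  by (simp_all add: integral_dot_def stieltjes_add[OF representable_nbv_component]
      stieltjes_cmult[OF representable_nbv_component] sum.distrib sum_distrib_left)

lemma integral_dot_integrator_linear:
  fixes g :: "real \<Rightarrow> real ^ 'n"
  assumes g: "g \<in> borel_measurable borel" "\<And>\<sigma>. \<sigma> \<in> {0..1} \<Longrightarrow> norm (g \<sigma>) \<le> B"
  shows "integral_dot (e + f) g = integral_dot e g + integral_dot f g"
    "integral_dot (c *\<^sub>R f) g = c * integral_dot f g"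
proof -
  have "stieltjes_integral (\<lambda>t. apply_nbv (e + f) t $ i) (\<lambda>\<sigma>. g \<sigma> $ i) =
      stieltjes_integral (\<lambda>t. apply_nbv e t $ i) (\<lambda>\<sigma>. g \<sigma> $ i) +
      stieltjes_integral (\<lambda>t. apply_nbv f t $ i) (\<lambda>\<sigma>. g \<sigma> $ i)" for i
    using stieltjes_add_integrator[OF representable_nbv_component representable_nbv_component _
        bounded_borel_on_unit_vec_nth[OF g], of e i f i i] representable_nbv_component[of "e + f" i]
    by simp
  then show "integral_dot (e + f) g = integral_dot e g + integral_dot f g"
    unfolding integral_dot_def by (simp only: sum.distrib)
  have "stieltjes_integral (\<lambda>t. apply_nbv (c *\<^sub>R f) t $ i) (\<lambda>\<sigma>. g \<sigma> $ i) =
      c * stieltjes_integral (\<lambda>t. apply_nbv f t $ i) (\<lambda>\<sigma>. g \<sigma> $ i)" for i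
    using stieltjes_cmult_integrator[OF representable_nbv_component _
        bounded_borel_on_unit_vec_nth[OF g], of c f i i] representable_nbv_component[of "c *\<^sub>R f" i]
    by simp
  then show "integral_dot (c *\<^sub>R f) g = c * integral_dot f g"
    unfolding integral_dot_def by (simp only: sum_distrib_left)
qed

text \<open>
  For an integrand with a fixed direction only the scalar measure \<open>d(f \<bullet> u)\<close> matters, and this is what
  the dominating measure of \<open>f\<close> controls.
\<close>
lemma integral_dot_const_direction:
  fixes u :: "real ^ 'n"
  assumes g: "bounded_borel_on_unit g"
  shows "integral_dot f (\<lambda>\<sigma>. g \<sigma> *\<^sub>R u) = stieltjes_integral (\<lambda>t. apply_nbv f t \<bullet> u) g"
proof -
  have "stieltjes_integral (\<lambda>t. apply_nbv f t \<bullet> u) g =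
      (\<Sum>i\<in>UNIV. u $ i * stieltjes_integral (\<lambda>t. apply_nbv f t $ i) g)"
  proof (rule sigma_functional_eqI[OF _ _ g])
    show "sigma_functional (stieltjes_integral (\<lambda>t. apply_nbv f t \<bullet> u))"
      "sigma_functional (\<lambda>g. \<Sum>i\<in>UNIV. u $ i * stieltjes_integral (\<lambda>t. apply_nbv f t $ i) g)"
      by (intro sigma_functional_stieltjes representable_nbv_inner representable_nbv_component
          sigma_functional_sum sigma_functional_cmult finite)+
    fix t :: real assume "t \<in> {0<..1}"
    then show "stieltjes_integral (\<lambda>t. apply_nbv f t \<bullet> u) (indicator {..t}) =
        (\<Sum>i\<in>UNIV. u $ i * stieltjes_integral (\<lambda>t. apply_nbv f t $ i) (indicator {..t}))"
      by (subst stieltjes_indicator[OF representable_nbv_inner])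
         (simp_all add: stieltjes_indicator representable_nbv_component inner_vec_def mult.commute)
  qed
  also have "\<dots> = integral_dot f (\<lambda>\<sigma>. g \<sigma> *\<^sub>R u)"
    using g by (simp add: integral_dot_def mult.commute[of "g _"] stieltjes_cmult representable_nbv_component)
  finally show ?thesis by simp
qed

text \<open>
  Let \<open>V t\<close> be the variation of \<open>f\<close> on $[0,t]$. An increment of \<open>f \<bullet> u\<close> is at most the
  increment of \<open>V\<close>, so \<open>V - f \<bullet> u\<close> is nondecreasing as well and its measure is
  positive. Thus \<open>d(f \<bullet> u) = dV - d(V - f \<bullet> u) \<le> dV\<close> on all Borel sets. It matters that the first
  measure is the same for all directions and has mass exactly the norm of \<open>f\<close>.
\<close>
lemma ex_dominating_measure:
  fixes f :: "('a :: euclidean_space) nbv"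
  obtains \<mu> where "unit_measure \<mu>" "measure \<mu> {0..1} = norm f"
    "\<And>u. norm u \<le> 1 \<Longrightarrow> \<exists>\<nu>. represents_df (\<lambda>t. apply_nbv f t \<bullet> u) \<mu> \<nu>"
proof -
  let ?f = "apply_nbv f"
  let ?V = "total_variation ?f 0"
  have inc: "?V s + norm (?f t - ?f s) \<le> ?V t" if "0 \<le> s" "s \<le> t" "t \<le> 1" for s t
    by (rule total_variation_increment[OF nbv_bounded_variation that])
  have V0: "?V 0 = 0"
  proof (rule antisym)
    have zero: "r = 0" if "r \<in> variation_sums ?f 0 0" for r
    proof -
      from that obtain k p where r: "r = (\<Sum>i<k. norm (?f (p (Suc i)) - ?f (p i)))"
        and p: "p ` {..k} \<subseteq> {0..0}" unfolding variation_sums_def by blast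
      have "p i = 0" if "i \<le> k" for i using p that by auto
      then show "r = 0" unfolding r by (intro sum.neutral) auto
    qed
    then show "?V 0 \<le> 0" by (intro total_variation_least) auto
    have "bounded_variation_on ?f 0 0"
      using zero by (intro bounded_variation_onI[of _ _ _ 0]) auto
    from total_variation_upper[OF this norm_diff_in_variation_sums[of 0 0 0 0 ?f]]
    show "0 \<le> ?V 0" by simp
  qed
  have V: "?V s \<le> ?V t" if "0 \<le> s" "s \<le> t" "t \<le> 1" for s t
    using inc[OF that] norm_ge_zero[of "?f t - ?f s"] by linarith
  obtain \<mu> where \<mu>: "finite_measure \<mu>" "sets \<mu> = sets (restrict_space borel {0..1})"
    "\<And>t. t \<in> {0<..<1} \<Longrightarrow> (?V \<longlongrightarrow> measure \<mu> {0..t}) (at_right t)"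
    "?V 1 = measure \<mu> {0..1}"
    using ex_monotone_measure[of ?V, OF V] V0 by auto
  show thesis
  proof (rule that)
    show "unit_measure \<mu>" using \<mu> by (simp add: unit_measure_def)
    show "measure \<mu> {0..1} = norm f" using \<mu> by (simp add: norm_nbv_def)
    fix u :: 'a assume u: "norm u \<le> 1"
    let ?Q = "\<lambda>t. ?V t - ?f t \<bullet> u"
    have Q: "?Q s \<le> ?Q t" if "0 \<le> s" "s \<le> t" "t \<le> 1" for s t
    proof -
      have "(?f t - ?f s) \<bullet> u \<le> norm (?f t - ?f s) * norm u" by (rule norm_cauchy_schwarz)
      also have "\<dots> \<le> norm (?f t - ?f s)" using u by (simp add: mult_left_le)
      finally show ?thesis using inc[OF that] by (simp add: inner_diff_left)
    qed
    obtain \<nu> where \<nu>: "finite_measure \<nu>" "sets \<nu> = sets (restrict_space borel {0..1})"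
      "\<And>t. t \<in> {0<..<1} \<Longrightarrow> (?Q \<longlongrightarrow> measure \<nu> {0..t}) (at_right t)"
      "?Q 1 = measure \<nu> {0..1}"
      using ex_monotone_measure[of ?Q, OF Q] V0 by auto
    have "measure \<mu> {0..t} - measure \<nu> {0..t} = ?f t \<bullet> u" if t: "t \<in> {0<..1}" for t
    proof (cases "t = 1")
      case False
      then have t: "t \<in> {0<..<1}" using t by auto
      have "((\<lambda>s. ?V s - ?Q s) \<longlongrightarrow> measure \<mu> {0..t} - measure \<nu> {0..t}) (at_right t)"
        by (intro tendsto_diff[OF \<mu>(3)[OF t] \<nu>(3)[OF t]])
      then have "((\<lambda>s. ?f s \<bullet> u) \<longlongrightarrow> measure \<mu> {0..t} - measure \<nu> {0..t}) (at_right t)" by simp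
      moreover have "((\<lambda>s. ?f s \<bullet> u) \<longlongrightarrow> ?f t \<bullet> u) (at_right t)"
        using nbv_right_continuous[OF t] by (intro tendsto_intros) (simp add: continuous_within)
      ultimately show ?thesis by (intro tendsto_unique[of "at_right t"]) auto
    qed (use \<mu>(4) \<nu>(4) in simp)
    then show "\<exists>\<nu>. represents_df (\<lambda>t. ?f t \<bullet> u) \<mu> \<nu>"
      using \<mu>(1,2) \<nu>(1,2) by (auto simp: represents_df_def)
  qed
qed

text \<open>
  For a simple function with values \<open>v\<close> on \<open>A v\<close> the integral is the sum of the numbers
  \<open>d(f \<bullet> v)(A v) \<le> norm v * \<mu>(A v)\<close>, with the dominating measure \<open>\<mu>\<close>. This gives the Euclidean bound
  with constant 1, which a bound component by component would miss by a factor depending on the dimension.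
\<close>
lemma integral_dot_bound:
  fixes f :: "(real ^ 'n) nbv" and g :: "real \<Rightarrow> real ^ 'n"
  assumes g: "g \<in> borel_measurable borel" "\<And>\<sigma>. \<sigma> \<in> {0..1} \<Longrightarrow> norm (g \<sigma>) \<le> B"
  shows "\<bar>integral_dot f g\<bar> \<le> norm f * B"
proof -
  obtain \<mu> where \<mu>: "unit_measure \<mu>" and tv: "measure \<mu> {0..1} = norm f"
    and dom: "\<And>u. norm u \<le> 1 \<Longrightarrow> \<exists>\<nu>. represents_df (\<lambda>t. apply_nbv f t \<bullet> u) \<mu> \<nu>"
    using ex_dominating_measure[of f] by metis
  interpret finite_measure \<mu> using \<mu> by (rule unit_measure_finite)
  have B: "0 \<le> B" using order_trans[OF norm_ge_zero g(2)[of 0]] by simp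
  have ind: "integral_dot f (\<lambda>\<sigma>. indicator A \<sigma> *\<^sub>R v) \<le> norm v * measure \<mu> (A \<inter> {0..1})"
    if A: "A \<in> sets borel" for A v
  proof -
    have "norm (sgn v) \<le> 1" by (simp add: norm_sgn)
    then obtain \<nu> where \<nu>: "represents_df (\<lambda>t. apply_nbv f t \<bullet> sgn v) \<mu> \<nu>"
      using dom by blast
    note ind = bounded_borel_on_unit_indicator[OF A]
    have "integral_dot f (\<lambda>\<sigma>. indicator A \<sigma> *\<^sub>R sgn v) =
        (\<integral>\<sigma>. indicator A \<sigma> \<partial>\<mu>) - (\<integral>\<sigma>. indicator A \<sigma> \<partial>\<nu>)"
      unfolding integral_dot_const_direction[OF ind] by (rule stieltjes_eq[OF \<nu> ind])
    also have "\<dots> \<le> measure \<mu> (A \<inter> {0..1})"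
      by (simp add: unit_measure_space[OF \<mu>])
    finally have le: "integral_dot f (\<lambda>\<sigma>. indicator A \<sigma> *\<^sub>R sgn v) \<le> measure \<mu> (A \<inter> {0..1})" .
    have "norm v *\<^sub>R sgn v = v"
      by (cases "v = 0") (simp_all add: sgn_div_norm)
    then have "norm v *\<^sub>R (indicator A \<sigma> *\<^sub>R sgn v) = indicator A \<sigma> *\<^sub>R v" for \<sigma> :: real
      by (simp add: indicator_def)
    then have "integral_dot f (\<lambda>\<sigma>. indicator A \<sigma> *\<^sub>R v) =
        integral_dot f (\<lambda>\<sigma>. norm v *\<^sub>R (indicator A \<sigma> *\<^sub>R sgn v))"
      by presburger
    also have "\<dots> = norm v * integral_dot f (\<lambda>\<sigma>. indicator A \<sigma> *\<^sub>R sgn v)"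
    proof (rule integral_dot_linear(2)[where B = 1 and h = "\<lambda>_. 0" and B' = 0])
      show "(\<lambda>\<sigma>. indicator A \<sigma> *\<^sub>R sgn v) \<in> borel_measurable borel"
        using A by measurable
    qed (auto simp: indicator_def norm_sgn)
    finally show ?thesis
      using le by (simp add: mult_left_mono)
  qed
  have simple: "integral_dot f s \<le> B * norm f"
    if s: "simple_function borel s" "\<And>\<sigma>. norm (s \<sigma>) \<le> B" for s
  proof -
    define A where "A v = s -` {v}" for v
    have fin: "finite (range s)" using simple_functionD(1)[OF s(1)] by simp
    have A: "A v \<in> sets borel" for v
      using simple_functionD(2)[OF s(1), of "{v}"] by (simp add: A_def)
    have sub: "integral_dot f (\<lambda>\<sigma>. \<Sum>v\<in>V. indicator (A v) \<sigma> *\<^sub>R v) \<le> (\<Sum>v\<in>V. norm v * measure \<mu> (A v \<inter> {0..1}))"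
      if "finite V" "V \<subseteq> range s" for V
      using that
    proof (induction V rule: finite_induct)
      case empty
      have "integral_dot f (\<lambda>_. 0) = 0"
        using integral_dot_linear(2)[of "\<lambda>_. 0" 0 "\<lambda>_. 0" 0 f 0] by simp
      then show ?case by simp
    next
      case (insert v V)
      have "integral_dot f (\<lambda>\<sigma>. indicator (A v) \<sigma> *\<^sub>R v + (\<Sum>v\<in>V. indicator (A v) \<sigma> *\<^sub>R v)) =
          integral_dot f (\<lambda>\<sigma>. indicator (A v) \<sigma> *\<^sub>R v) + integral_dot f (\<lambda>\<sigma>. \<Sum>v\<in>V. indicator (A v) \<sigma> *\<^sub>R v)"
      proof (rule integral_dot_linear(1))
        show "(\<lambda>\<sigma>. indicator (A v) \<sigma> *\<^sub>R v) \<in> borel_measurable borel"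
          "(\<lambda>\<sigma>. \<Sum>v\<in>V. indicator (A v) \<sigma> *\<^sub>R v) \<in> borel_measurable borel"
          using A by measurable
        show "norm (indicator (A v) \<sigma> *\<^sub>R v) \<le> norm v" for \<sigma>
          by (auto simp: indicator_def)
        show "norm (\<Sum>v\<in>V. indicator (A v) \<sigma> *\<^sub>R v) \<le> (\<Sum>v\<in>V. norm v)" for \<sigma>
          by (rule sum_norm_le) (auto simp: indicator_def)
      qed
      then show ?case
        unfolding sum.insert[OF insert.hyps] using insert.IH insert.prems ind[OF A, of v v] by simp
    qed
    have "s \<sigma> = (\<Sum>v\<in>range s. indicator (A v) \<sigma> *\<^sub>R v)" for \<sigma>
    proof -
      have "(\<Sum>v\<in>range s. indicator (A v) \<sigma> *\<^sub>R v) = (\<Sum>v\<in>range s. if v = s \<sigma> then v else 0)"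
        by (intro sum.cong) (auto simp: A_def indicator_def)
      also have "\<dots> = s \<sigma>" using fin by (subst sum.delta) auto
      finally show ?thesis by simp
    qed
    then have "integral_dot f s = integral_dot f (\<lambda>\<sigma>. \<Sum>v\<in>range s. indicator (A v) \<sigma> *\<^sub>R v)"
      by (rule integral_dot_cong)
    also have "\<dots> \<le> (\<Sum>v\<in>range s. norm v * measure \<mu> (A v \<inter> {0..1}))"
      by (rule sub[OF fin]) simp
    also have "\<dots> \<le> (\<Sum>v\<in>range s. B * measure \<mu> (A v \<inter> {0..1}))"
      using s(2) by (intro sum_mono mult_right_mono) auto
    also have "\<dots> = B * measure \<mu> (\<Union>v\<in>range s. A v \<inter> {0..1})"
    proof -
      have "A v \<inter> {0..1} \<in> sets \<mu>" for v
        using \<mu> A[of v] by (auto simp: unit_measure_def sets_restrict_space)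
      then have "measure \<mu> (\<Union>v\<in>range s. A v \<inter> {0..1}) = (\<Sum>v\<in>range s. measure \<mu> (A v \<inter> {0..1}))"
        using fin by (intro finite_measure_finite_Union) (auto simp: disjoint_family_on_def A_def)
      then show ?thesis by (simp add: sum_distrib_left)
    qed
    also have "(\<Union>v\<in>range s. A v \<inter> {0..1}) = {0..1}"
      by (auto simp: A_def)
    finally show ?thesis by (simp add: tv)
  qed
  have upper: "integral_dot f g \<le> norm f * B"
    if g: "g \<in> borel_measurable borel" "\<And>\<sigma>. \<sigma> \<in> {0..1} \<Longrightarrow> norm (g \<sigma>) \<le> B" for g :: "real \<Rightarrow> real ^ 'n"
  proof -
    (* The approximating simple functions may exceed the bound B by a factor of 2.
       The projection onto the ball of radius B is continuous and fixes g. *)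
    let ?c = "closest_point (cball (0 :: real ^ 'n) B)"
    have c: "norm (?c x) \<le> B" for x
      using closest_point_in_set[of "cball 0 B" x] B by auto
    obtain F where F: "\<And>k. simple_function borel (F k)" "\<And>\<sigma>. (\<lambda>k. F k \<sigma>) \<longlonglongrightarrow> g \<sigma>"
      using borel_measurable_implies_sequence_metric[OF g(1), of 0] by auto
    have cF: "simple_function borel (\<lambda>\<sigma>. ?c (F k \<sigma>))" for k
      using simple_function_compose[OF F(1), of ?c k] by (simp add: comp_def)
    have "(\<lambda>k. integral_dot f (\<lambda>\<sigma>. ?c (F k \<sigma>))) \<longlonglongrightarrow> integral_dot f g"
    proof (rule integral_dot_lim[OF _ _ g(1)])
      show "(\<lambda>\<sigma>. ?c (F k \<sigma>)) \<in> borel_measurable borel" for k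
        by (rule borel_measurable_simple_function[OF cF])
      fix \<sigma> :: real assume "\<sigma> \<in> {0..1}"
      have "(\<lambda>k. ?c (F k \<sigma>)) \<longlonglongrightarrow> ?c (g \<sigma>)"
        using B F(2)[of \<sigma>] by (intro isCont_tendsto_compose[of _ ?c] continuous_at_closest_point) auto
      then show "(\<lambda>k. ?c (F k \<sigma>)) \<longlonglongrightarrow> g \<sigma>"
        using g(2)[OF \<open>\<sigma> \<in> {0..1}\<close>] by (simp add: closest_point_self)
    qed (rule c)
    then show ?thesis
      using simple[OF cF c] by (intro LIMSEQ_le_const2) (auto simp: mult.commute)
  qed
  have "integral_dot f (\<lambda>\<sigma>. (-1) *\<^sub>R g \<sigma>) = -1 * integral_dot f g"
    by (rule integral_dot_linear(2)[OF g g])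
  moreover have "integral_dot f (\<lambda>\<sigma>. (-1) *\<^sub>R g \<sigma>) \<le> norm f * B"
    using g by (intro upper) auto
  ultimately show ?thesis using upper[OF g] by simp
qed

section \<open>Riesz representation and the norming property\<close>

lemma apply_bb_sum: "apply_bb (\<Sum>i\<in>J. F i) \<theta> = (\<Sum>i\<in>J. apply_bb (F i) \<theta>)"
  by (induction J rule: infinite_finite_induct) auto

text \<open>
  The variable of the measure is $\sigma\in[0,1]$, that of the bounded Borel function is
  $\theta=-\sigma$.
\<close>
definition bb_of :: "(real \<Rightarrow> 'a) \<Rightarrow> ('a :: euclidean_space) bounded_borel"
  where "bb_of g = Abs_bb (\<lambda>\<theta>. if \<theta> \<in> {-1..0} then g (- \<theta>) else 0)"

lemma apply_bb_of:
  assumes "g \<in> borel_measurable borel" "bounded (g ` {0..1})"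
  shows "apply_bb (bb_of g) \<theta> = (if \<theta> \<in> {-1..0} then g (- \<theta>) else 0)"
proof -
  have "apply_bb (bb_of g) = (\<lambda>\<theta>. if \<theta> \<in> {-1..0} then g (- \<theta>) else 0)"
    unfolding bb_of_def
  proof (rule Abs_bb_inverse, intro CollectI conjI)
    show "(\<lambda>\<theta>. if \<theta> \<in> {-1..0} then g (- \<theta>) else 0) \<in> borel_measurable borel"
      using assms(1) by measurable
    show "bounded ((\<lambda>\<theta>. if \<theta> \<in> {-1..0} then g (- \<theta>) else 0) ` {-1..0})"
      using assms(2) by (rule bounded_subset) auto
  qed auto
  then show ?thesis by simp
qed

lemma norm_bb_of_le:
  assumes "g \<in> borel_measurable borel" "\<And>\<sigma>. \<sigma> \<in> {0..1} \<Longrightarrow> norm (g \<sigma>) \<le> B"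
  shows "norm (bb_of g) \<le> B"
proof (rule norm_bb_least)
  have "bounded (g ` {0..1})" using assms(2) by (auto intro!: boundedI[of _ B])
  then show "norm (apply_bb (bb_of g) \<theta>) \<le> B" if "\<theta> \<in> {-1..0}" for \<theta>
    using assms that by (simp add: apply_bb_of)
qed

lemma bb_of_apply_bb: "bb_of (\<lambda>\<sigma>. apply_bb \<phi> (- \<sigma>)) = \<phi>"
proof (rule bb_eqI)
  have m: "(\<lambda>\<sigma>. apply_bb \<phi> (- \<sigma>)) \<in> borel_measurable borel" by measurable
  have "bounded ((\<lambda>\<sigma>. apply_bb \<phi> (- \<sigma>)) ` {0..1})"
    by (auto intro!: boundedI[of _ "norm \<phi>"] norm_bb_upper)
  then show "apply_bb (bb_of (\<lambda>\<sigma>. apply_bb \<phi> (- \<sigma>))) \<theta> = apply_bb \<phi> \<theta>" if "\<theta> \<in> {-1..0}" for \<theta>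
    using that by (simp add: apply_bb_of[OF m])
qed

lemma nbv_pairing_bb_of:
  fixes g :: "real \<Rightarrow> real ^ 'n"
  assumes "g \<in> borel_measurable borel" "bounded (g ` {0..1})"
  shows "nbv_pairing f (bb_of g) = integral_dot f g"
  unfolding nbv_pairing_def by (rule integral_dot_cong) (simp add: apply_bb_of[OF assms])

lemma nbv_pairing_linear:
  fixes \<phi> \<psi> :: "(real ^ 'n) bounded_borel"
  shows
  "nbv_pairing f (\<phi> + \<psi>) = nbv_pairing f \<phi> + nbv_pairing f \<psi>"
  "nbv_pairing f (c *\<^sub>R \<phi>) = c * nbv_pairing f \<phi>"
  "nbv_pairing (e + f) \<phi> = nbv_pairing e \<phi> + nbv_pairing f \<phi>"
  "nbv_pairing (c *\<^sub>R f) \<phi> = c * nbv_pairing f \<phi>"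
proof -
  have m: "(\<lambda>\<sigma>. apply_bb \<phi> (- \<sigma>)) \<in> borel_measurable borel" for \<phi> :: "(real ^ 'n) bounded_borel"
    by measurable
  show "nbv_pairing f (\<phi> + \<psi>) = nbv_pairing f \<phi> + nbv_pairing f \<psi>"
    "nbv_pairing f (c *\<^sub>R \<phi>) = c * nbv_pairing f \<phi>"
    unfolding nbv_pairing_def
    using integral_dot_linear(1)[OF m[of \<phi>] norm_bb_upper m[of \<psi>] norm_bb_upper]
      integral_dot_linear(2)[OF m[of \<phi>] norm_bb_upper m[of \<phi>] norm_bb_upper]
    by simp_all
  show "nbv_pairing (e + f) \<phi> = nbv_pairing e \<phi> + nbv_pairing f \<phi>"
    "nbv_pairing (c *\<^sub>R f) \<phi> = c * nbv_pairing f \<phi>"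
    unfolding nbv_pairing_def using integral_dot_integrator_linear[OF m[of \<phi>] norm_bb_upper] by auto
qed

lemma nbv_pairing_bound: "\<bar>nbv_pairing f \<phi>\<bar> \<le> norm f * norm \<phi>"
  unfolding nbv_pairing_def by (rule integral_dot_bound) (simp_all add: norm_bb_upper)

text \<open>
  Continuity under bounded pointwise convergence of sequences singles out, among all bounded
  functionals, those that are given by measures.
\<close>
definition sigma_continuous :: "(('a :: euclidean_space) bounded_borel \<Rightarrow> real) \<Rightarrow> bool"
  where "sigma_continuous l \<longleftrightarrow>
    (\<forall>\<phi> \<psi> B. (\<forall>k::nat. norm (\<phi> k) \<le> B) \<longrightarrow> (\<forall>\<theta>. (\<lambda>k. apply_bb (\<phi> k) \<theta>) \<longlonglongrightarrow> apply_bb \<psi> \<theta>) \<longrightarrow>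
      (\<lambda>k. l (\<phi> k)) \<longlonglongrightarrow> l \<psi>)"

lemma sigma_continuousI:
  assumes "\<And>(\<phi> :: nat \<Rightarrow> _) \<psi> B. (\<And>k. norm (\<phi> k) \<le> B) \<Longrightarrow>
    (\<And>\<theta>. (\<lambda>k. apply_bb (\<phi> k) \<theta>) \<longlonglongrightarrow> apply_bb \<psi> \<theta>) \<Longrightarrow> (\<lambda>k. l (\<phi> k)) \<longlonglongrightarrow> l \<psi>"
  shows "sigma_continuous l"
  unfolding sigma_continuous_def using assms by blast

lemma sigma_continuousD:
  assumes "sigma_continuous l" "\<And>k::nat. norm (\<phi> k) \<le> B"
    "\<And>\<theta>. (\<lambda>k. apply_bb (\<phi> k) \<theta>) \<longlonglongrightarrow> apply_bb \<psi> \<theta>"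
  shows "(\<lambda>k. l (\<phi> k)) \<longlonglongrightarrow> l \<psi>"
  using assms unfolding sigma_continuous_def by blast

lemma sigma_continuous_nbv_pairing: "sigma_continuous (nbv_pairing f)"
  unfolding nbv_pairing_def
  by (rule sigma_continuousI, rule integral_dot_lim) (auto intro: order_trans[OF norm_bb_upper])

text \<open>
  The set whose measure is the value at \<open>t\<close> of a normalized function; only its part in $[0,1]$
  matters. At \<open>t = 0\<close> it is empty and does not consist of the point 0, so that the increment
  from 0 to a positive \<open>t\<close> includes the atom at 0.
\<close>
definition initial_segment :: "real \<Rightarrow> real set"
  where "initial_segment t = (if t \<in> {0<..1} then {..t} else {})"

lemma initial_segment_mono: "s \<le> t \<Longrightarrow> t \<le> 1 \<Longrightarrow> initial_segment s \<subseteq> initial_segment t"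
  by (auto simp: initial_segment_def)

lemma initial_segment_borel [measurable]: "initial_segment t \<in> sets borel"
  by (simp add: initial_segment_def)

definition segment_bb :: "real \<Rightarrow> 'a \<Rightarrow> ('a :: euclidean_space) bounded_borel"
  where "segment_bb t u = bb_of (\<lambda>\<sigma>. indicator (initial_segment t) \<sigma> *\<^sub>R u)"

lemma apply_segment_bb:
  "apply_bb (segment_bb t u) \<theta> = (if \<theta> \<in> {-1..0} then indicator (initial_segment t) (- \<theta>) *\<^sub>R u else 0)"
  unfolding segment_bb_def
  by (rule apply_bb_of) (auto simp: indicator_def intro!: boundedI[of _ "norm u"])

text \<open>
  The pairing determines the values of \<open>f\<close>, and hence \<open>f\<close>.
\<close>
lemma nbv_pairing_segment:
  fixes u :: "real ^ 'n"
  assumes "t \<in> {0..1}"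
  shows "nbv_pairing f (segment_bb t u) = apply_nbv f t \<bullet> u"
proof (cases "t = 0")
  case True
  then have "segment_bb t u = 0"
    by (intro bb_eqI) (simp add: apply_segment_bb initial_segment_def)
  then show ?thesis
    using nbv_pairing_linear(2)[of f 0 0] True by simp
next
  case False
  then have t: "t \<in> {0<..1}" using assms by auto
  have "nbv_pairing f (segment_bb t u) = integral_dot f (\<lambda>\<sigma>. indicator {..t} \<sigma> *\<^sub>R u)"
    unfolding segment_bb_def initial_segment_def using t
    by (subst nbv_pairing_bb_of) (auto simp: indicator_def intro!: boundedI[of _ "norm u"])
  also have "\<dots> = stieltjes_integral (\<lambda>t. apply_nbv f t \<bullet> u) (indicator {..t})"
    by (intro integral_dot_const_direction bounded_borel_on_unit_indicator) simp
  also have "\<dots> = apply_nbv f t \<bullet> u"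
    by (rule stieltjes_indicator[OF representable_nbv_inner t])
  finally show ?thesis .
qed

lemma nbv_pairing_inject:
  assumes "\<And>\<phi>. nbv_pairing e \<phi> = nbv_pairing f \<phi>"
  shows "e = f"
proof (rule nbv_eqI)
  fix t :: real assume "t \<in> {0..1}"
  then have "apply_nbv e t \<bullet> u = apply_nbv f t \<bullet> u" for u
    using assms by (metis nbv_pairing_segment)
  then show "apply_nbv e t = apply_nbv f t" using vector_eq_rdot by blast
qed

lemma inner_sgn: "x \<bullet> sgn x = norm (x :: 'a :: real_inner)"
  by (cases "x = 0") (simp_all add: sgn_div_norm power2_norm_eq_inner[symmetric] power2_eq_square)

text \<open>
  The sum of the norms of the increments of \<open>f\<close> over a partition is the value of \<open>l\<close> at a step function
  that is equal, on each interval of the partition, to the unit vector in the direction of the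
  increment, and so has norm at most 1.
\<close>
lemma segment_variation_le:
  assumes l: "linear l" and bd: "\<And>\<phi>. \<bar>l \<phi>\<bar> \<le> K * norm \<phi>" and K: "0 \<le> K"
    and f: "\<And>t u. t \<in> {0..1} \<Longrightarrow> l (segment_bb t u) = f t \<bullet> u"
    and s: "s \<in> variation_sums f 0 1"
  shows "s \<le> K"
proof -
  interpret linear l by fact
  obtain k p where s: "s = (\<Sum>i<k. norm (f (p (Suc i)) - f (p i)))"
    and p: "mono_on {..k} p" "p ` {..k} \<subseteq> {0..1}"
    using s unfolding variation_sums_def by blast
  have p01: "p i \<in> {0..1}" if "i \<le> k" for i using p(2) that by auto
  define u where "u i = sgn (f (p (Suc i)) - f (p i))" for i
  define \<Phi> where "\<Phi> = (\<Sum>i<k. segment_bb (p (Suc i)) (u i) - segment_bb (p i) (u i))"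
  have "s = (\<Sum>i<k. (f (p (Suc i)) - f (p i)) \<bullet> u i)"
    unfolding s u_def inner_sgn ..
  also have "\<dots> = l \<Phi>"
    unfolding \<Phi>_def sum diff inner_diff_left using p01 by (intro sum.cong arg_cong2[of _ _ _ _ "(-)"] f[symmetric]) auto
  also have "\<dots> \<le> K * norm \<Phi>"
    using bd[of \<Phi>] by simp
  also have "K * norm \<Phi> \<le> K * 1"
  proof (rule mult_left_mono[OF _ K])
    show "norm \<Phi> \<le> 1"
  proof (rule norm_bb_least)
    fix \<theta> :: real assume \<theta>: "\<theta> \<in> {-1..0}"
    let ?I = "\<lambda>i. indicat_real (initial_segment (p i)) (- \<theta>)"
    (* The segments increase, so the coefficients are nonnegative and telescope. *)
    have "apply_bb \<Phi> \<theta> = (\<Sum>i<k. (?I (Suc i) - ?I i) *\<^sub>R u i)"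
      using \<theta> by (simp add: \<Phi>_def apply_bb_sum apply_segment_bb scaleR_diff_left)
    also have "norm \<dots> \<le> (\<Sum>i<k. ?I (Suc i) - ?I i)"
    proof (rule sum_norm_le)
      fix i assume "i \<in> {..<k}"
      then have "initial_segment (p i) \<subseteq> initial_segment (p (Suc i))"
        using p01[of "Suc i"] by (intro initial_segment_mono mono_onD[OF p(1)]) auto
      then have "?I i \<le> ?I (Suc i)" by (auto simp: indicator_def)
      then show "norm ((?I (Suc i) - ?I i) *\<^sub>R u i) \<le> ?I (Suc i) - ?I i"
        by (simp add: u_def norm_sgn)
    qed
    also have "\<dots> = ?I k - ?I 0"
      by (rule sum_lessThan_telescope)
    also have "\<dots> \<le> 1" by (simp add: indicator_def)
    finally show "norm (apply_bb \<Phi> \<theta>) \<le> 1" .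
  qed
  qed
  finally show "s \<le> K" by simp
qed

text \<open>
  The functions \<open>D i\<close> are the coordinates of \<open>l\<close> as signed measures, and \<open>f\<close> is the vector of their
  distribution functions. Right-continuity of \<open>f\<close> is the convergence of the indicators of
  $[0,s]$ to that of $[0,t]$ as \<open>s\<close> decreases to \<open>t\<close>.
\<close>
lemma Riesz_representation:
  fixes l :: "(real ^ 'n) bounded_borel \<Rightarrow> real"
  assumes l: "linear l" and bd: "\<And>\<phi>. \<bar>l \<phi>\<bar> \<le> K * norm \<phi>" and K: "0 \<le> K"
    and cont: "sigma_continuous l"
  obtains e where "norm e \<le> K" "\<And>\<phi>. nbv_pairing e \<phi> = l \<phi>"
proof -
  interpret linear l by fact
  define D where "D i g = l (bb_of (\<lambda>\<sigma>. g \<sigma> *\<^sub>R axis i 1))" for i and g :: "real \<Rightarrow> real"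
  have vec: "(\<lambda>\<sigma>. g \<sigma> *\<^sub>R v) \<in> borel_measurable borel" "bounded ((\<lambda>\<sigma>. g \<sigma> *\<^sub>R v) ` {0..1})"
    if g: "bounded_borel_on_unit g" for g and v :: "real ^ 'n"
  proof -
    show "(\<lambda>\<sigma>. g \<sigma> *\<^sub>R v) \<in> borel_measurable borel"
      using bounded_borel_on_unit_measurable[OF g] by measurable
    obtain B where "0 \<le> B" "\<And>\<sigma>. \<sigma> \<in> {0..1} \<Longrightarrow> \<bar>g \<sigma>\<bar> \<le> B" using bounded_borel_on_unitE[OF g] by metis
    then show "bounded ((\<lambda>\<sigma>. g \<sigma> *\<^sub>R v) ` {0..1})"
      by (intro boundedI[of _ "B * norm v"]) (auto intro!: mult_right_mono)
  qed
  have ap: "apply_bb (bb_of (\<lambda>\<sigma>. g \<sigma> *\<^sub>R v)) \<theta> = (if \<theta> \<in> {-1..0} then g (- \<theta>) *\<^sub>R v else 0)"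
    if g: "bounded_borel_on_unit g" for g \<theta> and v :: "real ^ 'n"
    by (rule apply_bb_of[OF vec[OF g]])
  have D: "sigma_functional (D i)" for i
  proof (rule sigma_functionalI)
    fix g h assume gh: "bounded_borel_on_unit g" "bounded_borel_on_unit h"
    show "D i g = D i h" if "\<And>\<sigma>. \<sigma> \<in> {0..1} \<Longrightarrow> g \<sigma> = h \<sigma>"
      unfolding D_def by (intro arg_cong[of _ _ l] bb_eqI) (simp add: ap gh that)
    have "bb_of (\<lambda>\<sigma>. (g \<sigma> + h \<sigma>) *\<^sub>R axis i 1) =
        bb_of (\<lambda>\<sigma>. g \<sigma> *\<^sub>R axis i (1::real)) + bb_of (\<lambda>\<sigma>. h \<sigma> *\<^sub>R axis i 1)"
      using ap[OF bounded_borel_on_unit_add[OF gh], of "axis i 1"]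
      by (intro bb_eqI) (simp add: ap gh scaleR_add_left)
    then show "D i (\<lambda>\<sigma>. g \<sigma> + h \<sigma>) = D i g + D i h"
      by (simp add: D_def add)
    show "D i (\<lambda>\<sigma>. c * g \<sigma>) = c * D i g" for c
    proof -
      have "bb_of (\<lambda>\<sigma>. (c * g \<sigma>) *\<^sub>R axis i 1) = c *\<^sub>R bb_of (\<lambda>\<sigma>. g \<sigma> *\<^sub>R axis i (1::real))"
        using ap[OF bounded_borel_on_unit_cmult[OF gh(1)], of c "axis i 1"]
        by (intro bb_eqI) (simp add: ap gh)
      then show ?thesis by (simp add: D_def scale)
    qed
  next
    fix g :: "nat \<Rightarrow> real \<Rightarrow> real" and h B
    assume g: "\<And>k. g k \<in> borel_measurable borel" "\<And>k \<sigma>. \<sigma> \<in> {0..1} \<Longrightarrow> \<bar>g k \<sigma>\<bar> \<le> B"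
      and h: "h \<in> borel_measurable borel" "\<And>\<sigma>. \<sigma> \<in> {0..1} \<Longrightarrow> (\<lambda>k. g k \<sigma>) \<longlonglongrightarrow> h \<sigma>"
    have hB: "\<bar>h \<sigma>\<bar> \<le> B" if "\<sigma> \<in> {0..1}" for \<sigma>
      using tendsto_upperbound[OF tendsto_rabs[OF h(2)[OF that]], of B] g(2)[OF that] by simp
    have bdd: "bounded_borel_on_unit (g k)" "bounded_borel_on_unit h" for k
      using g h(1) hB by (blast intro: bounded_borel_on_unitI)+
    show "(\<lambda>k. D i (g k)) \<longlonglongrightarrow> D i h"
      unfolding D_def
    proof (rule sigma_continuousD[OF cont, of _ B])
      show "norm (bb_of (\<lambda>\<sigma>. g k \<sigma> *\<^sub>R axis i (1::real))) \<le> B" for k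
        using vec(1)[OF bdd(1)] g(2) by (intro norm_bb_of_le) auto
      show "(\<lambda>k. apply_bb (bb_of (\<lambda>\<sigma>. g k \<sigma> *\<^sub>R axis i (1::real))) \<theta>) \<longlonglongrightarrow>
          apply_bb (bb_of (\<lambda>\<sigma>. h \<sigma> *\<^sub>R axis i 1)) \<theta>" for \<theta>
        unfolding ap[OF bdd(1)] ap[OF bdd(2)]
        using h(2)[of "- \<theta>"] by (auto intro!: tendsto_intros)
    qed
  qed
  have l_D: "l (bb_of g) = (\<Sum>i\<in>UNIV. D i (\<lambda>\<sigma>. g \<sigma> $ i))"
    if g: "g \<in> borel_measurable borel" "\<And>\<sigma>. \<sigma> \<in> {0..1} \<Longrightarrow> norm (g \<sigma>) \<le> B" for g B
  proof -
    have bdd: "bounded (g ` {0..1})" using g(2) by (auto intro!: boundedI[of _ B])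
    have comp: "bounded_borel_on_unit (\<lambda>\<sigma>. g \<sigma> $ i)" for i
      by (rule bounded_borel_on_unit_vec_nth[OF g])
    have "bb_of g = (\<Sum>i\<in>UNIV. bb_of (\<lambda>\<sigma>. g \<sigma> $ i *\<^sub>R axis i 1))"
    proof (rule bb_eqI)
      fix \<theta> :: real assume \<theta>: "\<theta> \<in> {-1..0}"
      have "g (- \<theta>) = (\<Sum>i\<in>UNIV. g (- \<theta>) $ i *\<^sub>R axis i 1)"
        using basis_expansion[of "g (- \<theta>)"] by (simp add: scalar_mult_eq_scaleR)
      then show "apply_bb (bb_of g) \<theta> = apply_bb (\<Sum>i\<in>UNIV. bb_of (\<lambda>\<sigma>. g \<sigma> $ i *\<^sub>R axis i 1)) \<theta>"
        using \<theta> unfolding apply_bb_sum apply_bb_of[OF g(1) bdd] ap[OF comp]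
        by simp
    qed
    then show ?thesis by (simp add: sum D_def)
  qed
  define f where "f t = (\<chi> i. D i (indicator (initial_segment t)))" for t
  have f_seg: "l (segment_bb t u) = f t \<bullet> u" for t u
  proof -
    have "l (segment_bb t u) = (\<Sum>i\<in>UNIV. D i (\<lambda>\<sigma>. (indicator (initial_segment t) \<sigma> *\<^sub>R u) $ i))"
      unfolding segment_bb_def by (rule l_D[of _ "norm u"]) (auto simp: indicator_def)
    also have "\<dots> = (\<Sum>i\<in>UNIV. u $ i * D i (indicator (initial_segment t)))"
      by (intro sum.cong refl)
         (simp add: mult.commute[of "indicator _ _"] sigma_functionalD(3)[OF D] bounded_borel_on_unit_indicator)
    finally show ?thesis by (simp add: f_def inner_vec_def mult.commute)
  qed
  have D0: "D i (\<lambda>_. 0) = 0" for i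
    using sigma_functionalD(3)[OF D, of "\<lambda>_. 0" i 0] by (simp add: bounded_borel_on_unitI[of _ 0])
  have f0: "f t = 0" if "t \<notin> {0<..1}" for t
  proof -
    have "indicat_real {} = (\<lambda>_ :: real. 0)" by auto
    then have "D i (indicator {}) = 0" for i using D0 by metis
    then show ?thesis using that by (auto simp: f_def initial_segment_def vec_eq_iff)
  qed
  have var: "s \<le> K" if "s \<in> variation_sums f 0 1" for s
    by (rule segment_variation_le[OF l bd K f_seg that])
  have cont_f: "continuous (at_right t) f" if t: "t \<in> {0<..<1}" for t
    unfolding continuous_within
  proof (rule tendsto_at_right_sequentially)
    show "t < 1" using t by simp
    fix S assume S: "\<And>n. t < S n" "\<And>n. S n < 1" "S \<longlonglongrightarrow> t"
    have "(\<lambda>n. D i (indicator (initial_segment (S n)))) \<longlonglongrightarrow> D i (indicator (initial_segment t))" for i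
    proof (rule sigma_functionalD(4)[OF D, of _ 1])
      fix \<sigma> :: real
      have "\<forall>\<^sub>F n in sequentially. (S n \<ge> \<sigma>) = (t \<ge> \<sigma>)"
      proof (cases "\<sigma> \<le> t")
        case True
        then show ?thesis using S(1) by (auto intro!: always_eventually dest: order_trans[OF _ less_imp_le])
      next
        case False
        then show ?thesis using order_tendstoD(2)[OF S(3), of \<sigma>] by (auto elim!: eventually_mono)
      qed
      then show "(\<lambda>n. indicat_real (initial_segment (S n)) \<sigma>) \<longlonglongrightarrow> indicator (initial_segment t) \<sigma>"
      proof (intro tendsto_eventually, eventually_elim)
        case (elim n)
        have "S n \<in> {0<..1}" "t \<in> {0<..1}" using t S(1,2)[of n] by auto
        then show ?case using elim by (simp add: initial_segment_def indicator_def)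
      qed
    qed (auto simp: indicator_def)
    then show "(\<lambda>n. f (S n)) \<longlonglongrightarrow> f t"
      unfolding f_def by (intro vec_tendstoI) simp
  qed
  define e where "e = Abs_nbv f"
  have e: "apply_nbv e = f"
    unfolding e_def
    using f0 cont_f by (intro Abs_nbv_inverse) (auto intro!: bounded_variation_onI[OF var])
  show thesis
  proof (rule that)
    show "norm e \<le> K" unfolding norm_nbv_def e using var by (intro total_variation_least) auto
    fix \<phi> :: "(real ^ 'n) bounded_borel"
    let ?g = "\<lambda>\<sigma>. apply_bb \<phi> (- \<sigma>)"
    have g: "?g \<in> borel_measurable borel" by measurable
    have "stieltjes_integral (\<lambda>t. f t $ i) (\<lambda>\<sigma>. ?g \<sigma> $ i) = D i (\<lambda>\<sigma>. ?g \<sigma> $ i)" for i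
    proof (rule sigma_functional_eqI[OF _ D])
      have rep: "representable (\<lambda>t. f t $ i)" using representable_nbv_component[of e i] by (simp add: e)
      show "sigma_functional (stieltjes_integral (\<lambda>t. f t $ i))"
        by (rule sigma_functional_stieltjes[OF rep])
      show "bounded_borel_on_unit (\<lambda>\<sigma>. ?g \<sigma> $ i)"
        by (rule bounded_borel_on_unit_vec_nth[OF g norm_bb_upper])
      show "stieltjes_integral (\<lambda>t. f t $ i) (indicator {..t}) = D i (indicator {..t})" if "t \<in> {0<..1}" for t
        unfolding stieltjes_indicator[OF rep that] using that by (simp add: f_def initial_segment_def)
    qed
    then have "nbv_pairing e \<phi> = (\<Sum>i\<in>UNIV. D i (\<lambda>\<sigma>. ?g \<sigma> $ i))"
      by (simp add: nbv_pairing_def integral_dot_def e)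
    also have "\<dots> = l (bb_of ?g)"
      by (rule l_D[symmetric, OF g norm_bb_upper])
    finally show "nbv_pairing e \<phi> = l \<phi>" by (simp add: bb_of_apply_bb)
  qed
qed

text \<open>
  Both supremum formulas need a near-optimal partner. For the norm of \<open>\<phi>\<close> it is the element
  that represents evaluation at \<open>\<theta>\<close> in the direction of \<open>\<phi>(\<theta>)\<close>. For the norm of \<open>f\<close> none has to be
  exhibited: the functional given by \<open>f\<close> is bounded by the supremum, so its representing
  element, which is \<open>f\<close> by injectivity, has at most that norm.
\<close>
lemma norming_dual_pair_nbv_pairing:
  "norming_dual_pair (nbv_pairing :: (real ^ 'n) nbv \<Rightarrow> (real ^ 'n) bounded_borel \<Rightarrow> real)"
  (is "norming_dual_pair ?p")
  unfolding norming_dual_pair_def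
proof (intro conjI allI)
  show "linear (?p f)" for f by (rule linearI) (simp_all add: nbv_pairing_linear)
  then have lin: "linear (?p f)" for f .
  show "linear (\<lambda>f. ?p f \<phi>)" for \<phi> by (rule linearI) (simp_all add: nbv_pairing_linear)
  show "\<exists>M\<ge>1. \<forall>f \<phi>. \<bar>?p f \<phi>\<bar> \<le> M * norm f * norm \<phi>"
    by (intro exI[of _ 1]) (simp add: nbv_pairing_bound)
  have le1: "\<bar>?p f \<phi>\<bar> \<le> norm \<phi>" if "norm f \<le> 1" for f \<phi>
    using nbv_pairing_bound[of f \<phi>] mult_right_mono[OF that norm_ge_zero[of \<phi>]] by simp
  have le2: "\<bar>?p f \<phi>\<bar> \<le> norm f" if "norm \<phi> \<le> 1" for f \<phi>
    using nbv_pairing_bound[of f \<phi>] mult_left_mono[OF that norm_ge_zero[of f]] by simp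
  show "norm \<phi> = (SUP f\<in>{f. norm f \<le> 1}. \<bar>?p f \<phi>\<bar>)" (is "_ = ?S") for \<phi>
  proof (rule antisym)
    show "norm \<phi> \<le> ?S"
    proof (rule norm_bb_least)
      fix \<theta> :: real
      let ?l = "\<lambda>\<psi>. apply_bb \<psi> \<theta> \<bullet> sgn (apply_bb \<phi> \<theta>)"
      have l: "linear ?l" by (rule linearI) (simp_all add: inner_add_left)
      have bd: "\<bar>?l \<psi>\<bar> \<le> 1 * norm \<psi>" for \<psi>
        using Cauchy_Schwarz_ineq2[of "apply_bb \<psi> \<theta>" "sgn (apply_bb \<phi> \<theta>)"] norm_bb_upper[of \<psi> \<theta>]
        by (auto simp: norm_sgn split: if_splits)
      have "sigma_continuous ?l"
        by (rule sigma_continuousI) (intro tendsto_intros)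
      then obtain e where e: "norm e \<le> 1" "\<And>\<psi>. ?p e \<psi> = ?l \<psi>"
        using Riesz_representation[OF l bd zero_le_one] by metis
      have "norm (apply_bb \<phi> \<theta>) = \<bar>?p e \<phi>\<bar>"
        by (simp add: e inner_sgn)
      also have "\<dots> \<le> ?S"
      proof (rule cSUP_upper)
        show "bdd_above ((\<lambda>f. \<bar>?p f \<phi>\<bar>) ` {f. norm f \<le> 1})"
          by (rule bdd_aboveI2[of _ _ "norm \<phi>"]) (simp add: le1)
      qed (simp add: e(1))
      finally show "norm (apply_bb \<phi> \<theta>) \<le> ?S" .
    qed
    show "?S \<le> norm \<phi>" by (rule cSUP_least) (auto simp: le1 intro: exI[of _ 0])
  qed
  show "norm f = (SUP \<phi>\<in>{\<phi>. norm \<phi> \<le> 1}. \<bar>?p f \<phi>\<bar>)" (is "_ = ?S") for f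
  proof (rule antisym)
    have "bdd_above ((\<lambda>\<phi>. \<bar>?p f \<phi>\<bar>) ` {\<phi>. norm \<phi> \<le> 1})"
      by (rule bdd_aboveI2[of _ _ "norm f"]) (simp add: le2)
    then have up: "\<bar>?p f \<phi>\<bar> \<le> ?S" if "norm \<phi> \<le> 1" for \<phi>
      using that by (intro cSUP_upper) simp_all
    have "\<bar>?p f \<phi>\<bar> \<le> ?S * norm \<phi>" for \<phi>
    proof (cases "\<phi> = 0")
      case True
      then show ?thesis using nbv_pairing_bound[of f \<phi>] by simp
    next
      case False
      then have "\<bar>?p f (sgn \<phi>)\<bar> \<le> ?S" by (intro up) (simp add: norm_sgn)
      then show ?thesis
        using False by (simp add: sgn_div_norm nbv_pairing_linear abs_mult divide_simps mult.commute)
    qed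
    moreover have "0 \<le> ?S" using up[of 0] by simp
    ultimately obtain e where "norm e \<le> ?S" "\<And>\<phi>. ?p e \<phi> = ?p f \<phi>"
      using Riesz_representation[OF lin, of f ?S] sigma_continuous_nbv_pairing by metis
    then show "norm f \<le> ?S" using nbv_pairing_inject by blast
    show "?S \<le> norm f" by (rule cSUP_least) (auto simp: le2 intro: exI[of _ 0])
  qed
qed

section \<open>The Volterra operator of the delay equation\<close>

lemma borel_measurable_vec_lambda:
  fixes f :: "'n::finite \<Rightarrow> 'a \<Rightarrow> real"
  assumes "\<And>i. f i \<in> borel_measurable M"
  shows "(\<lambda>x. (\<chi> i. f i x) :: real ^ 'n) \<in> borel_measurable M"
  unfolding borel_measurable_euclidean_space[of "\<lambda>x. (\<chi> i. f i x) :: real ^ 'n"]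
  using assms by (auto simp: Basis_vec_def inner_axis)

lemma integral_mat_cong:
  assumes "\<And>\<sigma>. \<sigma> \<in> {0..1} \<Longrightarrow> g \<sigma> = h \<sigma>"
  shows "integral_mat \<zeta> g = integral_mat \<zeta> h"
proof -
  have "stieltjes_integral f (\<lambda>\<sigma>. g \<sigma> $ j) = stieltjes_integral f (\<lambda>\<sigma>. h \<sigma> $ j)" for f j
    using assms by (intro stieltjes_cong) simp
  then show ?thesis unfolding integral_mat_def by simp
qed

lemma integral_mat_linear:
  fixes g h :: "real \<Rightarrow> real ^ 'n"
  assumes g: "g \<in> borel_measurable borel" "\<And>\<sigma>. \<sigma> \<in> {0..1} \<Longrightarrow> norm (g \<sigma>) \<le> B"
    and h: "h \<in> borel_measurable borel" "\<And>\<sigma>. \<sigma> \<in> {0..1} \<Longrightarrow> norm (h \<sigma>) \<le> B'"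
  shows "integral_mat \<zeta> (\<lambda>\<sigma>. g \<sigma> + h \<sigma>) = integral_mat \<zeta> g + integral_mat \<zeta> h"
    "integral_mat \<zeta> (\<lambda>\<sigma>. c *\<^sub>R g \<sigma>) = c *\<^sub>R integral_mat \<zeta> g"
  using bounded_borel_on_unit_vec_nth[OF g] bounded_borel_on_unit_vec_nth[OF h]
  by (simp_all add: vec_eq_iff integral_mat_def stieltjes_add[OF representable_nbv_entry]
      stieltjes_cmult[OF representable_nbv_entry] sum.distrib sum_distrib_left)

lemma ex_integral_mat_bound:
  fixes \<zeta> :: "(real ^ 'n ^ 'n) nbv"
  shows "\<exists>C>0. \<forall>g B. g \<in> borel_measurable borel \<longrightarrow> (\<forall>\<sigma>\<in>{0..1}. norm (g \<sigma>) \<le> B) \<longrightarrow>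
    norm (integral_mat \<zeta> g) \<le> C * B"
proof -
  have "\<exists>C\<ge>0. \<forall>g B. g \<in> borel_measurable borel \<longrightarrow> (\<forall>\<sigma>\<in>{0..1}. \<bar>g \<sigma>\<bar> \<le> B) \<longrightarrow>
      \<bar>stieltjes_integral (\<lambda>\<sigma>. apply_nbv \<zeta> \<sigma> $ i $ j) g\<bar> \<le> C * B" for i j
    by (rule stieltjes_bound[OF representable_nbv_entry[of \<zeta> i j]]) blast
  then obtain C where C: "\<And>i j. 0 \<le> C i j"
    "\<And>i j g B. g \<in> borel_measurable borel \<Longrightarrow> (\<forall>\<sigma>\<in>{0..1}. \<bar>g \<sigma>\<bar> \<le> B) \<Longrightarrow>
      \<bar>stieltjes_integral (\<lambda>\<sigma>. apply_nbv \<zeta> \<sigma> $ i $ j) g\<bar> \<le> C i j * B"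
    by metis
  let ?C = "(\<Sum>i\<in>UNIV. \<Sum>j\<in>UNIV. C i j) + 1"
  have "norm (integral_mat \<zeta> g) \<le> ?C * B"
    if g: "g \<in> borel_measurable borel" "\<And>\<sigma>. \<sigma> \<in> {0..1} \<Longrightarrow> norm (g \<sigma>) \<le> B" for g B
  proof -
    have B: "0 \<le> B" using order_trans[OF norm_ge_zero g(2)[of 0]] by simp
    have "norm (integral_mat \<zeta> g) \<le> (\<Sum>i\<in>UNIV. \<bar>integral_mat \<zeta> g $ i\<bar>)"
      by (rule norm_le_l1_cart)
    also have "\<dots> \<le> (\<Sum>i\<in>UNIV. \<Sum>j\<in>UNIV. C i j * B)"
    proof (rule sum_mono)
      fix i
      have "\<bar>integral_mat \<zeta> g $ i\<bar> \<le>
          (\<Sum>j\<in>UNIV. \<bar>stieltjes_integral (\<lambda>\<sigma>. apply_nbv \<zeta> \<sigma> $ i $ j) (\<lambda>\<sigma>. g \<sigma> $ j)\<bar>)"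
        by (simp add: integral_mat_def sum_abs)
      also have "\<dots> \<le> (\<Sum>j\<in>UNIV. C i j * B)"
        by (intro sum_mono C(2) borel_measurable_vec_nth g(1) ballI order_trans[OF component_le_norm_cart g(2)])
      finally show "\<bar>integral_mat \<zeta> g $ i\<bar> \<le> (\<Sum>j\<in>UNIV. C i j * B)" .
    qed
    also have "\<dots> \<le> ?C * B" using B by (simp add: sum_distrib_right distrib_right)
    finally show ?thesis .
  qed
  moreover have "?C > 0" using C(1) by (simp add: add_nonneg_pos sum_nonneg)
  ultimately show ?thesis by blast
qed

text \<open>
  A constant \<open>C\<close> as in the preceding lemma, fixed once and for all because the growth rate of the
  solutions depends on it. It is positive, so that exponentials with that rate increase.
\<close>
definition delay_bound :: "(real ^ 'n ^ 'n) nbv \<Rightarrow> real"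
  where "delay_bound \<zeta> = (SOME C. 0 < C \<and> (\<forall>g B. g \<in> borel_measurable borel \<longrightarrow>
    (\<forall>\<sigma>\<in>{0..1}. norm (g \<sigma>) \<le> B) \<longrightarrow> norm (integral_mat \<zeta> g) \<le> C * B))"

lemma delay_bound_pos: "0 < delay_bound \<zeta>"
  and integral_mat_bound: "g \<in> borel_measurable borel \<Longrightarrow> (\<And>\<sigma>. \<sigma> \<in> {0..1} \<Longrightarrow> norm (g \<sigma>) \<le> B) \<Longrightarrow>
    norm (integral_mat \<zeta> g) \<le> delay_bound \<zeta> * B"
  using someI_ex[OF ex_integral_mat_bound[of \<zeta>]] unfolding delay_bound_def[symmetric] by blast+

text \<open>
  With the rate \<open>2 C\<close> the integral of \<open>C exp (2 C s)\<close> up to \<open>t\<close> is at most half of \<open>exp (2 C t)\<close>,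
  which is the contraction factor of the Volterra operator.
\<close>
definition growth_rate :: "(real ^ 'n ^ 'n) nbv \<Rightarrow> real"
  where "growth_rate \<zeta> = 2 * delay_bound \<zeta>"

lemma growth_rate_pos: "0 < growth_rate \<zeta>"
  by (simp add: growth_rate_def delay_bound_pos)

text \<open>
  The functions on which the Volterra operator acts. They vanish to the left of $-1$ in order
  to admit a majorant \<open>K exp (\<omega> s)\<close> on each half-line that is bounded above; such a majorant tends to 0
  at minus infinity.
\<close>
definition tame :: "(real \<Rightarrow> real ^ 'n) \<Rightarrow> bool"
  where "tame w \<longleftrightarrow> w \<in> borel_measurable borel \<and> (\<forall>t < -1. w t = 0) \<and> (\<forall>T. bounded (w ` {..T}))"

lemma tame_measurable [measurable_dest]: "tame w \<Longrightarrow> w \<in> borel_measurable borel"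
  by (simp add: tame_def)

lemma tame_growth:
  assumes "tame w" "0 \<le> \<omega>"
  obtains K where "0 \<le> K" "\<And>s. s \<le> T \<Longrightarrow> norm (w s) \<le> K * exp (\<omega> * s)"
proof -
  obtain B where B: "0 < B" "\<And>s. s \<le> T \<Longrightarrow> norm (w s) \<le> B"
    using assms(1) unfolding tame_def bounded_pos by (metis atMost_iff imageI)
  show thesis
  proof (rule that[of "B * exp \<omega>"])
    show "0 \<le> B * exp \<omega>" using B by simp
    fix s assume s: "s \<le> T"
    show "norm (w s) \<le> B * exp \<omega> * exp (\<omega> * s)"
    proof (cases "s < -1")
      case True
      then show ?thesis using assms(1) B(1) by (simp add: tame_def)
    next
      case False
      then have "0 \<le> \<omega> * (1 + s)" using assms(2) by simp
      (* The factor exp \<omega> compensates for the decay of exp (\<omega> s) down to s = -1. *)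
      then have "1 \<le> exp \<omega> * exp (\<omega> * s)" by (simp add: exp_add[symmetric] algebra_simps)
      then have "B * 1 \<le> B * (exp \<omega> * exp (\<omega> * s))" using B(1) by (intro mult_left_mono) auto
      then show ?thesis using B(2)[OF s] by (simp add: mult.assoc)
    qed
  qed
qed

lemma tameI:
  assumes "w \<in> borel_measurable borel" "\<And>t. t < -1 \<Longrightarrow> w t = 0"
    and "\<And>T. \<exists>K\<ge>0. \<forall>s\<le>T. norm (w s) \<le> K * exp (\<omega> * s)" and "0 \<le> \<omega>"
  shows "tame w"
  unfolding tame_def
proof (intro conjI allI impI assms)
  fix T
  obtain K where K: "0 \<le> K" "\<And>s. s \<le> T \<Longrightarrow> norm (w s) \<le> K * exp (\<omega> * s)"
    using assms(3)[of T] by blast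
  have "norm (w s) \<le> K * exp (\<omega> * T)" if "s \<le> T" for s
  proof -
    have "K * exp (\<omega> * s) \<le> K * exp (\<omega> * T)"
      using that assms(4) K(1) by (intro mult_left_mono) (auto intro: mult_left_mono)
    then show ?thesis using K(2)[OF that] by simp
  qed
  then show "bounded (w ` {..T})" by (auto intro!: boundedI)
qed

lemma tame_add: "tame v \<Longrightarrow> tame w \<Longrightarrow> tame (\<lambda>t. v t + w t)"
  unfolding tame_def by (auto intro: bounded_plus_comp)

lemma tame_scaleR: "tame w \<Longrightarrow> tame (\<lambda>t. c *\<^sub>R w t)"
  unfolding tame_def by (auto intro: bounded_scaleR_comp)

definition delay_term :: "(real ^ 'n ^ 'n) nbv \<Rightarrow> (real \<Rightarrow> real ^ 'n) \<Rightarrow> real \<Rightarrow> real ^ 'n"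
  where "delay_term \<zeta> w s = integral_mat \<zeta> (\<lambda>\<sigma>. w (s - \<sigma>))"

lemma tame_shift:
  assumes w: "tame w"
  obtains B where "\<And>s. s \<le> T \<Longrightarrow> norm (w s) \<le> B" "\<And>s \<sigma>. s \<le> T \<Longrightarrow> \<sigma> \<in> {0..1} \<Longrightarrow> norm (w (s - \<sigma>)) \<le> B"
proof -
  obtain B where B: "\<And>s. s \<le> T \<Longrightarrow> norm (w s) \<le> B"
    using w unfolding tame_def bounded_iff by (metis atMost_iff imageI)
  then show thesis by (rule that) (use B in auto)
qed

lemma shift_measurable: "tame w \<Longrightarrow> (\<lambda>\<sigma>. w (s - \<sigma>)) \<in> borel_measurable borel"
  by (rule measurable_compose[OF _ tame_measurable]) measurable

lemma delay_term_measurable: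
  assumes w: "tame w"
  shows "delay_term \<zeta> w \<in> borel_measurable borel"
proof -
  have "(\<lambda>s. stieltjes_integral (\<lambda>\<sigma>. apply_nbv \<zeta> \<sigma> $ i $ j) (\<lambda>\<sigma>. w (s - \<sigma>) $ j)) \<in> borel_measurable borel" for i j
  proof (rule stieltjes_measurable[OF representable_nbv_entry])
    have "(\<lambda>p. w (fst p - snd p)) \<in> borel_measurable (borel \<Otimes>\<^sub>M borel)"
      using tame_measurable[OF w] by measurable
    from borel_measurable_vec_nth[OF this, of j]
    show "(\<lambda>(s, \<sigma>). w (s - \<sigma>) $ j) \<in> borel_measurable (borel \<Otimes>\<^sub>M borel)"
      by (simp add: case_prod_beta')
    fix s
    obtain B where "\<And>s' \<sigma>. s' \<le> s \<Longrightarrow> \<sigma> \<in> {0..1} \<Longrightarrow> norm (w (s' - \<sigma>)) \<le> B"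
      using tame_shift[OF w] by metis
    then show "bounded ((\<lambda>\<sigma>. w (s - \<sigma>) $ j) ` {0..1})"
      by (auto intro!: boundedI[of _ B] order_trans[OF component_le_norm_cart])
  qed
  then have "(\<lambda>s. \<chi> i. \<Sum>j\<in>UNIV. stieltjes_integral (\<lambda>\<sigma>. apply_nbv \<zeta> \<sigma> $ i $ j) (\<lambda>\<sigma>. w (s - \<sigma>) $ j))
      \<in> borel_measurable borel"
    by (intro borel_measurable_vec_lambda borel_measurable_sum)
  then show ?thesis unfolding delay_term_def integral_mat_def .
qed

lemma delay_term_linear:
  assumes "tame v" "tame w"
  shows "delay_term \<zeta> (\<lambda>t. v t + w t) s = delay_term \<zeta> v s + delay_term \<zeta> w s"
    "delay_term \<zeta> (\<lambda>t. c *\<^sub>R w t) s = c *\<^sub>R delay_term \<zeta> w s"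
proof -
  obtain A B where "\<And>s' \<sigma>. s' \<le> s \<Longrightarrow> \<sigma> \<in> {0..1} \<Longrightarrow> norm (v (s' - \<sigma>)) \<le> A"
      "\<And>s' \<sigma>. s' \<le> s \<Longrightarrow> \<sigma> \<in> {0..1} \<Longrightarrow> norm (w (s' - \<sigma>)) \<le> B"
    using tame_shift[OF assms(1), of s] tame_shift[OF assms(2), of s] by metis
  then have A: "\<And>\<sigma>. \<sigma> \<in> {0..1} \<Longrightarrow> norm (v (s - \<sigma>)) \<le> A" and B: "\<And>\<sigma>. \<sigma> \<in> {0..1} \<Longrightarrow> norm (w (s - \<sigma>)) \<le> B"
    by blast+
  show "delay_term \<zeta> (\<lambda>t. v t + w t) s = delay_term \<zeta> v s + delay_term \<zeta> w s"
    "delay_term \<zeta> (\<lambda>t. c *\<^sub>R w t) s = c *\<^sub>R delay_term \<zeta> w s"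
    unfolding delay_term_def
    by (rule integral_mat_linear(1)[OF shift_measurable[OF assms(1)] A shift_measurable[OF assms(2)] B]
        integral_mat_linear(2)[OF shift_measurable[OF assms(2)] B shift_measurable[OF assms(2)] B]; assumption)+
qed

lemma delay_term_bound:
  assumes "tame w" "\<And>\<sigma>. \<sigma> \<in> {0..1} \<Longrightarrow> norm (w (s - \<sigma>)) \<le> B"
  shows "norm (delay_term \<zeta> w s) \<le> delay_bound \<zeta> * B"
  unfolding delay_term_def by (rule integral_mat_bound[OF shift_measurable[OF assms(1)] assms(2)])

text \<open>
  Only values on the past of \<open>t\<close> enter, so convergence and a bound up to \<open>t\<close> are enough.
\<close>
lemma delay_term_lim:
  assumes w: "\<And>k::nat. tame (w k)" "tame w'" and le: "\<And>k s. s \<le> t \<Longrightarrow> norm (w k s) \<le> B"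
    and lim: "\<And>s. s \<le> t \<Longrightarrow> (\<lambda>k. w k s) \<longlonglongrightarrow> w' s"
  shows "(\<lambda>k. delay_term \<zeta> (w k) t) \<longlonglongrightarrow> delay_term \<zeta> w' t"
  unfolding delay_term_def integral_mat_def
  by (intro vec_tendstoI, simp only: vec_lambda_beta, intro tendsto_sum stieltjes_lim[where B = B] representable_nbv_entry
      borel_measurable_vec_nth shift_measurable w tendsto_vec_nth lim order_trans[OF component_le_norm_cart] le) auto

definition volterra :: "(real ^ 'n ^ 'n) nbv \<Rightarrow> (real \<Rightarrow> real ^ 'n) \<Rightarrow> real \<Rightarrow> real ^ 'n"
  where "volterra \<zeta> w t = (LBINT s:{0..t}. delay_term \<zeta> w s)"

lemma delay_term_set_integrable:
  assumes w: "tame w"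
  shows "set_integrable lborel {0..t} (delay_term \<zeta> w)"
proof -
  obtain B where B: "\<And>s \<sigma>. s \<le> t \<Longrightarrow> \<sigma> \<in> {0..1} \<Longrightarrow> norm (w (s - \<sigma>)) \<le> B"
    using tame_shift[OF w, of t] by metis
  have bd: "norm (delay_term \<zeta> w s) \<le> delay_bound \<zeta> * B" if "s \<le> t" for s
    using that by (intro delay_term_bound[OF w] B)
  show ?thesis
    unfolding set_integrable_def
    using delay_term_measurable[OF w]
    by (intro integrableI_bounded_set_indicator[where B = "delay_bound \<zeta> * B"])
       (auto intro!: AE_I2 bd simp: emeasure_lborel_Icc_eq)
qed

lemma volterra_linear:
  assumes "tame v" "tame w"
  shows "volterra \<zeta> (\<lambda>t. v t + w t) t = volterra \<zeta> v t + volterra \<zeta> w t"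
    "volterra \<zeta> (\<lambda>t. c *\<^sub>R w t) t = c *\<^sub>R volterra \<zeta> w t"
proof -
  have "delay_term \<zeta> (\<lambda>t. v t + w t) = (\<lambda>s. delay_term \<zeta> v s + delay_term \<zeta> w s)"
    "delay_term \<zeta> (\<lambda>t. c *\<^sub>R w t) = (\<lambda>s. c *\<^sub>R delay_term \<zeta> w s)"
    using delay_term_linear[OF assms] by auto
  then show "volterra \<zeta> (\<lambda>t. v t + w t) t = volterra \<zeta> v t + volterra \<zeta> w t"
    "volterra \<zeta> (\<lambda>t. c *\<^sub>R w t) t = c *\<^sub>R volterra \<zeta> w t"
    unfolding volterra_def
    using set_integral_add(2)[OF delay_term_set_integrable[OF assms(1)] delay_term_set_integrable[OF assms(2)]]
    by simp_all
qed

lemma volterra_nonpos: "t \<le> 0 \<Longrightarrow> volterra \<zeta> w t = 0"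
proof -
  assume "t \<le> 0"
  then have "AE s in lborel. s \<noteq> 0 \<longrightarrow> indicator {0..t} s *\<^sub>R delay_term \<zeta> w s = 0"
    by (intro AE_I2) (auto simp: indicator_def)
  then have "AE s in lborel. indicator {0..t} s *\<^sub>R delay_term \<zeta> w s = 0"
    by (rule AE_mp[OF AE_lborel_singleton[of 0]])
  then show ?thesis
    unfolding volterra_def set_lebesgue_integral_def by (intro integral_eq_zero_AE)
qed

text \<open>
  The Volterra operator halves the constant of an exponential majorant. The hypothesis is local in
  time, which uniqueness needs for solutions whose growth is not known in advance.
\<close>
lemma volterra_bound:
  assumes w: "tame w" and K: "0 \<le> K" "\<And>s. s \<le> T \<Longrightarrow> norm (w s) \<le> K * exp (growth_rate \<zeta> * s)"
    and t: "t \<le> T"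
  shows "norm (volterra \<zeta> w t) \<le> K / 2 * exp (growth_rate \<zeta> * t)"
proof (cases "t \<le> 0")
  case True
  then show ?thesis using K(1) by (simp add: volterra_nonpos)
next
  case False
  let ?\<omega> = "growth_rate \<zeta>" and ?C = "delay_bound \<zeta>"
  have \<omega>: "?\<omega> > 0" by (rule growth_rate_pos)
  let ?k = "\<lambda>s. ?C * (K * exp (?\<omega> * s))"
  have bd: "norm (delay_term \<zeta> w s) \<le> ?k s" if "s \<le> t" for s
  proof (rule delay_term_bound[OF w])
    fix \<sigma> :: real assume \<sigma>: "\<sigma> \<in> {0..1}"
    have "norm (w (s - \<sigma>)) \<le> K * exp (?\<omega> * (s - \<sigma>))"
      using that t \<sigma> by (intro K(2)) auto
    also have "\<dots> \<le> K * exp (?\<omega> * s)"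
      using \<sigma> \<omega> K(1) by (intro mult_left_mono) auto
    finally show "norm (w (s - \<sigma>)) \<le> K * exp (?\<omega> * s)" .
  qed
  let ?F = "\<lambda>s. K / 2 * exp (?\<omega> * s)"
  have der: "(?F has_vector_derivative ?k s) (at s within {0..t})" for s
    by (auto intro!: derivative_eq_intros simp: has_real_derivative_iff_has_vector_derivative[symmetric] growth_rate_def)
  have cont: "continuous_on {0..t} ?k" by (intro continuous_intros)
  have int: "set_integrable lborel {0..t} ?k"
    unfolding set_integrable_def by (rule borel_integrable_compact) (use cont in auto)
  have "norm (volterra \<zeta> w t) \<le> (LBINT s:{0..t}. ?k s)"
    unfolding volterra_def set_lebesgue_integral_def
  proof (rule Bochner_Integration.integral_norm_bound_integral)
    show "integrable lborel (\<lambda>s. indicator {0..t} s *\<^sub>R delay_term \<zeta> w s)"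
      using delay_term_set_integrable[OF w] by (simp add: set_integrable_def)
    show "integrable lborel (\<lambda>s. indicator {0..t} s *\<^sub>R ?k s)"
      using int by (simp add: set_integrable_def)
  qed (use bd in \<open>auto simp: indicator_def\<close>)
  also have "\<dots> = ?F t - ?F 0"
    unfolding set_lebesgue_integral_def using False der cont
    by (intro integral_FTC_atLeastAtMost) auto
  also have "\<dots> \<le> ?F t" using K(1) by simp
  finally show ?thesis .
qed

lemma tame_volterra:
  assumes w: "tame w"
  shows "tame (volterra \<zeta> w)"
proof (rule tameI[where \<omega> = "growth_rate \<zeta>"])
  note [measurable] = delay_term_measurable[OF w]
  have "(\<lambda>t. \<integral>s. (if 0 \<le> s \<and> s \<le> t then delay_term \<zeta> w s else 0) \<partial>lborel) \<in> borel_measurable borel"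
    by measurable
  also have "(\<lambda>t. \<integral>s. (if 0 \<le> s \<and> s \<le> t then delay_term \<zeta> w s else 0) \<partial>lborel) = volterra \<zeta> w"
    unfolding volterra_def set_lebesgue_integral_def
    by (intro ext Bochner_Integration.integral_cong) (auto simp: indicator_def)
  finally show "volterra \<zeta> w \<in> borel_measurable borel" .
  show "volterra \<zeta> w t = 0" if "t < -1" for t using that by (simp add: volterra_nonpos)
  show "0 \<le> growth_rate \<zeta>" using growth_rate_pos[of \<zeta>] by simp
  fix T
  obtain K where K: "0 \<le> K" "\<And>s. s \<le> T \<Longrightarrow> norm (w s) \<le> K * exp (growth_rate \<zeta> * s)"
    using tame_growth[OF w less_imp_le[OF growth_rate_pos]] by metis
  show "\<exists>K\<ge>0. \<forall>s\<le>T. norm (volterra \<zeta> w s) \<le> K * exp (growth_rate \<zeta> * s)"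
    using volterra_bound[OF w K] K(1) by (intro exI[of _ "K / 2"]) auto
qed

lemma volterra_lim:
  assumes w: "\<And>k::nat. tame (w k)" "tame w'" and le: "\<And>k s. s \<le> t \<Longrightarrow> norm (w k s) \<le> B"
    and lim: "\<And>s. s \<le> t \<Longrightarrow> (\<lambda>k. w k s) \<longlonglongrightarrow> w' s"
  shows "(\<lambda>k. volterra \<zeta> (w k) t) \<longlonglongrightarrow> volterra \<zeta> w' t"
  unfolding volterra_def set_lebesgue_integral_def
proof (rule integral_dominated_convergence)
  show "integrable lborel (\<lambda>s. indicat_real {0..t} s * (delay_bound \<zeta> * B))"
    by (intro integrable_mult_left) (simp add: emeasure_lborel_Icc_eq)
  show "(\<lambda>s. indicator {0..t} s *\<^sub>R delay_term \<zeta> w' s) \<in> borel_measurable lborel"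
    "(\<lambda>s. indicator {0..t} s *\<^sub>R delay_term \<zeta> (w k) s) \<in> borel_measurable lborel" for k
    using delay_term_measurable[OF w(1)] delay_term_measurable[OF w(2)] by measurable
  show "AE s in lborel. (\<lambda>k. indicator {0..t} s *\<^sub>R delay_term \<zeta> (w k) s) \<longlonglongrightarrow> indicator {0..t} s *\<^sub>R delay_term \<zeta> w' s"
  proof (rule AE_I2)
    fix s
    show "(\<lambda>k. indicator {0..t} s *\<^sub>R delay_term \<zeta> (w k) s) \<longlonglongrightarrow> indicator {0..t} s *\<^sub>R delay_term \<zeta> w' s"
    proof (cases "s \<in> {0..t}")
      case True
      then have "(\<lambda>k. delay_term \<zeta> (w k) s) \<longlonglongrightarrow> delay_term \<zeta> w' s"
        by (intro delay_term_lim[OF w, where B = B] le lim) auto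
      then show ?thesis by (intro tendsto_intros)
    qed auto
  qed
  show "AE s in lborel. norm (indicator {0..t} s *\<^sub>R delay_term \<zeta> (w k) s) \<le> indicat_real {0..t} s * (delay_bound \<zeta> * B)" for k
    by (rule AE_I2) (auto simp: indicator_def intro!: delay_term_bound w le)
qed

section \<open>Existence, uniqueness and continuous dependence of solutions\<close>

text \<open>
  The inhomogeneity of the integral equation on the whole line: the initial function, continued
  by its value at 0.
\<close>
definition initial_ext :: "(real ^ 'n) bounded_borel \<Rightarrow> real \<Rightarrow> real ^ 'n"
  where "initial_ext \<phi> t = apply_bb \<phi> (min t 0)"

lemma initial_ext_linear:
  "initial_ext (\<phi> + \<psi>) t = initial_ext \<phi> t + initial_ext \<psi> t"
  "initial_ext (c *\<^sub>R \<phi>) t = c *\<^sub>R initial_ext \<phi> t"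
  by (simp_all add: initial_ext_def)

text \<open>
  The factor in front of the norm accounts for \<open>exp (\<omega> t)\<close> being as small as \<open>exp (- \<omega>)\<close> on $[-1,0]$.
\<close>
definition growth_const :: "(real ^ 'n ^ 'n) nbv \<Rightarrow> (real ^ 'n) bounded_borel \<Rightarrow> real"
  where "growth_const \<zeta> \<phi> = exp (growth_rate \<zeta>) * norm \<phi>"

lemma growth_const_nonneg: "0 \<le> growth_const \<zeta> \<phi>"
  by (simp add: growth_const_def)

lemma initial_ext_bound: "norm (initial_ext \<phi> t) \<le> growth_const \<zeta> \<phi> * exp (growth_rate \<zeta> * t)"
proof (cases "t < -1")
  case True
  then show ?thesis by (simp add: initial_ext_def apply_bb_outside growth_const_nonneg)
next
  case False
  have "norm (initial_ext \<phi> t) \<le> norm \<phi> * 1"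
    by (simp add: initial_ext_def norm_bb_upper)
  also have "\<dots> \<le> norm \<phi> * exp (growth_rate \<zeta> * (1 + t))"
    using False growth_rate_pos[of \<zeta>] by (intro mult_left_mono) auto
  also have "\<dots> = growth_const \<zeta> \<phi> * exp (growth_rate \<zeta> * t)"
    by (simp add: growth_const_def distrib_left exp_add)
  finally show ?thesis .
qed

lemma tame_initial_ext: "tame (initial_ext \<phi>)"
  unfolding tame_def
proof (intro conjI allI impI)
  show "initial_ext \<phi> \<in> borel_measurable borel"
    unfolding initial_ext_def by measurable
  show "initial_ext \<phi> t = 0" if "t < -1" for t
    using that by (simp add: initial_ext_def apply_bb_outside)
  show "bounded (initial_ext \<phi> ` {..T})" for T
    by (intro boundedI[of _ "norm \<phi>"]) (auto simp: initial_ext_def norm_bb_upper)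
qed

primrec picard :: "(real ^ 'n ^ 'n) nbv \<Rightarrow> (real ^ 'n) bounded_borel \<Rightarrow> nat \<Rightarrow> real \<Rightarrow> real ^ 'n" where
  "picard \<zeta> \<phi> 0 = initial_ext \<phi>"
| "picard \<zeta> \<phi> (Suc k) = volterra \<zeta> (picard \<zeta> \<phi> k)"

lemma tame_picard: "tame (picard \<zeta> \<phi> k)"
  by (induction k) (simp_all add: tame_initial_ext tame_volterra)

lemma picard_linear:
  "picard \<zeta> (\<phi> + \<psi>) k t = picard \<zeta> \<phi> k t + picard \<zeta> \<psi> k t"
  "picard \<zeta> (c *\<^sub>R \<phi>) k t = c *\<^sub>R picard \<zeta> \<phi> k t"
proof -
  have "picard \<zeta> (\<phi> + \<psi>) k = (\<lambda>t. picard \<zeta> \<phi> k t + picard \<zeta> \<psi> k t)"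
  proof (induction k)
    case (Suc k)
    show ?case by (simp add: Suc fun_eq_iff volterra_linear(1)[OF tame_picard tame_picard])
  qed (simp add: fun_eq_iff initial_ext_linear)
  then show "picard \<zeta> (\<phi> + \<psi>) k t = picard \<zeta> \<phi> k t + picard \<zeta> \<psi> k t" by simp
  have "picard \<zeta> (c *\<^sub>R \<phi>) k = (\<lambda>t. c *\<^sub>R picard \<zeta> \<phi> k t)"
  proof (induction k)
    case (Suc k)
    show ?case by (simp add: Suc fun_eq_iff volterra_linear(2)[OF tame_picard tame_picard])
  qed (simp add: fun_eq_iff initial_ext_linear)
  then show "picard \<zeta> (c *\<^sub>R \<phi>) k t = c *\<^sub>R picard \<zeta> \<phi> k t" by simp
qed

lemma picard_bound: "norm (picard \<zeta> \<phi> k t) \<le> growth_const \<zeta> \<phi> * (1 / 2) ^ k * exp (growth_rate \<zeta> * t)"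
proof (induction k arbitrary: t)
  case 0
  then show ?case by (simp add: initial_ext_bound)
next
  case (Suc k)
  have "norm (volterra \<zeta> (picard \<zeta> \<phi> k) t) \<le> (growth_const \<zeta> \<phi> * (1 / 2) ^ k) / 2 * exp (growth_rate \<zeta> * t)"
    using Suc by (intro volterra_bound[OF tame_picard, of _ t]) (auto simp: growth_const_nonneg)
  then show ?case by simp
qed

definition picard_sum :: "(real ^ 'n ^ 'n) nbv \<Rightarrow> (real ^ 'n) bounded_borel \<Rightarrow> real \<Rightarrow> real ^ 'n"
  where "picard_sum \<zeta> \<phi> t = (\<Sum>k. picard \<zeta> \<phi> k t)"

lemma picard_majorant_sums:
  "(\<lambda>k. growth_const \<zeta> \<phi> * (1 / 2) ^ k * exp (growth_rate \<zeta> * t)) sums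
    (2 * growth_const \<zeta> \<phi> * exp (growth_rate \<zeta> * t))"
  using sums_mult2[OF sums_mult[OF geometric_sums[of "1 / 2 :: real"]], of "growth_const \<zeta> \<phi>" "exp (growth_rate \<zeta> * t)"]
  by (simp add: mult.commute)

lemma summable_norm_picard: "summable (\<lambda>k. norm (picard \<zeta> \<phi> k t))"
  by (rule summable_comparison_test'[OF sums_summable[OF picard_majorant_sums[of \<zeta> \<phi> t]]])
     (simp add: picard_bound)

lemma summable_picard: "summable (\<lambda>k. picard \<zeta> \<phi> k t)"
  by (rule summable_norm_cancel[OF summable_norm_picard])

lemma picard_partial_sum_bound:
  "norm (\<Sum>k<N. picard \<zeta> \<phi> k t) \<le> 2 * growth_const \<zeta> \<phi> * exp (growth_rate \<zeta> * t)"
proof -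
  have "norm (\<Sum>k<N. picard \<zeta> \<phi> k t) \<le> (\<Sum>k<N. growth_const \<zeta> \<phi> * (1 / 2) ^ k * exp (growth_rate \<zeta> * t))"
    by (rule sum_norm_le) (rule picard_bound)
  also have "\<dots> \<le> (\<Sum>k. growth_const \<zeta> \<phi> * (1 / 2) ^ k * exp (growth_rate \<zeta> * t))"
    by (rule sum_le_suminf[OF sums_summable[OF picard_majorant_sums]]) (auto simp: growth_const_nonneg)
  finally show ?thesis by (simp only: sums_unique[OF picard_majorant_sums, symmetric])
qed

lemma picard_sum_lim: "(\<lambda>N. \<Sum>k<N. picard \<zeta> \<phi> k t) \<longlonglongrightarrow> picard_sum \<zeta> \<phi> t"
  unfolding picard_sum_def by (rule summable_LIMSEQ[OF summable_picard])

lemma picard_sum_bound: "norm (picard_sum \<zeta> \<phi> t) \<le> 2 * growth_const \<zeta> \<phi> * exp (growth_rate \<zeta> * t)"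
  by (rule LIMSEQ_le_const2[OF tendsto_norm[OF picard_sum_lim]]) (auto intro: picard_partial_sum_bound)

lemma tame_picard_sum: "tame (picard_sum \<zeta> \<phi>)"
proof (rule tameI[where \<omega> = "growth_rate \<zeta>"])
  show "picard_sum \<zeta> \<phi> \<in> borel_measurable borel"
    unfolding picard_sum_def using tame_measurable[OF tame_picard] by measurable
  show "picard_sum \<zeta> \<phi> t = 0" if "t < -1" for t
  proof -
    have "picard \<zeta> \<phi> k t = 0" for k
      using that tame_picard[of \<zeta> \<phi> k] by (simp add: tame_def)
    then show ?thesis by (simp add: picard_sum_def)
  qed
  show "\<exists>K\<ge>0. \<forall>s\<le>T. norm (picard_sum \<zeta> \<phi> s) \<le> K * exp (growth_rate \<zeta> * s)" for T
    using picard_sum_bound growth_const_nonneg[of \<zeta> \<phi>]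
    by (intro exI[of _ "2 * growth_const \<zeta> \<phi>"]) auto
  show "0 \<le> growth_rate \<zeta>" using growth_rate_pos[of \<zeta>] by simp
qed

text \<open>
  The partial sums are the Picard iterates, \<open>X (N + 1) = initial_ext \<phi> + volterra \<zeta> (X N)\<close>, and the
  Volterra operator commutes with their limit by dominated convergence.
\<close>
lemma picard_sum_solves: "picard_sum \<zeta> \<phi> t = initial_ext \<phi> t + volterra \<zeta> (picard_sum \<zeta> \<phi>) t"
proof -
  let ?X = "\<lambda>N t. \<Sum>k<N. picard \<zeta> \<phi> k t"
  have zero: "volterra \<zeta> (\<lambda>_. 0) t = 0" for t
    using volterra_linear(2)[OF tame_initial_ext[of \<phi>] tame_initial_ext[of \<phi>], where c = 0 and \<zeta> = \<zeta> and t = t] by simp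
  have tameX: "tame (?X N)" for N
  proof (induction N)
    case 0
    then show ?case by (simp add: tame_def image_constant_conv)
  qed (simp add: tame_add tame_picard)
  have step: "?X (Suc N) t = initial_ext \<phi> t + volterra \<zeta> (?X N) t" for N
  proof (induction N)
    case 0
    then show ?case by (simp add: zero)
  next
    case (Suc N)
    have "?X (Suc (Suc N)) t = ?X (Suc N) t + volterra \<zeta> (picard \<zeta> \<phi> N) t" by simp
    also have "\<dots> = initial_ext \<phi> t + (volterra \<zeta> (?X N) t + volterra \<zeta> (picard \<zeta> \<phi> N) t)"
      using Suc by simp
    also have "volterra \<zeta> (?X N) t + volterra \<zeta> (picard \<zeta> \<phi> N) t = volterra \<zeta> (?X (Suc N)) t"
      by (simp add: volterra_linear(1)[OF tameX tame_picard])
    finally show ?case .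
  qed
  have "(\<lambda>N. volterra \<zeta> (?X N) t) \<longlonglongrightarrow> volterra \<zeta> (picard_sum \<zeta> \<phi>) t"
  proof (rule volterra_lim[OF tameX tame_picard_sum])
    fix N s assume "s \<le> t"
    then have "2 * growth_const \<zeta> \<phi> * exp (growth_rate \<zeta> * s) \<le> 2 * growth_const \<zeta> \<phi> * exp (growth_rate \<zeta> * t)"
      using growth_rate_pos[of \<zeta>] growth_const_nonneg[of \<zeta> \<phi>] by (intro mult_left_mono) auto
    then show "norm (?X N s) \<le> 2 * growth_const \<zeta> \<phi> * exp (growth_rate \<zeta> * t)"
      using picard_partial_sum_bound order_trans by blast
  qed (rule picard_sum_lim)
  then have "(\<lambda>N. ?X (Suc N) t) \<longlonglongrightarrow> initial_ext \<phi> t + volterra \<zeta> (picard_sum \<zeta> \<phi>) t"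
    unfolding step by (intro tendsto_intros)
  moreover have "(\<lambda>N. ?X (Suc N) t) \<longlonglongrightarrow> picard_sum \<zeta> \<phi> t"
    by (rule LIMSEQ_Suc[OF picard_sum_lim])
  ultimately show ?thesis by (rule LIMSEQ_unique[symmetric])
qed

text \<open>
  On each half-line a fixed point has an exponential majorant, and applying the operator repeatedly
  halves it any number of times.
\<close>
lemma volterra_fixed_point_eq_0:
  assumes d: "tame d" "\<And>t. d t = volterra \<zeta> d t"
  shows "d t = 0"
proof -
  obtain K where K: "0 \<le> K" "\<And>s. s \<le> t \<Longrightarrow> norm (d s) \<le> K * exp (growth_rate \<zeta> * s)"
    using tame_growth[OF d(1) less_imp_le[OF growth_rate_pos]] by metis
  have "norm (d s) \<le> K * (1 / 2) ^ k * exp (growth_rate \<zeta> * s)" if "s \<le> t" for s k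
    using that
  proof (induction k arbitrary: s)
    case 0
    then show ?case using K(2) by simp
  next
    case (Suc k)
    have "norm (volterra \<zeta> d s) \<le> (K * (1 / 2) ^ k) / 2 * exp (growth_rate \<zeta> * s)"
      using Suc K(1) by (intro volterra_bound[OF d(1), of _ t]) auto
    then show ?case using d(2)[of s] by simp
  qed
  then have le: "norm (d t) \<le> K * (1 / 2) ^ k * exp (growth_rate \<zeta> * t)" for k by simp
  have "(\<lambda>k. K * (1 / 2) ^ k * exp (growth_rate \<zeta> * t)) \<longlonglongrightarrow> K * 0 * exp (growth_rate \<zeta> * t)"
    by (intro tendsto_intros LIMSEQ_realpow_zero) auto
  then have "norm (d t) \<le> K * 0 * exp (growth_rate \<zeta> * t)"
    by (rule LIMSEQ_le_const) (use le in auto)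
  then show ?thesis by simp
qed

text \<open>
  Since the Volterra operator gives 0 at nonpositive times, initial condition and integral equation merge into one
  fixed point equation on the whole line.
\<close>
lemma is_rfde_solution_iff:
  assumes "\<And>t. t < -1 \<Longrightarrow> x t = 0"
  shows "is_rfde_solution \<zeta> \<phi> x \<longleftrightarrow> tame x \<and> (\<forall>t. x t = initial_ext \<phi> t + volterra \<zeta> x t)"
proof -
  have "(\<lambda>t. indicator {-1..} t *\<^sub>R x t) = x"
    using assms by (auto simp: indicator_def fun_eq_iff)
  then have m: "x \<in> borel_measurable (restrict_space borel {-1..}) \<longleftrightarrow> x \<in> borel_measurable borel"
    by (subst borel_measurable_restrict_space_iff) auto
  have "bounded (x ` {-1..T}) \<longleftrightarrow> bounded (x ` {..T})" for T
  proof
    assume "bounded (x ` {-1..T})"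
    then have "bounded (insert 0 (x ` {-1..T}))" by simp
    moreover have "x ` {..T} \<subseteq> insert 0 (x ` {-1..T})"
      using assms by (auto simp: image_iff) (metis atLeastAtMost_iff not_less)
    ultimately show "bounded (x ` {..T})" by (rule bounded_subset)
  qed (auto elim: bounded_subset)
  then have b: "(\<forall>T. bounded (x ` {-1..T})) \<longleftrightarrow> (\<forall>T. bounded (x ` {..T}))" by simp
  have e: "(\<forall>\<theta>\<in>{-1..0}. x \<theta> = apply_bb \<phi> \<theta>) \<and> (\<forall>t\<ge>0. x t = apply_bb \<phi> 0 + volterra \<zeta> x t) \<longleftrightarrow>
      (\<forall>t. x t = initial_ext \<phi> t + volterra \<zeta> x t)" (is "?A \<and> ?B \<longleftrightarrow> ?C")
  proof
    assume AB: "?A \<and> ?B"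
    show ?C
    proof
      fix t :: real
      consider "t < -1" | "t \<in> {-1..0}" | "0 \<le> t" by fastforce
      then show "x t = initial_ext \<phi> t + volterra \<zeta> x t"
        by cases (use AB assms[of t] in \<open>auto simp: initial_ext_def volterra_nonpos apply_bb_outside\<close>)
    qed
  next
    assume C: ?C
    show "?A \<and> ?B"
    proof (intro conjI ballI allI impI)
      show "x \<theta> = apply_bb \<phi> \<theta>" if "\<theta> \<in> {-1..0}" for \<theta>
        using C[rule_format, of \<theta>] that by (simp add: initial_ext_def volterra_nonpos)
      show "x t = apply_bb \<phi> 0 + volterra \<zeta> x t" if "0 \<le> t" for t
        using C[rule_format, of t] that by (simp add: initial_ext_def)
    qed
  qed
  show ?thesis
    using m b e assms
    unfolding is_rfde_solution_def tame_def volterra_def delay_term_def by blast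
qed

lemma rfde_solution_unique:
  assumes "tame x" "\<And>t. x t = initial_ext \<phi> t + volterra \<zeta> x t"
    and "tame y" "\<And>t. y t = initial_ext \<phi> t + volterra \<zeta> y t"
  shows "x = y"
proof
  fix t
  let ?d = "\<lambda>t. x t + (-1) *\<^sub>R y t"
  have "?d t = volterra \<zeta> ?d t" for t
  proof -
    have "volterra \<zeta> ?d t = volterra \<zeta> x t + (-1) *\<^sub>R volterra \<zeta> y t"
      by (simp only: volterra_linear(1)[OF assms(1) tame_scaleR[OF assms(3)]] volterra_linear(2)[OF assms(1,3)])
    then show ?thesis using assms(2)[of t] assms(4)[of t] by simp
  qed
  from volterra_fixed_point_eq_0[OF tame_add[OF assms(1) tame_scaleR[OF assms(3)]] this, of t]
  show "x t = y t" by simp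
qed

lemma rfde_solution_eq_picard_sum: "rfde_solution \<zeta> \<phi> = picard_sum \<zeta> \<phi>"
  unfolding rfde_solution_def
proof (rule the_equality)
  show "is_rfde_solution \<zeta> \<phi> (picard_sum \<zeta> \<phi>) \<and> (\<forall>t < -1. picard_sum \<zeta> \<phi> t = 0)"
    using tame_picard_sum[of \<zeta> \<phi>] picard_sum_solves[of \<zeta> \<phi>]
    by (subst is_rfde_solution_iff) (auto simp: tame_def)
  fix x assume "is_rfde_solution \<zeta> \<phi> x \<and> (\<forall>t < -1. x t = 0)"
  then have "tame x" "\<And>t. x t = initial_ext \<phi> t + volterra \<zeta> x t"
    using is_rfde_solution_iff[of x \<zeta> \<phi>] by blast+
  then show "x = picard_sum \<zeta> \<phi>"
    by (rule rfde_solution_unique[OF _ _ tame_picard_sum picard_sum_solves])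
qed

lemma tame_rfde_solution: "tame (rfde_solution \<zeta> \<phi>)"
  and rfde_solution_solves: "rfde_solution \<zeta> \<phi> t = initial_ext \<phi> t + volterra \<zeta> (rfde_solution \<zeta> \<phi>) t"
  and rfde_solution_bound: "norm (rfde_solution \<zeta> \<phi> t) \<le> 2 * growth_const \<zeta> \<phi> * exp (growth_rate \<zeta> * t)"
  unfolding rfde_solution_eq_picard_sum
  by (rule tame_picard_sum, rule picard_sum_solves, rule picard_sum_bound)

lemma rfde_solution_linear:
  "rfde_solution \<zeta> (\<phi> + \<psi>) t = rfde_solution \<zeta> \<phi> t + rfde_solution \<zeta> \<psi> t"
  "rfde_solution \<zeta> (c *\<^sub>R \<phi>) t = c *\<^sub>R rfde_solution \<zeta> \<phi> t"
  by (simp_all add: rfde_solution_eq_picard_sum picard_sum_def picard_linear suminf_add summable_picard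
      suminf_scaleR_right[symmetric])

text \<open>
  Continuity of each Picard term follows by induction from that of the Volterra operator; the
  majorant of the series is uniform along the sequence, so that the limit passes through the sum.
\<close>
lemma rfde_solution_lim:
  fixes \<phi> :: "nat \<Rightarrow> (real ^ 'n) bounded_borel"
  assumes B: "\<And>j. norm (\<phi> j) \<le> B" and lim: "\<And>\<theta>. (\<lambda>j. apply_bb (\<phi> j) \<theta>) \<longlonglongrightarrow> apply_bb \<psi> \<theta>"
  shows "(\<lambda>j. rfde_solution \<zeta> (\<phi> j) t) \<longlonglongrightarrow> rfde_solution \<zeta> \<psi> t"
proof -
  let ?K = "exp (growth_rate \<zeta>) * B"
  have K: "growth_const \<zeta> (\<phi> j) \<le> ?K" for j using B by (simp add: growth_const_def)
  have bd: "norm (picard \<zeta> (\<phi> j) k t) \<le> ?K * (1 / 2) ^ k * exp (growth_rate \<zeta> * t)" for j k t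
    using K by (intro order_trans[OF picard_bound] mult_right_mono) auto
  have K0: "0 \<le> ?K" using order_trans[OF growth_const_nonneg K] .
  have pic: "(\<lambda>j. picard \<zeta> (\<phi> j) k t) \<longlonglongrightarrow> picard \<zeta> \<psi> k t" for k t
  proof (induction k arbitrary: t)
    case 0
    then show ?case using lim by (simp add: initial_ext_def)
  next
    case (Suc k)
    have "(\<lambda>j. volterra \<zeta> (picard \<zeta> (\<phi> j) k) t) \<longlonglongrightarrow> volterra \<zeta> (picard \<zeta> \<psi> k) t"
    proof (rule volterra_lim[OF tame_picard tame_picard])
      fix j s assume "s \<le> t"
      then have "?K * (1 / 2) ^ k * exp (growth_rate \<zeta> * s) \<le> ?K * (1 / 2) ^ k * exp (growth_rate \<zeta> * t)"
        using growth_rate_pos[of \<zeta>] K0 by (intro mult_left_mono) auto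
      then show "norm (picard \<zeta> (\<phi> j) k s) \<le> ?K * (1 / 2) ^ k * exp (growth_rate \<zeta> * t)"
        using bd order_trans by blast
    qed (rule Suc)
    then show ?case by simp
  qed
  show ?thesis
  proof (rule vec_tendstoI)
    fix i
    (* Tannery's theorem applies in normed algebras, hence to each coordinate. *)
    have comp: "rfde_solution \<zeta> \<rho> t $ i = (\<Sum>k. picard \<zeta> \<rho> k t $ i)" for \<rho>
      unfolding rfde_solution_eq_picard_sum picard_sum_def
      by (rule bounded_linear.suminf[OF bounded_linear_vec_nth summable_picard])
    have "summable (\<lambda>k. ?K * (1 / 2) ^ k * exp (growth_rate \<zeta> * t))"
      by (intro summable_mult2 summable_mult summable_geometric) simp
    then have "(\<lambda>j. \<Sum>k. picard \<zeta> (\<phi> j) k t $ i) \<longlonglongrightarrow> (\<Sum>k. picard \<zeta> \<psi> k t $ i)"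
      by (intro conjunct2[OF conjunct2[OF tannerys_theorem[of _ _ sequentially]]] always_eventually)
         (auto intro!: tendsto_vec_nth pic order_trans[OF component_le_norm_cart bd])
    then show "(\<lambda>j. rfde_solution \<zeta> (\<phi> j) t $ i) \<longlonglongrightarrow> rfde_solution \<zeta> \<psi> t $ i"
      by (simp only: comp)
  qed
qed

lemma apply_rfde_semigroup:
  assumes "0 \<le> t"
  shows "apply_bb (rfde_semigroup \<zeta> t \<phi>) \<theta> = (if \<theta> \<in> {-1..0} then rfde_solution \<zeta> \<phi> (t + \<theta>) else 0)"
proof -
  have "apply_bb (rfde_semigroup \<zeta> t \<phi>) = (\<lambda>\<theta>. if \<theta> \<in> {-1..0} then rfde_solution \<zeta> \<phi> (t + \<theta>) else 0)"
    unfolding rfde_semigroup_def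
  proof (rule Abs_bb_inverse, intro CollectI conjI)
    show "(\<lambda>\<theta>. if \<theta> \<in> {-1..0} then rfde_solution \<zeta> \<phi> (t + \<theta>) else 0) \<in> borel_measurable borel"
      using tame_measurable[OF tame_rfde_solution[of \<zeta> \<phi>]] by measurable
    have "bounded (rfde_solution \<zeta> \<phi> ` {..t})"
      using tame_rfde_solution[of \<zeta> \<phi>] by (simp add: tame_def)
    then show "bounded ((\<lambda>\<theta>. if \<theta> \<in> {-1..0} then rfde_solution \<zeta> \<phi> (t + \<theta>) else 0) ` {-1..0})"
      by (rule bounded_subset) auto
  qed auto
  then show ?thesis by simp
qed

text \<open>
  The integral over $[0,t+s]$ splits at \<open>s\<close>, and translation turns its second part into
  the integral for the shifted function \<open>v\<close>. Agreement of \<open>v\<close> with the translate of \<open>w\<close> from $-1$ on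
  suffices because delays do not exceed 1.
\<close>
lemma volterra_shift:
  assumes w: "tame w" and v: "tame v" and s: "0 \<le> s" and t: "0 \<le> t"
    and eq: "\<And>r. -1 \<le> r \<Longrightarrow> v r = w (r + s)"
  shows "volterra \<zeta> w (t + s) = volterra \<zeta> w s + volterra \<zeta> v t"
proof -
  let ?f = "delay_term \<zeta> w"
  have "volterra \<zeta> w (t + s) = (LBINT r:{0..s} \<union> {s<..t + s}. ?f r)"
    unfolding volterra_def using s t by (intro arg_cong2[where f = "\<lambda>A g. set_lebesgue_integral lborel A g"]) auto
  also have "\<dots> = (LBINT r:{0..s}. ?f r) + (LBINT r:{s<..t + s}. ?f r)"
  proof (rule set_integral_Un)
    show "set_integrable lborel {0..s} ?f" by (rule delay_term_set_integrable[OF w])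
    show "set_integrable lborel {s<..t + s} ?f"
      using s by (intro set_integrable_subset[OF delay_term_set_integrable[OF w, where t = "t + s"]]) auto
  qed auto
  also have "(LBINT r:{s<..t + s}. ?f r) = (LBINT r:{0<..t}. delay_term \<zeta> v r)"
  proof -
    have "(LBINT r:{s<..t + s}. ?f r) = (\<integral>r. indicator {s<..t + s} (s + 1 * r) *\<^sub>R ?f (s + 1 * r) \<partial>lborel)"
      unfolding set_lebesgue_integral_def by (subst lborel_integral_real_affine[of 1 _ s]) auto
    also have "\<dots> = (LBINT r:{0<..t}. delay_term \<zeta> v r)"
      unfolding set_lebesgue_integral_def
    proof (rule Bochner_Integration.integral_cong[OF refl])
      fix r :: real
      have "delay_term \<zeta> v r = ?f (s + r)" if "0 < r"
        unfolding delay_term_def using that eq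
        by (intro integral_mat_cong) (simp add: algebra_simps)
      then show "indicator {s<..t + s} (s + 1 * r) *\<^sub>R ?f (s + 1 * r) = indicator {0<..t} r *\<^sub>R delay_term \<zeta> v r"
        by (auto simp: indicator_def)
    qed
    finally show ?thesis .
  qed
  also have "(LBINT r:{0<..t}. delay_term \<zeta> v r) = (LBINT r:{0..t}. delay_term \<zeta> v r)"
    unfolding set_lebesgue_integral_def
  proof (rule integral_cong_AE)
    show "AE r in lborel. indicator {0<..t} r *\<^sub>R delay_term \<zeta> v r = indicator {0..t} r *\<^sub>R delay_term \<zeta> v r"
      by (rule AE_mp[OF AE_lborel_singleton[of 0]]) (auto simp: indicator_def)
  qed (use delay_term_measurable[OF v] in measurable)
  finally show ?thesis by (simp add: volterra_def)
qed

text \<open>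
  The translate of a solution solves the equation whose initial function is the
  translated history. It is cut off to the left of $-1$, where solutions are 0 by convention.
\<close>
lemma rfde_solution_semigroup:
  assumes s: "0 \<le> s"
  shows "rfde_solution \<zeta> (rfde_semigroup \<zeta> s \<phi>) = (\<lambda>t. if t < -1 then 0 else rfde_solution \<zeta> \<phi> (t + s))"
    (is "_ = ?y")
proof (rule rfde_solution_unique[OF tame_rfde_solution rfde_solution_solves])
  let ?x = "rfde_solution \<zeta> \<phi>"
  show y: "tame ?y"
    unfolding tame_def
  proof (intro conjI allI impI)
    show "?y \<in> borel_measurable borel"
      using tame_measurable[OF tame_rfde_solution[of \<zeta> \<phi>]] by measurable
    have "bounded (insert 0 (?x ` {..T + s}))" for T
      using tame_rfde_solution[of \<zeta> \<phi>] by (simp add: tame_def)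
    then show "bounded (?y ` {..T})" for T
      by (rule bounded_subset) auto
  qed auto
  show "?y t = initial_ext (rfde_semigroup \<zeta> s \<phi>) t + volterra \<zeta> ?y t" for t
  proof (cases "0 \<le> t")
    case True
    have "?x (t + s) = apply_bb \<phi> 0 + volterra \<zeta> ?x (t + s)"
      using True s by (subst rfde_solution_solves) (simp add: initial_ext_def)
    also have "\<dots> = (apply_bb \<phi> 0 + volterra \<zeta> ?x s) + volterra \<zeta> ?y t"
      by (simp add: volterra_shift[OF tame_rfde_solution y s True])
    also have "apply_bb \<phi> 0 + volterra \<zeta> ?x s = ?x s"
      using s by (subst rfde_solution_solves[of \<zeta> \<phi> s]) (simp add: initial_ext_def)
    finally show ?thesis
      using True s by (simp add: initial_ext_def apply_rfde_semigroup)
  next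
    case False
    then show ?thesis
      using s by (simp add: initial_ext_def volterra_nonpos apply_rfde_semigroup add.commute)
  qed
qed

lemma rfde_semigroup_add:
  assumes "0 \<le> t" "0 \<le> s"
  shows "rfde_semigroup \<zeta> (t + s) \<phi> = rfde_semigroup \<zeta> t (rfde_semigroup \<zeta> s \<phi>)"
  by (rule bb_eqI) (use assms in \<open>simp add: apply_rfde_semigroup rfde_solution_semigroup algebra_simps\<close>)

lemma rfde_semigroup_0: "rfde_semigroup \<zeta> 0 \<phi> = \<phi>"
proof (rule bb_eqI)
  show "apply_bb (rfde_semigroup \<zeta> 0 \<phi>) \<theta> = apply_bb \<phi> \<theta>" if "\<theta> \<in> {-1..0}" for \<theta>
    using that rfde_solution_solves[of \<zeta> \<phi> \<theta>] by (simp add: apply_rfde_semigroup initial_ext_def volterra_nonpos)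
qed

section \<open>Twin operators from functionals that are continuous under bounded convergence\<close>

lemma nbv_pairing_separates:
  fixes y z :: "(real ^ 'n) bounded_borel"
  assumes "\<And>d. nbv_pairing d y = nbv_pairing d z"
  shows "y = z"
proof -
  have "nbv_pairing d (y + (-1) *\<^sub>R z) = 0" for d
    using assms[of d] by (simp only: nbv_pairing_linear)
  then have "nbv_pairing d (y - z) = 0" for d by simp
  moreover have "norm (y - z) = (SUP d\<in>{d. norm d \<le> 1}. \<bar>nbv_pairing d (y - z)\<bar>)"
    using norming_dual_pair_nbv_pairing[where 'n = 'n] unfolding norming_dual_pair_def by blast
  ultimately have "norm (y - z) = (SUP d\<in>{d :: (real ^ 'n) nbv. norm d \<le> 1}. 0)" by simp
  also have "\<dots> = 0" by (rule cSUP_const) (auto intro: exI[of _ 0])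
  finally show ?thesis by simp
qed

text \<open>
  The adjoint action on \<open>NBV\<close> comes for free from \<open>Riesz_representation\<close>; only the action on the bounded
  Borel functions has to be exhibited.
\<close>
lemma twin_operatorI:
  fixes L :: "(real ^ 'n) nbv \<Rightarrow> (real ^ 'n) bounded_borel \<Rightarrow> real"
  assumes left: "\<And>y. linear (\<lambda>d. L d y)" and right: "\<And>d. linear (L d)"
    and K: "0 \<le> K" and bd: "\<And>d y. \<bar>L d y\<bar> \<le> K * norm d * norm y"
    and cont: "\<And>d. sigma_continuous (L d)"
    and z: "\<And>y. \<exists>z. \<forall>d. nbv_pairing d z = L d y"
  shows "twin_operator nbv_pairing L"
  unfolding twin_operator_def
proof (intro conjI allI z)
  show "bounded_bilinear L"
  proof
    show "L (d + d') y = L d y + L d' y" "L (r *\<^sub>R d) y = r *\<^sub>R L d y" for d d' y r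
      using linear_add[OF left] linear_scale[OF left] by blast+
    show "L d (y + y') = L d y + L d y'" "L d (r *\<^sub>R y) = r *\<^sub>R L d y" for d y y' r
      using linear_add[OF right] linear_scale[OF right] by blast+
    show "\<exists>K. \<forall>d y. norm (L d y) \<le> norm d * norm y * K"
      using bd by (intro exI[of _ K]) (simp add: mult.commute mult.left_commute)
  qed
  fix d :: "(real ^ 'n) nbv"
  have "0 \<le> K * norm d" using K by simp
  from Riesz_representation[OF right[of d] bd[of d] this cont[of d]]
  show "\<exists>e. \<forall>y. nbv_pairing e y = L d y" by metis
qed

lemma left_action_eq:
  "twin_operator nbv_pairing L \<Longrightarrow> nbv_pairing (left_action nbv_pairing d L) y = L d y"
proof -
  assume "twin_operator nbv_pairing L"
  then have "\<exists>e. \<forall>y. nbv_pairing e y = L d y" by (simp add: twin_operator_def)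
  then have "\<exists>!e. \<forall>y. nbv_pairing e y = L d y"
    by (metis nbv_pairing_inject)
  from theI'[OF this] show ?thesis unfolding left_action_def by blast
qed

lemma right_action_operator_form: "right_action nbv_pairing (operator_form nbv_pairing T) y = T y"
  unfolding right_action_def operator_form_def
  by (rule the_equality) (auto intro: nbv_pairing_separates)

text \<open>
  The factor 2 is the sum of the geometric series of the Picard terms.
\<close>
definition growth_factor :: "(real ^ 'n ^ 'n) nbv \<Rightarrow> real"
  where "growth_factor \<zeta> = 2 * exp (growth_rate \<zeta>)"

lemma rfde_semigroup_bound:
  assumes "0 \<le> t"
  shows "norm (rfde_semigroup \<zeta> t \<phi>) \<le> growth_factor \<zeta> * exp (growth_rate \<zeta> * t) * norm \<phi>"
proof (rule norm_bb_least)
  fix \<theta> :: real assume \<theta>: "\<theta> \<in> {-1..0}"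
  have "norm (rfde_solution \<zeta> \<phi> (t + \<theta>)) \<le> 2 * growth_const \<zeta> \<phi> * exp (growth_rate \<zeta> * (t + \<theta>))"
    by (rule rfde_solution_bound)
  also have "\<dots> \<le> 2 * growth_const \<zeta> \<phi> * exp (growth_rate \<zeta> * t)"
    using \<theta> growth_rate_pos[of \<zeta>] growth_const_nonneg[of \<zeta> \<phi>] by (intro mult_left_mono) auto
  finally show "norm (apply_bb (rfde_semigroup \<zeta> t \<phi>) \<theta>) \<le> growth_factor \<zeta> * exp (growth_rate \<zeta> * t) * norm \<phi>"
    using \<theta> assms by (simp add: apply_rfde_semigroup growth_const_def growth_factor_def mult_ac)
qed

lemma rfde_semigroup_linear:
  assumes "0 \<le> t"
  shows "rfde_semigroup \<zeta> t (\<phi> + \<psi>) = rfde_semigroup \<zeta> t \<phi> + rfde_semigroup \<zeta> t \<psi>"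
    "rfde_semigroup \<zeta> t (c *\<^sub>R \<phi>) = c *\<^sub>R rfde_semigroup \<zeta> t \<phi>"
  by (rule bb_eqI; simp add: apply_rfde_semigroup assms rfde_solution_linear)+

lemma rfde_semigroup_lim:
  assumes "0 \<le> t" "\<And>j::nat. norm (\<phi> j) \<le> B" "\<And>\<theta>. (\<lambda>j. apply_bb (\<phi> j) \<theta>) \<longlonglongrightarrow> apply_bb \<psi> \<theta>"
  shows "(\<lambda>j. nbv_pairing d (rfde_semigroup \<zeta> t (\<phi> j))) \<longlonglongrightarrow> nbv_pairing d (rfde_semigroup \<zeta> t \<psi>)"
proof (rule sigma_continuousD[OF sigma_continuous_nbv_pairing])
  show "norm (rfde_semigroup \<zeta> t (\<phi> j)) \<le> growth_factor \<zeta> * exp (growth_rate \<zeta> * t) * B" for j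
    using assms(2)[of j] by (intro order_trans[OF rfde_semigroup_bound[OF assms(1)]] mult_left_mono)
      (auto simp: growth_factor_def)
  show "(\<lambda>j. apply_bb (rfde_semigroup \<zeta> t (\<phi> j)) \<theta>) \<longlonglongrightarrow> apply_bb (rfde_semigroup \<zeta> t \<psi>) \<theta>" for \<theta>
    using rfde_solution_lim[OF assms(2,3), of \<zeta> "t + \<theta>"] by (cases "\<theta> \<in> {-1..0}") (simp_all add: apply_rfde_semigroup assms(1) del: atLeastAtMost_iff)
qed

lemma rfde_form_bound:
  assumes "0 \<le> t"
  shows "\<bar>nbv_pairing d (rfde_semigroup \<zeta> t y)\<bar> \<le> growth_factor \<zeta> * exp (growth_rate \<zeta> * t) * norm y * norm d"
proof -
  have "\<bar>nbv_pairing d (rfde_semigroup \<zeta> t y)\<bar> \<le> norm d * norm (rfde_semigroup \<zeta> t y)"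
    by (rule nbv_pairing_bound)
  also have "\<dots> \<le> norm d * (growth_factor \<zeta> * exp (growth_rate \<zeta> * t) * norm y)"
    by (intro mult_left_mono rfde_semigroup_bound assms) simp
  finally show ?thesis by (simp add: mult_ac)
qed

lemma twin_operator_rfde_semigroup:
  assumes t: "0 \<le> t"
  shows "twin_operator nbv_pairing (operator_form nbv_pairing (rfde_semigroup \<zeta> t))"
proof (rule twin_operatorI[where K = "growth_factor \<zeta> * exp (growth_rate \<zeta> * t)"])
  show "linear (\<lambda>d. operator_form nbv_pairing (rfde_semigroup \<zeta> t) d y)"
    "linear (operator_form nbv_pairing (rfde_semigroup \<zeta> t) d)" for d y
    by (rule linearI; simp add: operator_form_def nbv_pairing_linear rfde_semigroup_linear[OF t])+
  show "\<bar>operator_form nbv_pairing (rfde_semigroup \<zeta> t) d y\<bar>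
      \<le> growth_factor \<zeta> * exp (growth_rate \<zeta> * t) * norm d * norm y" for d y
    using rfde_form_bound[OF t, of d \<zeta> y] by (simp add: operator_form_def mult_ac)
  show "sigma_continuous (operator_form nbv_pairing (rfde_semigroup \<zeta> t) d)" for d
    unfolding operator_form_def by (rule sigma_continuousI) (rule rfde_semigroup_lim[OF t])
qed (auto simp: operator_form_def growth_factor_def)

lemma twin_comp_rfde_semigroup:
  assumes "0 \<le> t" "0 \<le> s"
  shows "operator_form nbv_pairing (rfde_semigroup \<zeta> (t + s)) =
    twin_comp nbv_pairing (operator_form nbv_pairing (rfde_semigroup \<zeta> t))
      (operator_form nbv_pairing (rfde_semigroup \<zeta> s))"
proof (intro ext)
  fix d y
  show "operator_form nbv_pairing (rfde_semigroup \<zeta> (t + s)) d y =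
    twin_comp nbv_pairing (operator_form nbv_pairing (rfde_semigroup \<zeta> t))
      (operator_form nbv_pairing (rfde_semigroup \<zeta> s)) d y"
    unfolding twin_comp_def right_action_operator_form
      left_action_eq[OF twin_operator_rfde_semigroup[OF assms(1)]]
    by (simp add: operator_form_def rfde_semigroup_add[OF assms])
qed

text \<open>
  This expression for the pairing with $S(t)y$ makes sense for all real \<open>t\<close>, and its dependence on \<open>t\<close> is
  covered by the measurability and Fubini lemmas for parametric integrands.
\<close>
lemma rfde_form_eq:
  assumes "0 \<le> t"
  shows "nbv_pairing d (rfde_semigroup \<zeta> t y) = integral_dot d (\<lambda>\<sigma>. rfde_solution \<zeta> y (t - \<sigma>))"
  unfolding nbv_pairing_def by (rule integral_dot_cong) (simp add: apply_rfde_semigroup assms)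

lemma rfde_solution_shift_component_measurable:
  "(\<lambda>(t, \<sigma>). rfde_solution \<zeta> y (t - \<sigma>) $ i) \<in> borel_measurable (borel \<Otimes>\<^sub>M borel)"
proof -
  have "(\<lambda>p. rfde_solution \<zeta> y (fst p - snd p)) \<in> borel_measurable (borel \<Otimes>\<^sub>M borel)"
    using tame_measurable[OF tame_rfde_solution[of \<zeta> y]] by measurable
  from borel_measurable_vec_nth[OF this, of i] show ?thesis by (simp add: case_prod_beta')
qed

lemma rfde_form_measurable:
  "(\<lambda>t. integral_dot d (\<lambda>\<sigma>. rfde_solution \<zeta> y (t - \<sigma>))) \<in> borel_measurable borel"
  unfolding integral_dot_def
proof (intro borel_measurable_sum stieltjes_measurable[OF representable_nbv_component]
    rfde_solution_shift_component_measurable)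
  fix i t
  obtain B where "\<And>s \<sigma>. s \<le> t \<Longrightarrow> \<sigma> \<in> {0..1} \<Longrightarrow> norm (rfde_solution \<zeta> y (s - \<sigma>)) \<le> B"
    using tame_shift[OF tame_rfde_solution[of \<zeta> y], of t] by metis
  then show "bounded ((\<lambda>\<sigma>. rfde_solution \<zeta> y (t - \<sigma>) $ i) ` {0..1})"
    by (auto intro!: boundedI[of _ B] order_trans[OF component_le_norm_cart])
qed

section \<open>Laplace transforms\<close>

lemma set_integrable_exp_decay:
  assumes "0 < (a :: real)"
  shows "set_integrable lborel {0..} (\<lambda>t. c * exp (- a * t))"
proof -
  have "(\<lambda>t. exp (- a * t)) absolutely_integrable_on {0..}"
    by (intro nonnegative_absolutely_integrable_1 integrable_on_exp_minus_to_infinity assms) simp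
  then have "integrable lebesgue (\<lambda>t. indicator {0..} t *\<^sub>R exp (- a * t))"
    by (simp add: set_integrable_def)
  then have "set_integrable lborel {0..} (\<lambda>t. exp (- a * t))"
    unfolding set_integrable_def by (subst (asm) integrable_completion) auto
  then show ?thesis by (rule set_integrable_mult_right)
qed

text \<open>
  The weight \<open>w\<close> stands for \<open>exp (- \<kappa> t)\<close>, or for the real or imaginary part of a
  complex exponential of modulus \<open>exp (- \<kappa> t)\<close>.
\<close>
definition laplace_form ::
    "(real ^ 'n ^ 'n) nbv \<Rightarrow> (real \<Rightarrow> real) \<Rightarrow> (real ^ 'n) nbv \<Rightarrow> (real ^ 'n) bounded_borel \<Rightarrow> real"
  where "laplace_form \<zeta> w d y = (LBINT t:{0..}. w t * nbv_pairing d (rfde_semigroup \<zeta> t y))"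

context
  fixes \<zeta> :: "(real ^ 'n ^ 'n) nbv" and w :: "real \<Rightarrow> real" and \<kappa> :: real
  assumes w: "w \<in> borel_measurable borel" "\<And>t. 0 \<le> t \<Longrightarrow> \<bar>w t\<bar> \<le> exp (- \<kappa> * t)"
    and \<kappa>: "growth_rate \<zeta> < \<kappa>"
begin

lemma weight_bound:
  assumes "0 \<le> t" "\<bar>r\<bar> \<le> c * exp (growth_rate \<zeta> * t)"
  shows "\<bar>w t * r\<bar> \<le> c * exp (- (\<kappa> - growth_rate \<zeta>) * t)"
proof -
  have "\<bar>w t * r\<bar> \<le> exp (- \<kappa> * t) * (c * exp (growth_rate \<zeta> * t))"
    unfolding abs_mult using assms w(2)[OF assms(1)] by (intro mult_mono) auto
  also have "\<dots> = c * exp (- (\<kappa> - growth_rate \<zeta>) * t)"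
    by (simp add: algebra_simps exp_add[symmetric])
  finally show ?thesis .
qed

lemma majorant_integrable: "set_integrable lborel {0..} (\<lambda>t. c * exp (- (\<kappa> - growth_rate \<zeta>) * t))"
  using \<kappa> by (intro set_integrable_exp_decay) simp

lemma weighted_rfde_form_measurable:
  "(\<lambda>t. indicator {0..} t *\<^sub>R (w t * nbv_pairing d (rfde_semigroup \<zeta> t y))) \<in> borel_measurable borel"
proof -
  have "(\<lambda>t. indicator {0..} t *\<^sub>R (w t * integral_dot d (\<lambda>\<sigma>. rfde_solution \<zeta> y (t - \<sigma>)))) \<in> borel_measurable borel"
    using w(1) rfde_form_measurable by measurable
  then show ?thesis
    by (rule measurable_cong[THEN iffD1, rotated]) (auto simp: rfde_form_eq indicator_def)
qed

lemma weighted_rfde_form_bound: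
  "0 \<le> t \<Longrightarrow> \<bar>w t * nbv_pairing d (rfde_semigroup \<zeta> t y)\<bar> \<le>
    (growth_factor \<zeta> * norm y * norm d) * exp (- (\<kappa> - growth_rate \<zeta>) * t)"
  using rfde_form_bound[of t d \<zeta> y] by (intro weight_bound) (simp_all add: mult_ac)

lemma laplace_integrable:
  "set_integrable lborel {0..} (\<lambda>t. w t * nbv_pairing d (rfde_semigroup \<zeta> t y))"
  unfolding set_integrable_def
proof (rule Bochner_Integration.integrable_bound)
  show "integrable lborel (\<lambda>t. indicator {0..} t *\<^sub>R ((growth_factor \<zeta> * norm y * norm d) * exp (- (\<kappa> - growth_rate \<zeta>) * t)))"
    using majorant_integrable by (simp add: set_integrable_def)
  show "(\<lambda>t. indicator {0..} t *\<^sub>R (w t * nbv_pairing d (rfde_semigroup \<zeta> t y))) \<in> borel_measurable lborel"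
    using weighted_rfde_form_measurable by simp
  show "AE t in lborel. norm (indicator {0..} t *\<^sub>R (w t * nbv_pairing d (rfde_semigroup \<zeta> t y)))
      \<le> norm (indicator {0..} t *\<^sub>R ((growth_factor \<zeta> * norm y * norm d) * exp (- (\<kappa> - growth_rate \<zeta>) * t)))"
    using weighted_rfde_form_bound by (intro AE_I2) (auto simp: indicator_def intro: order_trans[OF _ abs_ge_self])
qed

lemma laplace_form_linear: "linear (\<lambda>d. laplace_form \<zeta> w d y)" "linear (laplace_form \<zeta> w d)"
proof -
  have add: "(LBINT t:{0..}. f t + g t) = (LBINT t:{0..}. f t) + (LBINT t:{0..}. g t)"
    if "set_integrable lborel {0..} f" "set_integrable lborel {0..} g" for f g :: "real \<Rightarrow> real"
    by (rule set_integral_add(2)[OF that])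
  have cong: "(LBINT t:{0..}. f t) = (LBINT t:{0..}. g t)"
    if "\<And>t. 0 \<le> t \<Longrightarrow> f t = g t" for f g :: "real \<Rightarrow> real"
    using that by (intro set_lebesgue_integral_cong) auto
  show "linear (\<lambda>d. laplace_form \<zeta> w d y)"
    by (rule linearI)
       (simp_all add: laplace_form_def nbv_pairing_linear distrib_left add laplace_integrable mult.left_commute[of "w _"])
  show "linear (laplace_form \<zeta> w d)"
  proof (rule linearI)
    show "laplace_form \<zeta> w d (x + y) = laplace_form \<zeta> w d x + laplace_form \<zeta> w d y" for x y
      unfolding laplace_form_def add[OF laplace_integrable laplace_integrable, symmetric]
      by (rule cong) (simp add: nbv_pairing_linear rfde_semigroup_linear distrib_left)
    show "laplace_form \<zeta> w d (r *\<^sub>R x) = r *\<^sub>R laplace_form \<zeta> w d x" for r x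
      unfolding laplace_form_def real_scaleR_def set_integral_mult_right[symmetric]
      by (rule cong) (simp add: nbv_pairing_linear rfde_semigroup_linear)
  qed
qed

lemma laplace_form_bound:
  "\<bar>laplace_form \<zeta> w d y\<bar> \<le> (growth_factor \<zeta> * (LBINT t:{0..}. exp (- (\<kappa> - growth_rate \<zeta>) * t))) * norm d * norm y"
proof -
  have "norm (laplace_form \<zeta> w d y) \<le> (LBINT t:{0..}. (growth_factor \<zeta> * norm y * norm d) * exp (- (\<kappa> - growth_rate \<zeta>) * t))"
    unfolding laplace_form_def set_lebesgue_integral_def
  proof (rule Bochner_Integration.integral_norm_bound_integral)
    show "integrable lborel (\<lambda>t. indicator {0..} t *\<^sub>R (w t * nbv_pairing d (rfde_semigroup \<zeta> t y)))"
      using laplace_integrable by (simp add: set_integrable_def)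
    show "integrable lborel (\<lambda>t. indicator {0..} t *\<^sub>R ((growth_factor \<zeta> * norm y * norm d) * exp (- (\<kappa> - growth_rate \<zeta>) * t)))"
      using majorant_integrable by (simp add: set_integrable_def)
  qed (use weighted_rfde_form_bound in \<open>auto simp: indicator_def\<close>)
  then show ?thesis by (simp add: mult_ac)
qed

lemma laplace_form_sigma_continuous: "sigma_continuous (laplace_form \<zeta> w d)"
proof (rule sigma_continuousI)
  fix \<phi> :: "nat \<Rightarrow> (real ^ 'n) bounded_borel" and \<psi> B
  assume B: "\<And>k. norm (\<phi> k) \<le> B" and lim: "\<And>\<theta>. (\<lambda>k. apply_bb (\<phi> k) \<theta>) \<longlonglongrightarrow> apply_bb \<psi> \<theta>"
  let ?c = "growth_factor \<zeta> * B * norm d"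
  show "(\<lambda>k. laplace_form \<zeta> w d (\<phi> k)) \<longlonglongrightarrow> laplace_form \<zeta> w d \<psi>"
    unfolding laplace_form_def set_lebesgue_integral_def
  proof (rule integral_dominated_convergence)
    show "integrable lborel (\<lambda>t. indicator {0..} t *\<^sub>R (?c * exp (- (\<kappa> - growth_rate \<zeta>) * t)))"
      using majorant_integrable by (simp add: set_integrable_def)
    show "AE t in lborel. (\<lambda>k. indicator {0..} t *\<^sub>R (w t * nbv_pairing d (rfde_semigroup \<zeta> t (\<phi> k)))) \<longlonglongrightarrow>
        indicator {0..} t *\<^sub>R (w t * nbv_pairing d (rfde_semigroup \<zeta> t \<psi>))"
    proof (rule AE_I2)
      fix t :: real
      show "(\<lambda>k. indicator {0..} t *\<^sub>R (w t * nbv_pairing d (rfde_semigroup \<zeta> t (\<phi> k)))) \<longlonglongrightarrow>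
          indicator {0..} t *\<^sub>R (w t * nbv_pairing d (rfde_semigroup \<zeta> t \<psi>))"
      proof (cases "0 \<le> t")
        case True
        show ?thesis by (intro tendsto_intros rfde_semigroup_lim[OF True B lim])
      qed auto
    qed
    fix k
    have "(growth_factor \<zeta> * norm (\<phi> k) * norm d) * exp (- (\<kappa> - growth_rate \<zeta>) * t) \<le> ?c * exp (- (\<kappa> - growth_rate \<zeta>) * t)" for t
      using B[of k] by (intro mult_right_mono mult_left_mono) (auto simp: growth_factor_def)
    then have "\<bar>w t * nbv_pairing d (rfde_semigroup \<zeta> t (\<phi> k))\<bar> \<le> ?c * exp (- (\<kappa> - growth_rate \<zeta>) * t)" if "0 \<le> t" for t
      using weighted_rfde_form_bound[OF that] order_trans by blast
    then show "AE t in lborel. norm (indicator {0..} t *\<^sub>R (w t * nbv_pairing d (rfde_semigroup \<zeta> t (\<phi> k))))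
        \<le> indicator {0..} t *\<^sub>R (?c * exp (- (\<kappa> - growth_rate \<zeta>) * t))"
      by (intro AE_I2) (auto simp: indicator_def)
  qed (use weighted_rfde_form_measurable in simp_all)
qed

text \<open>
  The function is $\theta\mapsto\int_0^\infty w(t)\,x(t+\theta)\,dt$, and pairing it with
  \<open>d\<close> is an exchange of the order of integration.
\<close>
lemma laplace_form_right: "\<exists>z. \<forall>d. nbv_pairing d z = laplace_form \<zeta> w d y"
proof -
  let ?x = "rfde_solution \<zeta> y"
  define G where "G i t \<sigma> = indicator {0..} t * (w t * ?x (t - \<sigma>) $ i)" for i t \<sigma>
  define k where "k t = indicator {0..} t * (2 * growth_const \<zeta> y * exp (- (\<kappa> - growth_rate \<zeta>) * t))" for t :: real
  have k: "integrable lborel k"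
    using majorant_integrable[of "2 * growth_const \<zeta> y"] unfolding k_def set_integrable_def real_scaleR_def .
  have Gm: "case_prod (G i) \<in> borel_measurable (borel \<Otimes>\<^sub>M borel)" for i
    unfolding G_def
    using rfde_solution_shift_component_measurable[of \<zeta> y i] w(1) by measurable
  have Gk: "\<bar>G i t \<sigma>\<bar> \<le> k t" if \<sigma>: "\<sigma> \<in> {0..1}" for i t \<sigma>
  proof (cases "0 \<le> t")
    case True
    have "\<bar>?x (t - \<sigma>) $ i\<bar> \<le> norm (?x (t - \<sigma>))" by (rule component_le_norm_cart)
    also have "\<dots> \<le> 2 * growth_const \<zeta> y * exp (growth_rate \<zeta> * (t - \<sigma>))" by (rule rfde_solution_bound)
    also have "\<dots> \<le> 2 * growth_const \<zeta> y * exp (growth_rate \<zeta> * t)"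
      using \<sigma> growth_rate_pos[of \<zeta>] growth_const_nonneg[of \<zeta> y] by (intro mult_left_mono) auto
    finally show ?thesis using weight_bound[OF True] True by (simp add: G_def k_def)
  qed (simp add: G_def k_def)
  (* Defined coordinate by coordinate, in the form in which the exchange of integrals delivers it. *)
  define g where "g \<sigma> = (\<chi> i. \<integral>t. G i t \<sigma> \<partial>lborel)" for \<sigma>
  have bd: "bounded_borel_on_unit (\<lambda>\<sigma>. \<integral>t. G i t \<sigma> \<partial>lborel)" for i
    by (rule integral_bounded_borel_on_unit[OF Gm k Gk])
  have gm: "g \<in> borel_measurable borel"
    unfolding g_def using bd by (intro borel_measurable_vec_lambda bounded_borel_on_unit_measurable)
  have "\<exists>B. \<forall>\<sigma>\<in>{0..1}. \<bar>\<integral>t. G i t \<sigma> \<partial>lborel\<bar> \<le> B" for i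
    by (rule bounded_borel_on_unitE[OF bd[of i]]) blast
  then obtain B where "\<And>i \<sigma>. \<sigma> \<in> {0..1} \<Longrightarrow> \<bar>\<integral>t. G i t \<sigma> \<partial>lborel\<bar> \<le> B i" by metis
  then have "norm (g \<sigma>) \<le> (\<Sum>i\<in>UNIV. B i)" if "\<sigma> \<in> {0..1}" for \<sigma>
    using that by (intro order_trans[OF norm_le_l1_cart] sum_mono) (simp add: g_def)
  then have gb: "bounded (g ` {0..1})" by (auto intro!: boundedI[where B = "\<Sum>i\<in>UNIV. B i"])
  have "nbv_pairing d (bb_of g) = laplace_form \<zeta> w d y" for d
  proof -
    let ?S = "\<lambda>i. stieltjes_integral (\<lambda>\<sigma>. apply_nbv d \<sigma> $ i)"
    have "nbv_pairing d (bb_of g) = (\<Sum>i\<in>UNIV. ?S i (\<lambda>\<sigma>. \<integral>t. G i t \<sigma> \<partial>lborel))"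
      by (simp add: nbv_pairing_bb_of[OF gm gb] integral_dot_def g_def)
    also have "\<dots> = (\<Sum>i\<in>UNIV. \<integral>t. ?S i (G i t) \<partial>lborel)"
      by (intro sum.cong refl stieltjes_Fubini(2)[symmetric, OF representable_nbv_component Gm k Gk])
    also have "\<dots> = (\<integral>t. (\<Sum>i\<in>UNIV. ?S i (G i t)) \<partial>lborel)"
      by (intro Bochner_Integration.integral_sum[symmetric] stieltjes_Fubini(1)[OF representable_nbv_component Gm k Gk])
    also have "\<dots> = laplace_form \<zeta> w d y"
      unfolding laplace_form_def set_lebesgue_integral_def
    proof (rule Bochner_Integration.integral_cong[OF refl])
      fix t :: real
      obtain B where "\<And>s \<sigma>. s \<le> t \<Longrightarrow> \<sigma> \<in> {0..1} \<Longrightarrow> norm (?x (s - \<sigma>)) \<le> B"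
        using tame_shift[OF tame_rfde_solution[of \<zeta> y], of t] by metis
      then have "norm (?x (t - \<sigma>)) \<le> B" if "\<sigma> \<in> {0..1}" for \<sigma> using that by blast
      from bounded_borel_on_unit_vec_nth[OF shift_measurable[OF tame_rfde_solution] this]
      have x: "bounded_borel_on_unit (\<lambda>\<sigma>. ?x (t - \<sigma>) $ i)" for i .
      have "?S i (G i t) = indicator {0..} t * (w t * ?S i (\<lambda>\<sigma>. ?x (t - \<sigma>) $ i))" for i
        unfolding G_def mult.assoc[symmetric]
        by (rule stieltjes_cmult[OF representable_nbv_component x])
      then have "(\<Sum>i\<in>UNIV. ?S i (G i t)) = indicator {0..} t * (w t * integral_dot d (\<lambda>\<sigma>. ?x (t - \<sigma>)))"
        by (simp add: integral_dot_def sum_distrib_left)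
      then show "(\<Sum>i\<in>UNIV. ?S i (G i t)) = indicator {0..} t *\<^sub>R (w t * nbv_pairing d (rfde_semigroup \<zeta> t y))"
        by (simp add: rfde_form_eq indicator_def)
    qed
    finally show ?thesis .
  qed
  then show ?thesis by blast
qed

lemma twin_operator_laplace_form: "twin_operator nbv_pairing (laplace_form \<zeta> w)"
proof (rule twin_operatorI[OF laplace_form_linear _ laplace_form_bound laplace_form_sigma_continuous laplace_form_right])
  have "0 \<le> (LBINT t:{0..}. exp (- (\<kappa> - growth_rate \<zeta>) * t))"
    unfolding set_lebesgue_integral_def by (intro Bochner_Integration.integral_nonneg) auto
  then show "0 \<le> growth_factor \<zeta> * (LBINT t:{0..}. exp (- (\<kappa> - growth_rate \<zeta>) * t))"
    by (simp add: growth_factor_def)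
qed

end

section \<open>Complexification and the twin semigroup\<close>

text \<open>
  The supremum that defines the Taylor norm includes the angles $0$ and $\pi/2$.
\<close>
lemma cplx_norm_upper:
  "norm (fst w) \<le> cplx_norm w" "norm (snd w) \<le> cplx_norm w"
proof -
  have "bdd_above (range (\<lambda>\<alpha>. norm (cos \<alpha> *\<^sub>R fst w + sin \<alpha> *\<^sub>R snd w)))"
  proof (rule bdd_aboveI2)
    fix \<alpha> :: real
    show "norm (cos \<alpha> *\<^sub>R fst w + sin \<alpha> *\<^sub>R snd w) \<le> norm (fst w) + norm (snd w)"
      by (rule norm_triangle_le) (auto intro!: add_mono mult_left_le_one_le)
  qed
  then have "norm (cos \<alpha> *\<^sub>R fst w + sin \<alpha> *\<^sub>R snd w) \<le> cplx_norm w" for \<alpha>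
    unfolding cplx_norm_def by (rule cSUP_upper[OF UNIV_I])
  from this[of 0] this[of "pi / 2"]
  show "norm (fst w) \<le> cplx_norm w" "norm (snd w) \<le> cplx_norm w" by simp_all
qed

lemma cplx_form_bounded_bilinear:
  assumes "bounded_bilinear L"
  shows "cplx_bounded_bilinear (cplx_form L)"
proof -
  interpret bounded_bilinear L by fact
  obtain K where K: "0 < K" "\<And>d y. norm (L d y) \<le> norm d * norm y * K"
    using pos_bounded by blast
  have le: "\<bar>L d y\<bar> \<le> K * cplx_norm v * cplx_norm u"
    if "norm d \<le> cplx_norm v" "norm y \<le> cplx_norm u" for d y and v :: "'a \<times> 'a" and u :: "'b \<times> 'b"
  proof -
    have "norm d * norm y * K \<le> cplx_norm v * cplx_norm u * K"
      using that K(1) order_trans[OF norm_ge_zero that(1)]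
      by (intro mult_right_mono mult_mono) auto
    then show ?thesis using K(2)[of d y] by (simp add: mult_ac)
  qed
  have "norm (cplx_form L d y) \<le> 4 * K * cplx_norm d * cplx_norm y" for d y
  proof -
    have "norm (cplx_form L d y) \<le> \<bar>Re (cplx_form L d y)\<bar> + \<bar>Im (cplx_form L d y)\<bar>"
      by (rule cmod_le)
    also have "\<dots> \<le> (\<bar>L (fst d) (fst y)\<bar> + \<bar>L (snd d) (snd y)\<bar>) + (\<bar>L (fst d) (snd y)\<bar> + \<bar>L (snd d) (fst y)\<bar>)"
      unfolding cplx_form_def by (intro add_mono) auto
    also have "\<dots> \<le> 4 * K * cplx_norm d * cplx_norm y"
      using le[OF cplx_norm_upper(1) cplx_norm_upper(1), of d y] le[OF cplx_norm_upper(2) cplx_norm_upper(2), of d y]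
        le[OF cplx_norm_upper(1) cplx_norm_upper(2), of d y] le[OF cplx_norm_upper(2) cplx_norm_upper(1), of d y]
      by linarith
    finally show ?thesis .
  qed
  then show ?thesis
    unfolding cplx_bounded_bilinear_def
    by (intro conjI allI exI[of _ "4 * K"])
       (auto simp: cplx_form_def cplx_scale_def complex_eq_iff add_left add_right diff_left diff_right
         scaleR_left scaleR_right algebra_simps)
qed

lemma cplx_bounded_bilinearD:
  assumes "cplx_bounded_bilinear L"
  shows "L (d + d') y = L d y + L d' y" "L d (y + y') = L d y + L d y'"
    "L (cplx_scale r d) y = r * L d y" "L d (cplx_scale r y) = r * L d y"
    "\<exists>K. \<forall>d y. norm (L d y) \<le> K * cplx_norm d * cplx_norm y"
proof -
  note L = assms[unfolded cplx_bounded_bilinear_def]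
  show "L (d + d') y = L d y + L d' y" by (rule L[THEN conjunct1, rule_format])
  show "L d (y + y') = L d y + L d y'" by (rule L[THEN conjunct2, THEN conjunct1, rule_format])
  show "L (cplx_scale r d) y = r * L d y"
    by (rule L[THEN conjunct2, THEN conjunct2, THEN conjunct1, rule_format])
  show "L d (cplx_scale r y) = r * L d y"
    by (rule L[THEN conjunct2, THEN conjunct2, THEN conjunct2, THEN conjunct1, rule_format])
  show "\<exists>K. \<forall>d y. norm (L d y) \<le> K * cplx_norm d * cplx_norm y"
    by (rule L[THEN conjunct2, THEN conjunct2, THEN conjunct2, THEN conjunct2])
qed

lemma cplx_bounded_bilinear_combine:
  assumes L: "cplx_bounded_bilinear L" and M: "cplx_bounded_bilinear M"
  shows "cplx_bounded_bilinear (\<lambda>d y. L d y + c * M d y)"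
proof -
  obtain K1 K2 where K: "\<And>d y. norm (L d y) \<le> K1 * cplx_norm d * cplx_norm y"
    "\<And>d y. norm (M d y) \<le> K2 * cplx_norm d * cplx_norm y"
    using cplx_bounded_bilinearD(5)[OF L] cplx_bounded_bilinearD(5)[OF M] by metis
  have "norm (L d y + c * M d y) \<le> (K1 + norm c * K2) * cplx_norm d * cplx_norm y" for d y
  proof -
    have "norm (L d y + c * M d y) \<le> norm (L d y) + norm c * norm (M d y)"
      by (rule order_trans[OF norm_triangle_ineq]) (simp add: norm_mult)
    also have "\<dots> \<le> K1 * cplx_norm d * cplx_norm y + norm c * (K2 * cplx_norm d * cplx_norm y)"
      by (intro add_mono mult_left_mono K) auto
    finally show ?thesis by (simp add: algebra_simps)
  qed
  note le = this
  show ?thesis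
    unfolding cplx_bounded_bilinear_def
    by (intro conjI allI exI[of _ "K1 + norm c * K2"] le) 
       (simp_all only: cplx_bounded_bilinearD[OF L] cplx_bounded_bilinearD[OF M] distrib_left ac_simps)
qed

text \<open>
  If \<open>A\<close> and \<open>B\<close> send \<open>y1\<close>, \<open>y2\<close> to \<open>a1\<close>, \<open>a2\<close> and \<open>b1\<close>, \<open>b2\<close>, then \<open>A + i B\<close> sends \<open>y1 + i y2\<close> to
  \<open>(a1 - b2) + i (a2 + b1)\<close>; the same formula gives the action on the other space.
\<close>
lemma cplx_twin_operator_combine:
  assumes p: "bounded_bilinear p" and A: "twin_operator p A" and B: "twin_operator p B"
  shows "cplx_twin_operator p (\<lambda>d y. cplx_form A d y + \<i> * cplx_form B d y)"
  unfolding cplx_twin_operator_def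
proof (intro conjI allI)
  interpret p: bounded_bilinear p by fact
  show "cplx_bounded_bilinear (\<lambda>d y. cplx_form A d y + \<i> * cplx_form B d y)"
    using A B by (intro cplx_bounded_bilinear_combine cplx_form_bounded_bilinear) (simp_all add: twin_operator_def)
  have "\<exists>z. \<forall>d. p d z = A d y" "\<exists>z. \<forall>d. p d z = B d y" for y
    using A B by (simp_all add: twin_operator_def)
  then obtain a b where a: "\<And>d y. p d (a y) = A d y" and b: "\<And>d y. p d (b y) = B d y" by metis
  show "\<exists>z. \<forall>d. cplx_form p d z = cplx_form A d y + \<i> * cplx_form B d y" for y
    by (intro exI[of _ "(a (fst y) - b (snd y), a (snd y) + b (fst y))"])
       (simp add: cplx_form_def complex_eq_iff p.diff_right p.add_right a b)
  have "\<exists>e. \<forall>y. p e y = A d y" "\<exists>e. \<forall>y. p e y = B d y" for d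
    using A B by (simp_all add: twin_operator_def)
  then obtain a' b' where a': "\<And>d y. p (a' d) y = A d y" and b': "\<And>d y. p (b' d) y = B d y" by metis
  show "\<exists>e. \<forall>y. cplx_form p e y = cplx_form A d y + \<i> * cplx_form B d y" for d
    by (intro exI[of _ "(a' (fst d) - b' (snd d), a' (snd d) + b' (fst d))"])
       (simp add: cplx_form_def complex_eq_iff p.diff_left p.add_left a' b')
qed

lemma set_integral_Complex:
  assumes f: "set_integrable M A f" and g: "set_integrable M A g"
  shows "set_integrable M A (\<lambda>x. Complex (f x) (g x))"
    "(LINT x:A|M. Complex (f x) (g x)) = Complex (LINT x:A|M. f x) (LINT x:A|M. g x)"
proof -
  have eq: "indicator A x *\<^sub>R Complex (f x) (g x) =
      complex_of_real (indicator A x *\<^sub>R f x) + \<i> * complex_of_real (indicator A x *\<^sub>R g x)" for x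
    by (simp add: complex_eq_iff)
  have fg: "integrable M (\<lambda>x. complex_of_real (indicator A x *\<^sub>R f x))"
    "integrable M (\<lambda>x. complex_of_real (indicator A x *\<^sub>R g x))"
    by (intro integrable_of_real f[unfolded set_integrable_def] g[unfolded set_integrable_def])+
  show "set_integrable M A (\<lambda>x. Complex (f x) (g x))"
    unfolding set_integrable_def eq
    by (intro Bochner_Integration.integrable_add integrable_mult_right fg)
  show "(LINT x:A|M. Complex (f x) (g x)) = Complex (LINT x:A|M. f x) (LINT x:A|M. g x)"
    unfolding set_lebesgue_integral_def eq
    by (subst Bochner_Integration.integral_add[OF fg(1) integrable_mult_right[OF fg(2)]])
       (simp only: Complex_eq integral_complex_of_real integral_mult_right_zero)
qed

lemma bounded_bilinear_nbv_pairing: "bounded_bilinear (nbv_pairing :: (real ^ 'n) nbv \<Rightarrow> _)"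
proof
  show "\<exists>K. \<forall>d y. norm (nbv_pairing d y) \<le> norm d * norm y * K"
    by (intro exI[of _ 1]) (simp add: nbv_pairing_bound)
qed (simp_all add: nbv_pairing_linear)

text \<open>
  For non-real \<open>z\<close> the integrand is the product of \<open>?a + i ?b\<close>, the exponential, with a complex
  combination of real forms. Its real and imaginary parts are therefore sums of integrands of
  \<open>laplace_form\<close> with the weights \<open>?a\<close> and \<open>?b\<close>.
\<close>
lemma has_laplace_twin_operator_rfde:
  fixes \<zeta> :: "(real ^ 'n ^ 'n) nbv"
  assumes z: "growth_rate \<zeta> < Re z"
  shows "has_laplace_twin_operator nbv_pairing (\<lambda>t. operator_form nbv_pairing (rfde_semigroup \<zeta> t)) z"
proof (cases "Im z = 0")
  case True
  let ?w = "\<lambda>t. exp (- Re z * t)"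
  have w: "?w \<in> borel_measurable borel" "\<And>t. 0 \<le> t \<Longrightarrow> \<bar>?w t\<bar> \<le> exp (- Re z * t)" by auto
  show ?thesis
    unfolding has_laplace_twin_operator_def operator_form_def
    using True twin_operator_laplace_form[OF w z] laplace_integrable[OF w z]
    by (auto simp: laplace_form_def intro!: exI[of _ "laplace_form \<zeta> ?w"])
next
  case False
  let ?e = "\<lambda>t. exp (- z * complex_of_real t)"
  let ?a = "\<lambda>t. Re (?e t)" and ?b = "\<lambda>t. Im (?e t)"
  have e: "norm (?e t) = exp (- Re z * t)" for t by simp
  have a: "?a \<in> borel_measurable borel" "\<And>t. 0 \<le> t \<Longrightarrow> \<bar>?a t\<bar> \<le> exp (- Re z * t)"
    using abs_Re_le_cmod[of "?e _"] e by (auto simp del: complex_Re_le_cmod)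
  have b: "?b \<in> borel_measurable borel" "\<And>t. 0 \<le> t \<Longrightarrow> \<bar>?b t\<bar> \<le> exp (- Re z * t)"
    using abs_Im_le_cmod[of "?e _"] e by auto
  let ?S = "\<lambda>t d y. nbv_pairing d (rfde_semigroup \<zeta> t y)"
  let ?A = "laplace_form \<zeta> ?a" and ?B = "laplace_form \<zeta> ?b"
  have int: "set_integrable lborel {0..} (\<lambda>t. ?a t * ?S t d y)" "set_integrable lborel {0..} (\<lambda>t. ?b t * ?S t d y)" for d y
    by (rule laplace_integrable[OF a z], assumption, rule laplace_integrable[OF b z], assumption)
  let ?L = "\<lambda>d y. cplx_form ?A d y + \<i> * cplx_form ?B d y"
  have "cplx_twin_operator nbv_pairing ?L"
    by (intro cplx_twin_operator_combine bounded_bilinear_nbv_pairing twin_operator_laplace_form[OF a z]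
        twin_operator_laplace_form[OF b z])
  moreover have "set_integrable lborel {0..} (\<lambda>t. ?e t * cplx_form (?S t) d y)"
    "?L d y = (LBINT t:{0..}. ?e t * cplx_form (?S t) d y)" for d y
  proof -
    obtain d1 d2 where d: "d = (d1, d2)" by (cases d)
    obtain y1 y2 where y: "y = (y1, y2)" by (cases y)
    let ?f = "\<lambda>t. ?a t * ?S t d1 y1 - ?a t * ?S t d2 y2 - (?b t * ?S t d1 y2 + ?b t * ?S t d2 y1)"
    let ?g = "\<lambda>t. ?a t * ?S t d1 y2 + ?a t * ?S t d2 y1 + (?b t * ?S t d1 y1 - ?b t * ?S t d2 y2)"
    have eq: "?e t * cplx_form (?S t) d y = Complex (?f t) (?g t)" for t
      by (simp add: complex_eq_iff cplx_form_def d y algebra_simps del: Re_exp Im_exp)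
    have fg: "set_integrable lborel {0..} ?f" "set_integrable lborel {0..} ?g"
      by (intro set_integral_add(1) set_integral_diff(1) int)+
    have f: "(LBINT t:{0..}. ?f t) = ?A d1 y1 - ?A d2 y2 - (?B d1 y2 + ?B d2 y1)"
      by (simp only: laplace_form_def set_integral_add set_integral_diff int)
    have g: "(LBINT t:{0..}. ?g t) = ?A d1 y2 + ?A d2 y1 + (?B d1 y1 - ?B d2 y2)"
      by (simp only: laplace_form_def set_integral_add set_integral_diff int)
    show "set_integrable lborel {0..} (\<lambda>t. ?e t * cplx_form (?S t) d y)"
      unfolding eq by (rule set_integral_Complex(1)[OF fg])
    show "?L d y = (LBINT t:{0..}. ?e t * cplx_form (?S t) d y)"
      unfolding eq set_integral_Complex(2)[OF fg] f g
      by (simp add: complex_eq_iff cplx_form_def d y)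
  qed
  ultimately show ?thesis
    unfolding has_laplace_twin_operator_def operator_form_def using False by auto
qed

lemma twin_semigroup_rfde:
  fixes \<zeta> :: "(real ^ 'n ^ 'n) nbv"
  shows "twin_semigroup nbv_pairing (\<lambda>t. operator_form nbv_pairing (rfde_semigroup \<zeta> t))"
  unfolding twin_semigroup_def
proof (intro conjI allI impI)
  show "twin_operator nbv_pairing (operator_form nbv_pairing (rfde_semigroup \<zeta> t))" if "0 \<le> t" for t
    by (rule twin_operator_rfde_semigroup[OF that])
  show "operator_form nbv_pairing (rfde_semigroup \<zeta> 0) = nbv_pairing"
    by (intro ext) (simp add: operator_form_def rfde_semigroup_0)
  show "operator_form nbv_pairing (rfde_semigroup \<zeta> (t + s)) =
      twin_comp nbv_pairing (operator_form nbv_pairing (rfde_semigroup \<zeta> t))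
        (operator_form nbv_pairing (rfde_semigroup \<zeta> s))" if "0 \<le> t" "0 \<le> s" for t s
    by (rule twin_comp_rfde_semigroup[OF that])
  show "(\<lambda>t. operator_form nbv_pairing (rfde_semigroup \<zeta> t) d y) \<in> borel_measurable (restrict_space borel {0..})" for d y
  proof -
    have "(\<lambda>t. integral_dot d (\<lambda>\<sigma>. rfde_solution \<zeta> y (t - \<sigma>))) \<in> borel_measurable (restrict_space borel {0..})"
      by (rule measurable_restrict_space1[OF rfde_form_measurable])
    then show ?thesis
      by (rule measurable_cong[THEN iffD1, rotated])
         (simp add: space_restrict_space operator_form_def rfde_form_eq)
  qed
  have "1 \<le> growth_factor \<zeta>"
    using growth_rate_pos[of \<zeta>] one_le_exp_iff[of "growth_rate \<zeta>"] unfolding growth_factor_def by linarith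
  then show "\<exists>M \<omega>. 1 \<le> M \<and>
      (\<forall>t\<ge>0. \<forall>d y. \<bar>operator_form nbv_pairing (rfde_semigroup \<zeta> t) d y\<bar> \<le> M * exp (\<omega> * t) * norm y * norm d) \<and>
      (\<forall>z. \<omega> < Re z \<longrightarrow> has_laplace_twin_operator nbv_pairing (\<lambda>t. operator_form nbv_pairing (rfde_semigroup \<zeta> t)) z)"
    using has_laplace_twin_operator_rfde[of \<zeta>]
    by (intro exI[of _ "growth_factor \<zeta>"] exI[of _ "growth_rate \<zeta>"])
       (auto simp: operator_form_def intro: rfde_form_bound)
qed

theorem theorem4p4:
  fixes \<zeta> :: "(real ^ 'n ^ 'n) nbv"
  shows "norming_dual_pair (nbv_pairing :: (real ^ 'n) nbv \<Rightarrow> (real ^ 'n) bounded_borel \<Rightarrow> real) \<and>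
    twin_semigroup nbv_pairing (\<lambda>t. operator_form nbv_pairing (rfde_semigroup \<zeta> t))"
  using norming_dual_pair_nbv_pairing twin_semigroup_rfde by blast

end
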